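(* Let $n\ge1$ be an integer, and let $\nu=e/f>0$ be a rational number with $e,f\in\mathbb{N}$, $\gcd(e,f)=1$. Let $\alpha\in(0,2)$ be an irrational number which is not a Liouville number. Then the power series $$A_{1;\alpha,\nu,n}(z)=\sum_{l=0}^\infty\frac{(-1)^l}{l!}\Gamma(\nu+l)\frac{\Gamma\left(\frac{n-\alpha(\nu+l)}{2}\right)}{\Gamma\left(\frac{\alpha(\nu+l)}{2}\right)}\frac{z^l}{2^{\alpha l}},$$ $$A_{2;\alpha,\nu,n}(z)=\frac2\alpha\sum_{j=0}^\infty\frac{(-1)^j}{j!}\frac{\Gamma\left(\frac{n+2j}{\alpha}\right)}{\Gamma\left(\frac{n+2j}{2}\right)}\Gamma\left(\frac{\alpha\nu-n-2j}{\alpha}\right)\frac{z^j}{2^{2j}}$$ converge absolutely for all $z\in\mathbb{C}$ (so they define entire functions), and for $r>0$ $$q_{\alpha,\nu,n}(r)=\frac{1}{2^n\pi^{\frac n2}\Gamma(\nu)}\left\{\frac{r^{\alpha\nu-n}}{2^{\alpha\nu-n}}A_{1;\alpha,\nu,n}(r^\alpha)+A_{2;\alpha,\nu,n}(r^2)\right\}.$$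
   Context: $\Vert\cdot\Vert$ is the Euclidean norm on $\mathbb{R}^n$. For an integer $n\ge1$, $\alpha\in(0,2]$, $\nu>0$, $p_{\alpha,\nu,n}$ denotes the probability density function on $\mathbb{R}^n$ whose characteristic function is $\int_{\mathbb{R}^n}e^{i\mathbf{x}\cdot\boldsymbol{t}}p_{\alpha,\nu,n}(\mathbf{x})\,d^n\mathbf{x}=(1+\Vert\boldsymbol{t}\Vert^\alpha)^{-\nu}$ for all $\boldsymbol{t}\in\mathbb{R}^n$. It is a radial function; one takes the version which is continuous on $\mathbb{R}^n\setminus\{\mathbf{0}\}$, and $q_{\alpha,\nu,n}(r)$, $r>0$, denotes the value of $p_{\alpha,\nu,n}(\mathbf{x})$ at points with $\Vert\mathbf{x}\Vert=r$. $\mathbb{N}=\{1,2,\ldots\}$. An irrational number $\beta$ is called a Liouville number if for every $m=2,3,\ldots$ there exist integers $p,q$ with $q\ge2$ such that $\left|\beta-\frac pq\right|\le\frac{1}{q^m}$. *)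

theory Defs
  imports "HOL-Probability.Probability"
begin

definition liouville_number :: "real \<Rightarrow> bool" where
  "liouville_number \<beta> \<longleftrightarrow> \<beta> \<notin> \<rat> \<and>
     (\<forall>m::nat. 2 \<le> m \<longrightarrow>
        (\<exists>p q :: int. 2 \<le> q \<and> \<bar>\<beta> - of_int p / of_int q\<bar> \<le> 1 / of_int q ^ m))"

(* The value at the origin is only required to be nonnegative: the density may be
   unbounded there, and away from the origin continuity determines it. *)
definition linnik_density :: "real \<Rightarrow> real \<Rightarrow> (real ^ 'n \<Rightarrow> real) \<Rightarrow> bool" where
  "linnik_density \<alpha> \<nu> p \<longleftrightarrow>
     p \<in> borel_measurable borel \<and> (\<forall>x. 0 \<le> p x) \<and>
     prob_space (density lborel (\<lambda>x. ennreal (p x))) \<and>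
     (\<forall>t. (\<integral>x. exp (\<i> * complex_of_real (x \<bullet> t)) * complex_of_real (p x) \<partial>lborel) =
          complex_of_real ((1 + norm t powr \<alpha>) powr (- \<nu>))) \<and>
     continuous_on (- {0}) p"

(* The common value of p on the sphere of radius r; unspecified if p is not constant there. *)
definition radial_part :: "(real ^ 'n \<Rightarrow> real) \<Rightarrow> real \<Rightarrow> real" where
  "radial_part p r = (THE y. \<forall>x. norm x = r \<longrightarrow> p x = y)"

(* The library sets Gamma to 0 at its poles. When \<alpha> is irrational and \<nu> > 0 is rational,
   no Gamma argument in the two series below is a pole. *)
definition A1_term :: "real \<Rightarrow> real \<Rightarrow> nat \<Rightarrow> complex \<Rightarrow> nat \<Rightarrow> complex" where
  "A1_term \<alpha> \<nu> n z l =
     complex_of_real ((- 1) ^ l / fact l * Gamma (\<nu> + real l) *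
       (Gamma ((real n - \<alpha> * (\<nu> + real l)) / 2) / Gamma (\<alpha> * (\<nu> + real l) / 2))) *
     (z ^ l / complex_of_real (2 powr (\<alpha> * real l)))"

definition A1 :: "real \<Rightarrow> real \<Rightarrow> nat \<Rightarrow> complex \<Rightarrow> complex" where
  "A1 \<alpha> \<nu> n z = (\<Sum>l. A1_term \<alpha> \<nu> n z l)"

definition A2_term :: "real \<Rightarrow> real \<Rightarrow> nat \<Rightarrow> complex \<Rightarrow> nat \<Rightarrow> complex" where
  "A2_term \<alpha> \<nu> n z j =
     complex_of_real ((- 1) ^ j / fact j *
       (Gamma ((real n + 2 * real j) / \<alpha>) / Gamma ((real n + 2 * real j) / 2)) *
       Gamma ((\<alpha> * \<nu> - real n - 2 * real j) / \<alpha>)) *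
     (z ^ j / 2 ^ (2 * j))"

definition A2 :: "real \<Rightarrow> real \<Rightarrow> nat \<Rightarrow> complex \<Rightarrow> complex" where
  "A2 \<alpha> \<nu> n z = complex_of_real (2 / \<alpha>) * (\<Sum>j. A2_term \<alpha> \<nu> n z j)"

end

(*
  Write a = alpha/2, h(x) = (1 + x^a)^(-nu), so that the characteristic function is
  h(|t|^2), and let S(u) = sum_l c_l u^(a(nu+l)-1) be the termwise inverse Laplace transform
  of the binomial series of h at infinity.  S(u) is a power of u times an entire function of u^a,
  but its Laplace transform is only known to be h for x > 1.  Hence split h = high + low with
  high(x) = integral_0^1 S(u) exp(-xu) du; then low(x) decays like exp(-x).

  - Smoothing p with a Gaussian and letting its variance tend to 0 expresses p(x), for x nonzero, by
    an integral of S over (0,1] against heat kernels plus the Fourier integral of low(|t|^2).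
  - Integrated term by term, S contributes the residual gamma functions of A1 and, for every
    pair (l,j), a term with denominator a(nu+l) - (n/2+j); the Fourier integral contributes a power
    series in |x|^2 with the Mellin moments of low as coefficients.
  - For fixed j the terms with these denominators complete the j-th Mellin moment of low to the
    analytically continued Mellin transform of h, a product of gamma functions: this is A2.
  - The Diophantine hypothesis bounds the denominators from below by a power of 1/(1+l), so
    the double series converges absolutely; the convergence of A1 and A2 is a by-product.
*)
theory Submission
  imports Defs
begin

text \<open>With b = |x|^2 / 4, everything rests on one double series with terms c_l (-b)^j / (j!
  (a(\<nu>+l) - n/2 - j)). Each sum over j is an integral over (0,1] minus a complete gamma
  function, and the latter is the A1 term. Each sum over l is a Mellin moment and produces the A2
  term minus the share of \<open>low\<close>. The formula is thus a single exchange of summations,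
  and no contour integral occurs. A zero denominator would mean \<alpha> (\<nu>+l) = n + 2j,
  impossible for irrational \<alpha> and rational \<nu>. The lower bound for the denominators costs
  a polynomial in l only, which the factor 1/Gamma in c_l absorbs. The binomial series at infinity
  converges for x > 1 only and uniformly only away from 1. Therefore the moment integrals are cut at
  x = 2, and what happens at x = 2 has to cancel in the end. Both one-parameter families of
  integrals are known in closed form only on a half-line of the parameter; recursions obtained by
  partial integration replace analytic continuation.\<close>

section \<open>Integrals of powers and exponentials\<close>

lemma set_integral_nonneg_has_integral:
  fixes f :: "real \<Rightarrow> real"
  assumes [measurable]: "f \<in> borel_measurable borel" "A \<in> sets borel"
    and nonneg: "\<And>x. x \<in> A \<Longrightarrow> 0 \<le> f x" and I: "(f has_integral I) A"
  shows "set_integrable lborel A f" "(LINT x:A|lborel. f x) = I"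
proof -
  have "f absolutely_integrable_on A"
    using I nonneg by (intro nonnegative_absolutely_integrable_1) (auto simp: integrable_on_def)
  then show *: "set_integrable lborel A f"
    unfolding set_integrable_def by (subst (asm) integrable_completion) auto
  show "(LINT x:A|lborel. f x) = I"
    using set_borel_integral_eq_integral(2)[OF *] I by (simp add: integral_unique)
qed

text \<open>The product bound \<open>B l * G x\<close> makes the sum of the L1 norms finite. The
  measure is left general because the counting measure turns this into an exchange of two
  summations, see \<open>suminf_swap_dominated\<close>.\<close>

lemma sums_set_integral_dominated:
  fixes f :: "nat \<Rightarrow> 'a \<Rightarrow> 'b::{banach, second_countable_topology}"
  assumes meas [measurable]: "\<And>l. f l \<in> borel_measurable M" "A \<in> sets M"
    and bound: "\<And>l x. x \<in> A \<Longrightarrow> norm (f l x) \<le> B l * G x"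
    and B: "summable B" and G: "set_integrable M A G"
  shows "set_integrable M A (\<lambda>x. \<Sum>l. f l x)"
    and "(\<lambda>l. LINT x:A|M. f l x) sums (LINT x:A|M. (\<Sum>l. f l x))"
    and "summable (\<lambda>l. norm (LINT x:A|M. f l x))"
    and "\<And>l. set_integrable M A (f l)"
proof -
  let ?f = "\<lambda>l x. indicator A x *\<^sub>R f l x"
  have int: "integrable M (?f l)" for l
  proof (rule Bochner_Integration.integrable_bound)
    show "integrable M (\<lambda>x. B l * (indicator A x *\<^sub>R G x))"
      using G by (intro integrable_mult_right) (auto simp: set_integrable_def)
    show "AE x in M. norm (?f l x) \<le> norm (B l * (indicator A x *\<^sub>R G x))"
      using bound[of _ l] by (intro AE_I2) (fastforce simp: indicator_def)
  qed auto
  then show "set_integrable M A (f l)" for l by (simp add: set_integrable_def)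
  have sp: "summable (\<lambda>l. norm (?f l x))" for x
  proof (rule summable_comparison_test')
    show "summable (\<lambda>l. B l * (indicator A x * G x))" by (intro summable_mult2 B)
    show "norm (norm (?f n x)) \<le> B n * (indicator A x * G x)" for n
      using bound[of x n] by (auto simp: indicator_def)
  qed
  have bd: "(\<integral>x. norm (?f l x) \<partial>M) \<le> B l * (LINT x:A|M. G x)" for l
  proof -
    have "(\<integral>x. norm (?f l x) \<partial>M) \<le> (\<integral>x. B l * (indicator A x *\<^sub>R G x) \<partial>M)"
    proof (rule integral_mono)
      show "integrable M (\<lambda>x. norm (?f l x))" using int by (rule integrable_norm)
      show "integrable M (\<lambda>x. B l * (indicator A x *\<^sub>R G x))"
        using G by (intro integrable_mult_right) (auto simp: set_integrable_def)
      show "norm (?f l x) \<le> B l * (indicator A x *\<^sub>R G x)" for x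
        using bound[of x l] by (auto simp: indicator_def)
    qed
    then show ?thesis by (simp add: set_lebesgue_integral_def)
  qed
  have si: "summable (\<lambda>l. \<integral>x. norm (?f l x) \<partial>M)"
  proof (rule summable_comparison_test')
    show "summable (\<lambda>l. B l * (LINT x:A|M. G x))" by (intro summable_mult2 B)
    show "norm (\<integral>x. norm (?f l x) \<partial>M) \<le> B l * (LINT x:A|M. G x)" for l
      using bd[of l] by simp
  qed
  have eq: "(\<Sum>l. ?f l x) = indicator A x *\<^sub>R (\<Sum>l. f l x)" for x
    by (cases "x \<in> A") auto
  note * = integrable_suminf[OF int AE_I2[OF sp] si] sums_integral[OF int AE_I2[OF sp] si]
  show "set_integrable M A (\<lambda>x. \<Sum>l. f l x)"
    using *(1) by (simp add: eq set_integrable_def)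
  show "(\<lambda>l. LINT x:A|M. f l x) sums (LINT x:A|M. (\<Sum>l. f l x))"
    using *(2) by (simp add: eq set_lebesgue_integral_def)
  show "summable (\<lambda>l. norm (LINT x:A|M. f l x))"
  proof (rule summable_comparison_test'[OF si])
    show "norm (norm (LINT x:A|M. f l x)) \<le> (\<integral>x. norm (?f l x) \<partial>M)" for l
      unfolding set_lebesgue_integral_def by (simp del: norm_scaleR)
  qed
qed

text \<open>For nonnegative \<open>f\<close> the norm in Fubini's criterion disappears, so the
  iterated integral in one order, usually known in closed form, certifies integrability and value in
  the other order.\<close>

lemma Tonelli_set_integral:
  fixes f :: "real \<Rightarrow> real \<Rightarrow> real"
  assumes meas [measurable]: "(\<lambda>p. f (fst p) (snd p)) \<in> borel_measurable (borel \<Otimes>\<^sub>M borel)"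
      "A \<in> sets borel" "B \<in> sets borel"
    and nonneg: "\<And>x y. x \<in> A \<Longrightarrow> y \<in> B \<Longrightarrow> 0 \<le> f x y"
    and int1: "\<And>x. x \<in> A \<Longrightarrow> set_integrable lborel B (f x)"
    and int2: "set_integrable lborel A (\<lambda>x. LINT y:B|lborel. f x y)"
  shows "set_integrable lborel B (\<lambda>y. LINT x:A|lborel. f x y)"
    and "(LINT y:B|lborel. LINT x:A|lborel. f x y) = (LINT x:A|lborel. LINT y:B|lborel. f x y)"
proof -
  define F where "F x y = (indicator A x * indicator B y) *\<^sub>R f x y" for x y
  have F: "integrable (lborel \<Otimes>\<^sub>M lborel) (case_prod F)"
  proof (rule lborel_pair.Fubini_integrable)
    show "case_prod F \<in> borel_measurable (lborel \<Otimes>\<^sub>M lborel)"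
      unfolding F_def case_prod_beta by measurable
    have "(\<lambda>x. \<integral>y. norm (F x y) \<partial>lborel) = (\<lambda>x. indicator A x *\<^sub>R (LINT y:B|lborel. f x y))"
    proof
      fix x
      have "norm (F x y) = indicator A x * (indicator B y *\<^sub>R f x y)" for y
        using nonneg[of x y] by (auto simp: F_def indicator_def)
      then show "(\<integral>y. norm (F x y) \<partial>lborel) = indicator A x *\<^sub>R (LINT y:B|lborel. f x y)"
        by (simp add: set_lebesgue_integral_def)
    qed
    then show "integrable lborel (\<lambda>x. \<integral>y. norm (case_prod F (x, y)) \<partial>lborel)"
      using int2 by (simp add: set_integrable_def)
    show "AE x in lborel. integrable lborel (\<lambda>y. case_prod F (x, y))"
    proof (rule AE_I2)
      fix x
      show "integrable lborel (\<lambda>y. case_prod F (x, y))"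
        using int1[of x] by (cases "x \<in> A") (auto simp: F_def set_integrable_def)
    qed
  qed
  have 1: "(\<integral>y. F x y \<partial>lborel) = indicator A x *\<^sub>R (LINT y:B|lborel. f x y)" for x
    by (simp add: F_def set_lebesgue_integral_def mult.assoc flip: scaleR_scaleR)
  have 2: "(\<integral>x. F x y \<partial>lborel) = indicator B y *\<^sub>R (LINT x:A|lborel. f x y)" for y
  proof -
    have "(\<lambda>x. F x y) = (\<lambda>x. indicator B y *\<^sub>R (indicator A x *\<^sub>R f x y))"
      by (auto simp: F_def indicator_def)
    then show ?thesis by (simp add: set_lebesgue_integral_def)
  qed
  show "set_integrable lborel B (\<lambda>y. LINT x:A|lborel. f x y)"
    using lborel_pair.integrable_snd[OF F] by (simp add: 2 set_integrable_def)
  show "(LINT y:B|lborel. LINT x:A|lborel. f x y) = (LINT x:A|lborel. LINT y:B|lborel. f x y)"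
    using lborel_pair.Fubini_integral[OF F] by (simp add: 1 2 set_lebesgue_integral_def)
qed

section \<open>Power and gamma integrals\<close>

lemma integral_powr_Ioc:
  fixes a c :: real
  assumes "0 < a" "0 < c"
  shows "set_integrable lborel {0<..c} (\<lambda>x. x powr (a - 1))"
    and "(LINT x:{0<..c}|lborel. x powr (a - 1)) = c powr a / a"
proof -
  have "((\<lambda>x. x powr (a - 1)) has_integral (c powr a / a)) {0..c}"
    using has_integral_powr_from_0[of "a - 1" c] assms by simp
  then have *: "((\<lambda>x. x powr (a - 1)) has_integral (c powr a / a)) {0<..c}"
    by (subst (asm) has_integral_spike_set_eq[of _ "{0<..c}"]) (auto intro: negligible_subset[of "{0}"])
  show "set_integrable lborel {0<..c} (\<lambda>x. x powr (a - 1))"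
    "(LINT x:{0<..c}|lborel. x powr (a - 1)) = c powr a / a"
    by (rule set_integral_nonneg_has_integral[OF _ _ _ *]; simp)+
qed

lemma integral_powr_Ioi:
  fixes s c :: real
  assumes "0 < s" "0 < c"
  shows "set_integrable lborel {c<..} (\<lambda>x. x powr (- s - 1))"
    and "(LINT x:{c<..}|lborel. x powr (- s - 1)) = c powr (- s) / s"
proof -
  have "((\<lambda>x. x powr (- s - 1)) has_integral (c powr (- s) / s)) {c..}"
    using has_integral_powr_to_inf[of "- s - 1" c] assms by simp
  then have *: "((\<lambda>x. x powr (- s - 1)) has_integral (c powr (- s) / s)) {c<..}"
    by (subst (asm) has_integral_spike_set_eq[of _ "{c<..}"]) (auto intro: negligible_subset[of "{c}"])
  show "set_integrable lborel {c<..} (\<lambda>x. x powr (- s - 1))"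
    "(LINT x:{c<..}|lborel. x powr (- s - 1)) = c powr (- s) / s"
    by (rule set_integral_nonneg_has_integral[OF _ _ _ *]; simp)+
qed

text \<open>Substitution t = c x^q in the gamma integral. The sign of \<open>q\<close> is left free
  because three cases are needed: q = 1, q = \<open>a\<close>, and q = -1 for exp(-c/u).\<close>

lemma integral_powr_exp_powr:
  fixes p q c :: real
  assumes c: "0 < c" and pq: "0 < p / q"
  shows "set_integrable lborel {0<..} (\<lambda>x. x powr (p - 1) * exp (- c * x powr q))"
    and "(LINT x:{0<..}|lborel. x powr (p - 1) * exp (- c * x powr q)) =
      Gamma (p / q) * c powr (- (p / q)) / \<bar>q\<bar>"
proof -
  let ?s = "p / q"
  let ?f = "\<lambda>t::real. t powr (?s - 1) * exp (- t)"
  let ?g = "\<lambda>x::real. c * x powr q"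
  have q: "q \<noteq> 0" using pq by auto
  have im: "?g ` {0<..} = {0<..}"
  proof (intro equalityI subsetI)
    fix y :: real assume y: "y \<in> {0<..}"
    have "y = ?g ((y / c) powr (1 / q))"
      using y c q by (simp add: powr_powr)
    moreover have "(y / c) powr (1 / q) \<in> {0<..}" using y c by simp
    ultimately show "y \<in> ?g ` {0<..}" by (rule image_eqI)
  qed (use c in auto)
  have inj: "inj_on ?g {0<..}"
  proof (rule inj_onI)
    fix x y :: real assume xy: "x \<in> {0<..}" "y \<in> {0<..}" "?g x = ?g y"
    then have "x powr q = y powr q" using c by simp
    then have "(x powr q) powr (1 / q) = (y powr q) powr (1 / q)" by simp
    then show "x = y" using xy q by (simp add: powr_powr)
  qed
  have "((\<lambda>t. t powr (?s - 1) / exp t) has_integral Gamma ?s) {0..}"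
    using pq by (rule Gamma_integral_real)
  then have f: "(?f has_integral Gamma ?s) {0<..}"
    by (subst (asm) has_integral_spike_set_eq[of _ "{0<..}"])
      (auto simp: exp_minus field_simps intro: negligible_subset[of "{0}"])
  then have "?f absolutely_integrable_on {0<..}"
    by (intro nonnegative_absolutely_integrable_1) (auto simp: integrable_on_def)
  moreover have "integral {0<..} ?f = Gamma ?s" using f by (rule integral_unique)
  moreover have "(?g has_field_derivative (c * (q * x powr (q - 1)))) (at x within {0<..})"
    if "x \<in> {0<..}" for x
    using that by (auto intro!: derivative_eq_intros)
  ultimately have cv: "(\<lambda>x. \<bar>c * (q * x powr (q - 1))\<bar> * ?f (?g x)) absolutely_integrable_on {0<..} \<and>
      integral {0<..} (\<lambda>x. \<bar>c * (q * x powr (q - 1))\<bar> * ?f (?g x)) = Gamma ?s"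
    using has_absolute_integral_change_of_variables_1'[of "{0<..}" ?g
        "\<lambda>x. c * (q * x powr (q - 1))" ?f "Gamma ?s"] inj im
    by auto
  have eq: "\<bar>c * (q * x powr (q - 1))\<bar> * ?f (?g x) =
      (\<bar>q\<bar> * c powr ?s) * (x powr (p - 1) * exp (- c * x powr q))" if x: "0 < x" for x
  proof -
    have "c * c powr (?s - 1) = c powr ?s"
      using c by (simp add: powr_diff)
    moreover have "x powr (q - 1) * (x powr q) powr (?s - 1) = x powr (p - 1)"
      using q by (simp add: powr_powr algebra_simps flip: powr_add)
    ultimately show ?thesis
      using c x by (simp add: abs_mult powr_mult mult_ac)
  qed
  have "((\<lambda>x. \<bar>c * (q * x powr (q - 1))\<bar> * ?f (?g x)) has_integral Gamma ?s) {0<..}"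
    using cv by (auto simp: has_integral_iff absolutely_integrable_on_def)
  then have K: "((\<lambda>x. (\<bar>q\<bar> * c powr ?s) * (x powr (p - 1) * exp (- c * x powr q))) has_integral Gamma ?s) {0<..}"
    by (rule has_integral_eq[rotated]) (use eq in auto)
  have "((\<lambda>x. x powr (p - 1) * exp (- c * x powr q)) has_integral
      (1 / (\<bar>q\<bar> * c powr ?s)) * Gamma ?s) {0<..}"
    by (rule has_integral_eq[OF _ has_integral_mult_right[OF K, of "1 / (\<bar>q\<bar> * c powr ?s)"]])
      (use c q in auto)
  moreover have "(1 / (\<bar>q\<bar> * c powr ?s)) * Gamma ?s = Gamma (p / q) * c powr (- (p / q)) / \<bar>q\<bar>"
    using c by (simp add: powr_minus field_simps)
  ultimately have *: "((\<lambda>x. x powr (p - 1) * exp (- c * x powr q)) has_integral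
      (Gamma (p / q) * c powr (- (p / q)) / \<bar>q\<bar>)) {0<..}" by simp
  show "set_integrable lborel {0<..} (\<lambda>x. x powr (p - 1) * exp (- c * x powr q))"
    "(LINT x:{0<..}|lborel. x powr (p - 1) * exp (- c * x powr q)) =
      Gamma (p / q) * c powr (- (p / q)) / \<bar>q\<bar>"
    by (rule set_integral_nonneg_has_integral[OF _ _ _ *]; simp)+
qed

lemma set_integral_FTC_Ioc:
  fixes F f :: "real \<Rightarrow> real"
  assumes c: "0 < c"
    and deriv: "\<And>x. 0 < x \<Longrightarrow> (F has_real_derivative f x) (at x)"
    and cont: "continuous_on {0<..} f"
    and int: "set_integrable lborel {0<..c} f"
    and lim: "(F \<longlongrightarrow> 0) (at_right 0)"
  shows "(LINT x:{0<..c}|lborel. f x) = F c"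
proof -
  have "(LINT x:{0<..c}|lborel. f x) = (LBINT x=0..ereal c. f x)"
    using interval_integral_Ioc[of 0 c f] c by (simp add: zero_ereal_def)
  also have "\<dots> = F c - 0"
  proof (rule interval_integral_FTC_integrable)
    show "(F has_vector_derivative f x) (at x)" if "0 < ereal x" "ereal x < ereal c" for x
      using deriv[of x] that by (simp add: has_real_derivative_iff_has_vector_derivative zero_ereal_def)
    show "isCont f x" if "0 < ereal x" "ereal x < ereal c" for x
      using that cont by (auto simp: zero_ereal_def continuous_on_eq_continuous_at)
    show "set_integrable lborel (einterval 0 (ereal c)) f"
      by (rule set_integrable_subset[OF int]) (auto simp: zero_ereal_def einterval_eq)
    show "((F \<circ> real_of_ereal) \<longlongrightarrow> 0) (at_right 0)"
      using lim by (simp add: zero_ereal_def ereal_tendsto_simps1)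
    have "(F \<longlongrightarrow> F c) (at_left c)"
      using DERIV_isCont[OF deriv[OF c]] by (auto simp: isCont_def intro: filterlim_mono[OF _ order_refl at_le])
    then show "((F \<circ> real_of_ereal) \<longlongrightarrow> F c) (at_left (ereal c))"
      by (simp add: ereal_tendsto_simps1)
  qed (use c in simp)
  finally show ?thesis by simp
qed

section \<open>Powers against exp(-b/u) on (0,1]\<close>

lemma summable_power_div_fact: "summable (\<lambda>j. b ^ j / fact j :: real)"
  using summable_exp[of b] by (simp add: field_simps)

lemma sums_exp_real: "(\<lambda>j. b ^ j / fact j) sums exp (b::real)"
  using exp_converges[of b] by (simp add: field_simps)

lemma set_integrable_powr_exp_inverse:
  fixes b d :: real
  assumes b: "0 < b"
  shows "set_integrable lborel {0<..1} (\<lambda>u. u powr (d - 1) * exp (- b / u))"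
proof -
  \<comment> \<open>For a negative exponent the integral converges even over (0, infinity), by q =
    -1 in \<open>integral_powr_exp_powr\<close>; on (0,1] lowering the exponent only enlarges the
    integrand.\<close>
  define m where "m = min d (- 1)"
  have "set_integrable lborel {0<..} (\<lambda>u. u powr (m - 1) * exp (- b * u powr - 1))"
    by (rule integral_powr_exp_powr(1)[OF b]) (simp add: m_def)
  then have "set_integrable lborel {0<..1} (\<lambda>u. u powr (m - 1) * exp (- b * u powr - 1))"
    by (rule set_integrable_subset) auto
  then show ?thesis
  proof (rule set_integrable_bound)
    show "set_borel_measurable lborel {0<..1} (\<lambda>u. u powr (d - 1) * exp (- b / u))"
      unfolding set_borel_measurable_def by measurable
    have "u powr (d - 1) * exp (- b / u) \<le> u powr (m - 1) * exp (- b * u powr - 1)"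
      if "u \<in> {0<..1}" for u
    proof -
      have "u powr (d - 1) \<le> u powr (m - 1)"
        using that by (intro powr_mono') (auto simp: m_def)
      then show ?thesis using that by (simp add: powr_minus divide_inverse)
    qed
    then show "AE u in lborel. u \<in> {0<..1} \<longrightarrow> norm (u powr (d - 1) * exp (- b / u)) \<le>
        norm (u powr (m - 1) * exp (- b * u powr - 1))"
      by (intro AE_I2) auto
  qed
qed

lemma tendsto_powr_exp_inverse_at_right_0:
  fixes b d :: real
  assumes b: "0 < b"
  shows "((\<lambda>u. u powr d * exp (- b / u)) \<longlongrightarrow> 0) (at_right 0)"
  using b by real_asymp

text \<open>The two integrands together are the derivative of u^d exp(-b/u). This vanishes at 0+ for
  every real \<open>d\<close>, since exp(-b/u) beats any power, so the relation leads from negative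
  to positive \<open>d\<close>.\<close>

lemma integral_powr_exp_inverse_rec:
  fixes b d :: real
  assumes b: "0 < b"
  shows "d * (LINT u:{0<..1}|lborel. u powr (d - 1) * exp (- b / u)) +
      b * (LINT u:{0<..1}|lborel. u powr (d - 1 - 1) * exp (- b / u)) = exp (- b)"
proof -
  let ?f = "\<lambda>u::real. d * (u powr (d - 1) * exp (- b / u)) + b * (u powr (d - 1 - 1) * exp (- b / u))"
  note int = set_integrable_powr_exp_inverse[OF b]
  have "(LINT u:{0<..1}|lborel. ?f u) = 1 powr d * exp (- b / 1)"
  proof (rule set_integral_FTC_Ioc)
    show "((\<lambda>u. u powr d * exp (- b / u)) has_real_derivative ?f u) (at u)" if "0 < u" for u
    proof -
      have "((\<lambda>u. u powr d * exp (- b / u)) has_real_derivative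
          d * u powr (d - 1) * exp (- b / u) + u powr d * (exp (- b / u) * (b / u\<^sup>2))) (at u)"
        using that by (auto intro!: derivative_eq_intros simp: power2_eq_square)
      moreover have "u powr (d - 1 - 1) = u powr d / u\<^sup>2"
        using that by (simp add: powr_diff power2_eq_square)
      ultimately show ?thesis by (simp add: field_simps)
    qed
    show "continuous_on {0<..} ?f" by (auto intro!: continuous_intros)
    show "set_integrable lborel {0<..1} ?f"
      by (intro set_integral_add set_integrable_mult_right int)
    show "((\<lambda>u. u powr d * exp (- b / u)) \<longlongrightarrow> 0) (at_right 0)"
      by (rule tendsto_powr_exp_inverse_at_right_0[OF b])
  qed simp
  moreover have "(LINT u:{0<..1}|lborel. ?f u) =
      d * (LINT u:{0<..1}|lborel. u powr (d - 1) * exp (- b / u)) +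
      b * (LINT u:{0<..1}|lborel. u powr (d - 1 - 1) * exp (- b / u))"
    using int[of d] int[of "d - 1"] by (subst set_integral_add) (auto intro: set_integrable_mult_right simp del: diff_diff_eq2)
  ultimately show ?thesis by simp
qed

text \<open>Termwise integration over (0,1] is impossible, as u^(d-j-1) is not integrable at 0.
  Instead the complement u > 1 is expanded: there exp(-b/u) is a power series in 1/u dominated by
  b^j/j!, and the j-th integral is 1/(j-d). The integral over (0, infinity) supplies the gamma
  term.\<close>

lemma integral_powr_exp_inverse_sums_neg:
  fixes b d :: real
  assumes b: "0 < b" and d: "d < 0"
  shows "(\<lambda>j. (- b) ^ j / fact j / (d - real j)) sums
      ((LINT u:{0<..1}|lborel. u powr (d - 1) * exp (- b / u)) - b powr d * Gamma (- d))"
proof -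
  let ?F = "\<lambda>u. u powr (d - 1) * exp (- b / u)"
  let ?f = "\<lambda>j u. (- b) ^ j / fact j * (u powr (d - real j - 1))"
  have eq: "u powr (d - 1) * exp (- b * u powr - 1) = ?F u" if "u \<in> {0<..}" for u
    using that by (simp add: powr_minus divide_inverse)
  have int: "set_integrable lborel {0<..} ?F"
  proof -
    have "set_integrable lborel {0<..} (\<lambda>u. u powr (d - 1) * exp (- b * u powr - 1))"
      by (rule integral_powr_exp_powr(1)[OF b]) (use d in simp)
    also have "?this \<longleftrightarrow> ?thesis" by (rule set_integrable_cong[OF refl refl eq])
    finally show ?thesis .
  qed
  have val: "(LINT u:{0<..}|lborel. ?F u) = Gamma (- d) * b powr d"
  proof -
    have "(LINT u:{0<..}|lborel. ?F u) = (LINT u:{0<..}|lborel. u powr (d - 1) * exp (- b * u powr - 1))"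
      by (rule set_lebesgue_integral_cong) (use eq in auto)
    also have "\<dots> = Gamma (d / - 1) * b powr (- (d / - 1)) / \<bar>- 1\<bar>"
      by (rule integral_powr_exp_powr(2)[OF b]) (use d in simp)
    finally show ?thesis by simp
  qed
  have split: "(LINT u:{0<..}|lborel. ?F u) = (LINT u:{0<..1}|lborel. ?F u) + (LINT u:{1<..}|lborel. ?F u)"
  proof -
    have U: "{0<..1} \<union> {1<..} = {0::real<..}" by auto
    have "(LINT u:{0<..1} \<union> {1<..}|lborel. ?F u) = (LINT u:{0<..1}|lborel. ?F u) + (LINT u:{1<..}|lborel. ?F u)"
    proof (rule set_integral_Un)
      show "set_integrable lborel {0<..1} ?F" by (rule set_integrable_subset[OF int]) auto
      show "set_integrable lborel {1<..} ?F" by (rule set_integrable_subset[OF int]) auto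
    qed auto
    then show ?thesis unfolding U .
  qed
  have pw: "set_integrable lborel {1<..} (\<lambda>u. u powr (d - real j - 1))"
    "(LINT u:{1<..}|lborel. u powr (d - real j - 1)) = 1 / (real j - d)" for j
  proof -
    have "- (real j - d) - 1 = d - real j - 1" by simp
    then show "set_integrable lborel {1<..} (\<lambda>u. u powr (d - real j - 1))"
      "(LINT u:{1<..}|lborel. u powr (d - real j - 1)) = 1 / (real j - d)"
      using integral_powr_Ioi[of "real j - d" 1] d by (simp_all only:) auto
  qed
  have "(\<lambda>j. LINT u:{1<..}|lborel. ?f j u) sums (LINT u:{1<..}|lborel. (\<Sum>j. ?f j u))"
  proof (rule sums_set_integral_dominated(2)[where B = "\<lambda>j. b ^ j / fact j" and G = "\<lambda>u. u powr (d - 1)"])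
    show "summable (\<lambda>j. b ^ j / fact j)" by (rule summable_power_div_fact)
    show "set_integrable lborel {1<..} (\<lambda>u. u powr (d - 1))" using pw(1)[of 0] by simp
    show "norm (?f j u) \<le> b ^ j / fact j * u powr (d - 1)" if "u \<in> {1<..}" for j u
      using b that by (auto simp: abs_mult power_abs intro!: mult_left_mono divide_right_mono powr_mono)
  qed auto
  moreover have "(LINT u:{1<..}|lborel. (\<Sum>j. ?f j u)) = (LINT u:{1<..}|lborel. ?F u)"
  proof (rule set_lebesgue_integral_cong)
    show "\<forall>u. u \<in> {1<..} \<longrightarrow> (\<Sum>j. ?f j u) = ?F u"
    proof (intro allI impI)
      fix u :: real assume u: "u \<in> {1<..}"
      have "(\<lambda>j. u powr (d - 1) * ((- b / u) ^ j / fact j)) sums ?F u"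
        by (intro sums_mult sums_exp_real)
      moreover have "u powr (d - 1) * ((- b / u) ^ j / fact j) = ?f j u" for j
      proof -
        have "u powr (d - real j - 1) = u powr (d - 1 - real j)" by (simp add: algebra_simps)
        also have "\<dots> = u powr (d - 1) / u ^ j" using u by (simp only: powr_diff) (simp add: powr_realpow)
        finally show ?thesis by (simp only: power_divide[of "- b" u]) (simp add: field_simps)
      qed
      ultimately show "(\<Sum>j. ?f j u) = ?F u" by (simp add: sums_iff)
    qed
  qed auto
  moreover have "(LINT u:{1<..}|lborel. ?F u) =
      b powr d * Gamma (- d) - (LINT u:{0<..1}|lborel. ?F u)"
    using split val by (simp add: mult.commute)
  moreover have "(LINT u:{1<..}|lborel. ?f j u) = - ((- b) ^ j / fact j / (d - real j))" for j
  proof -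
    have "d - real j = - (real j - d)" by simp
    then show ?thesis
      unfolding set_integral_mult_right pw(2) by (simp only: divide_minus_right minus_minus) simp
  qed
  ultimately have "(\<lambda>j. - ((- b) ^ j / fact j / (d - real j))) sums
      (b powr d * Gamma (- d) - (LINT u:{0<..1}|lborel. ?F u))"
    by simp
  from sums_minus[OF this] show ?thesis by simp
qed

text \<open>For d < 0 the integral also converges over (0, infinity), to b^d Gamma(-d); partial integration
  then raises d by one.\<close>

lemma integral_powr_exp_inverse_sums:
  fixes b d :: real
  assumes b: "0 < b" and d: "d \<notin> \<nat>"
  shows "(\<lambda>j. (- b) ^ j / fact j / (d - real j)) sums
      ((LINT u:{0<..1}|lborel. u powr (d - 1) * exp (- b / u)) - b powr d * Gamma (- d))"
proof -
  let ?I = "\<lambda>d. LINT u:{0<..1}|lborel. u powr (d - 1) * exp (- b / u)"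
  have "(\<lambda>j. (- b) ^ j / fact j / (d - real j)) sums (?I d - b powr d * Gamma (- d))"
    if "d < real m" "d \<notin> \<nat>" for m d
    using that
  proof (induction m arbitrary: d)
    case 0
    then show ?case using integral_powr_exp_inverse_sums_neg[OF b, of d] by simp
  next
    case (Suc m)
    define t where "t d j = (- b) ^ j / fact j / (d - real j)" for d j
    have d1: "d - 1 \<notin> \<nat>"
      using Suc.prems(2) Nats_add[of "d - 1" 1] by auto
    have d0: "d \<noteq> 0" using Suc.prems(2) by auto
    have dj: "d \<noteq> real j" for j using Suc.prems(2) by auto
    have IH: "t (d - 1) sums (?I (d - 1) - b powr (d - 1) * Gamma (- (d - 1)))"
      unfolding t_def using Suc.IH[of "d - 1"] Suc.prems d1 by simp
    \<comment> \<open>From d/(d-j) = 1 + j/(d-j): multiplied by (-b)^j/j!, the second summand is -b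
      times the term of index j-1 in the series for d-1. Hence the shift and the value 0 at j =
      0.\<close>
    define v where "v j = (case j of 0 \<Rightarrow> 0 | Suc i \<Rightarrow> - b * t (d - 1) i)" for j
    have "(\<lambda>i. v (Suc i)) sums (- b * (?I (d - 1) - b powr (d - 1) * Gamma (- (d - 1))))"
      using sums_mult[OF IH, of "- b"] by (simp add: v_def)
    then have v: "v sums (- b * (?I (d - 1) - b powr (d - 1) * Gamma (- (d - 1))))"
      by (subst (asm) sums_Suc_iff) (simp add: v_def)
    have "(\<lambda>j. (1 / d) * ((- b) ^ j / fact j + v j)) sums
        ((1 / d) * (exp (- b) + - b * (?I (d - 1) - b powr (d - 1) * Gamma (- (d - 1)))))"
      by (intro sums_mult sums_add sums_exp_real v)
    moreover have "(1 / d) * ((- b) ^ j / fact j + v j) = t d j" for j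
    proof (cases j)
      case (Suc i)
      define e B where "e = d - 1 - real i" and "B = - b * ((- b) ^ i / fact i)"
      have e: "e \<noteq> 0" "d = e + (1 + real i)" using dj[of "Suc i"] by (auto simp: e_def)
      have B: "(- b) ^ j / fact j = B / (1 + real i)" by (simp add: B_def Suc)
      have "(1 / (e + k)) * (B / k + B / e) = B / k / e" if "k \<noteq> 0" "e + k \<noteq> 0" for k
      proof -
        have "B / k + B / e = (e + k) * (B / k / e)" using that e(1) by (simp add: field_simps)
        then show ?thesis using that by simp
      qed
      from this[of "1 + real i"] have "(1 / d) * (B / (1 + real i) + B / e) = B / (1 + real i) / e"
        using e d0 by simp
      moreover have "v j = B / e" by (simp add: Suc v_def t_def B_def e_def)
      moreover have "t d j = B / (1 + real i) / e"
        unfolding t_def B by (simp add: e_def Suc)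
      ultimately show ?thesis unfolding B by simp
    qed (simp add: v_def t_def)
    moreover have "(1 / d) * (exp (- b) + - b * (?I (d - 1) - b powr (d - 1) * Gamma (- (d - 1)))) =
        ?I d - b powr d * Gamma (- d)"
    proof -
      have G: "Gamma (- (d - 1)) = - d * Gamma (- d)"
        using Gamma_plus1[of "- d"] Suc.prems(2)
        by (auto simp: nonpos_Ints_altdef Nats_altdef2)
      have "b * b powr (d - 1) = b powr d" using b by (simp add: powr_diff)
      then have "b * (b powr (d - 1) * Gamma (- (d - 1))) = - d * (b powr d * Gamma (- d))"
        unfolding G by (simp flip: mult.assoc)
      moreover have "exp (- b) - b * ?I (d - 1) = d * ?I d"
        using integral_powr_exp_inverse_rec[OF b, of d] by simp
      ultimately have "exp (- b) + - b * (?I (d - 1) - b powr (d - 1) * Gamma (- (d - 1))) =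
          d * (?I d - b powr d * Gamma (- d))"
        by (simp add: algebra_simps)
      then show ?thesis using d0 by simp
    qed
    ultimately have "t d sums (?I d - b powr d * Gamma (- d))" by (simp only:)
    then show ?case unfolding t_def .
  qed
  moreover obtain m :: nat where "d < real m" using reals_Archimedean2 by blast
  ultimately show ?thesis using d by blast
qed

section \<open>Truncated Laplace transforms of powers and their moments\<close>

lemma set_integral_Ioi_split:
  fixes f :: "real \<Rightarrow> real"
  assumes int: "set_integrable lborel {0<..} f" and c: "0 < c"
  shows "(LINT x:{0<..}|lborel. f x) = (LINT x:{0<..c}|lborel. f x) + (LINT x:{c<..}|lborel. f x)"
proof -
  have U: "{0<..c} \<union> {c<..} = {0<..}" using c by auto
  have "(LINT x:{0<..c} \<union> {c<..}|lborel. f x) = (LINT x:{0<..c}|lborel. f x) + (LINT x:{c<..}|lborel. f x)"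
  proof (rule set_integral_Un)
    show "set_integrable lborel {0<..c} f" by (rule set_integrable_subset[OF int]) auto
    show "set_integrable lborel {c<..} f" by (rule set_integrable_subset[OF int]) (use c in auto)
  qed auto
  then show ?thesis unfolding U .
qed

lemma integral_powr_exp:
  fixes p c :: real
  assumes "0 < p" "0 < c"
  shows "set_integrable lborel {0<..} (\<lambda>x. x powr (p - 1) * exp (- c * x))"
    and "(LINT x:{0<..}|lborel. x powr (p - 1) * exp (- c * x)) = Gamma p * c powr (- p)"
proof -
  have eq: "x powr (p - 1) * exp (- c * x powr 1) = x powr (p - 1) * exp (- c * x)" if "x \<in> {0<..}" for x
    using that by simp
  have "set_integrable lborel {0<..} (\<lambda>x. x powr (p - 1) * exp (- c * x powr 1))"
    by (rule integral_powr_exp_powr(1)) (use assms in auto)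
  also have "?this \<longleftrightarrow> set_integrable lborel {0<..} (\<lambda>x. x powr (p - 1) * exp (- c * x))"
    by (rule set_integrable_cong[OF refl refl eq])
  finally show "set_integrable lborel {0<..} (\<lambda>x. x powr (p - 1) * exp (- c * x))" .
  have "(LINT x:{0<..}|lborel. x powr (p - 1) * exp (- c * x)) =
      (LINT x:{0<..}|lborel. x powr (p - 1) * exp (- c * x powr 1))"
    by (rule set_lebesgue_integral_cong) (use eq in auto)
  also have "\<dots> = Gamma (p / 1) * c powr (- (p / 1)) / \<bar>1\<bar>"
    by (rule integral_powr_exp_powr(2)) (use assms in auto)
  finally show "(LINT x:{0<..}|lborel. x powr (p - 1) * exp (- c * x)) = Gamma p * c powr (- p)"
    by simp
qed

text \<open>For x > 0, with \<open>B\<close> equal to (0,1] or (1, infinity), this is x^(-a) times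
  the lower or upper incomplete gamma function at (a, x).\<close>

definition laplace_powr :: "real set \<Rightarrow> real \<Rightarrow> real \<Rightarrow> real" where
  "laplace_powr B a x = (LINT u:B|lborel. u powr (a - 1) * exp (- x * u))"

lemma borel_measurable_laplace_powr [measurable]:
  assumes [measurable]: "B \<in> sets borel"
  shows "laplace_powr B a \<in> borel_measurable borel"
  unfolding laplace_powr_def set_lebesgue_integral_def by measurable

lemma laplace_powr_nonneg: "0 \<le> laplace_powr B a x"
  unfolding laplace_powr_def set_lebesgue_integral_def by (intro Bochner_Integration.integral_nonneg) auto

lemma laplace_powr_add:
  assumes "0 < a" "0 < x"
  shows "laplace_powr {0<..1} a x + laplace_powr {1<..} a x = Gamma a * x powr (- a)"
  using set_integral_Ioi_split[OF integral_powr_exp(1)[OF assms], of 1] integral_powr_exp(2)[OF assms]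
  unfolding laplace_powr_def by simp

lemma laplace_powr_Ioc_le:
  assumes a: "0 < a" and x: "0 \<le> x"
  shows "set_integrable lborel {0<..1} (\<lambda>u. u powr (a - 1) * exp (- x * u))"
    and "laplace_powr {0<..1} a x \<le> 1 / a"
proof -
  note p = integral_powr_Ioc[OF a, of 1]
  have le: "u powr (a - 1) * exp (- x * u) \<le> u powr (a - 1)" if "u \<in> {0<..1}" for u
    using that x by (intro mult_left_le) auto
  show int: "set_integrable lborel {0<..1} (\<lambda>u. u powr (a - 1) * exp (- x * u))"
  proof (rule set_integrable_bound[OF p(1)])
    show "set_borel_measurable lborel {0<..1} (\<lambda>u. u powr (a - 1) * exp (- x * u))"
      unfolding set_borel_measurable_def by measurable
    show "AE u in lborel. u \<in> {0<..1} \<longrightarrow> norm (u powr (a - 1) * exp (- x * u)) \<le> norm (u powr (a - 1))"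
      using le by (intro AE_I2) auto
  qed simp
  have "laplace_powr {0<..1} a x \<le> (LINT u:{0<..1}|lborel. u powr (a - 1))"
    unfolding laplace_powr_def by (rule set_integral_mono[OF int]) (use p(1) le in auto)
  then show "laplace_powr {0<..1} a x \<le> 1 / a" using p(2) by simp
qed

text \<open>Write exp(-xu) = exp(-(x-2)u) exp(-2u) and use u > 1 in the first factor only. The
  reference point 2 leaves the factor 2^(-a), which later makes the sum over l converge like a
  binomial series at x = 2.\<close>

lemma laplace_powr_Ioi_le:
  assumes a: "0 < a" and x: "2 \<le> x"
  shows "laplace_powr {1<..} a x \<le> Gamma a * 2 powr (- a) * exp (2 - x)"
proof -
  note p = integral_powr_exp[OF a, of 2]
  have "laplace_powr {1<..} a x \<le> (LINT u:{1<..}|lborel. exp (2 - x) * (u powr (a - 1) * exp (- 2 * u)))"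
    unfolding laplace_powr_def
  proof (rule set_integral_mono)
    have "set_integrable lborel {0<..} (\<lambda>u. u powr (a - 1) * exp (- x * u))"
      by (rule integral_powr_exp(1)[OF a]) (use x in simp)
    then show "set_integrable lborel {1<..} (\<lambda>u. u powr (a - 1) * exp (- x * u))"
      by (rule set_integrable_subset) auto
    have "set_integrable lborel {1<..} (\<lambda>u. u powr (a - 1) * exp (- 2 * u))"
      by (rule set_integrable_subset[OF p(1)]) auto
    then show "set_integrable lborel {1<..} (\<lambda>u. exp (2 - x) * (u powr (a - 1) * exp (- 2 * u)))"
      by (rule set_integrable_mult_right)
    fix u :: real assume u: "u \<in> {1<..}"
    have "(x - 2) * 1 \<le> (x - 2) * u" using u x by (intro mult_left_mono) auto
    then have "exp (- x * u) \<le> exp (2 - x + (- 2 * u))" by (simp add: algebra_simps)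
    then have "u powr (a - 1) * exp (- x * u) \<le> u powr (a - 1) * exp (2 - x + (- 2 * u))"
      by (rule mult_left_mono) simp
    then show "u powr (a - 1) * exp (- x * u) \<le> exp (2 - x) * (u powr (a - 1) * exp (- 2 * u))"
      by (simp only: exp_add mult.left_commute)
  qed
  also have "\<dots> = exp (2 - x) * laplace_powr {1<..} a 2"
    by (simp add: laplace_powr_def)
  also have "laplace_powr {1<..} a 2 \<le> Gamma a * 2 powr (- a)"
    using laplace_powr_add[OF a, of 2] laplace_powr_nonneg[of "{0<..1}" a 2] by simp
  finally show ?thesis by (simp add: mult_ac)
qed

text \<open>Integrating over x first produces Gamma(z) u^(-z); the integrability hypothesis is the
  convergence of the integral that remains.\<close>

lemma mellin_laplace_powr:
  assumes z: "0 < z" and B [measurable]: "B \<in> sets borel" and B0: "B \<subseteq> {0<..}"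
    and int: "set_integrable lborel B (\<lambda>u. u powr (a - z - 1))"
  shows "set_integrable lborel {0<..} (\<lambda>x. x powr (z - 1) * laplace_powr B a x)"
    and "(LINT x:{0<..}|lborel. x powr (z - 1) * laplace_powr B a x) =
      Gamma z * (LINT u:B|lborel. u powr (a - z - 1))"
proof -
  let ?f = "\<lambda>u x :: real. u powr (a - 1) * (x powr (z - 1) * exp (- u * x))"
  have in1: "set_integrable lborel {0<..} (?f u)" if "u \<in> B" for u
    using that B0 by (intro set_integrable_mult_right integral_powr_exp(1)[OF z]) auto
  have in2: "(LINT x:{0<..}|lborel. ?f u x) = Gamma z * u powr (a - z - 1)" if "u \<in> B" for u
  proof -
    have u: "0 < u" using that B0 by auto
    have "(LINT x:{0<..}|lborel. ?f u x) = u powr (a - 1) * (Gamma z * u powr (- z))"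
      unfolding set_integral_mult_right using integral_powr_exp(2)[OF z u] by simp
    also have "\<dots> = Gamma z * (u powr (a - 1) * u powr (- z))" by simp
    also have "u powr (a - 1) * u powr (- z) = u powr (a - z - 1)" by (simp flip: powr_add) (simp add: algebra_simps)
    finally show ?thesis .
  qed
  have "set_integrable lborel B (\<lambda>u. Gamma z * u powr (a - z - 1))"
    using int by (rule set_integrable_mult_right)
  also have "?this \<longleftrightarrow> set_integrable lborel B (\<lambda>u. LINT x:{0<..}|lborel. ?f u x)"
    by (rule set_integrable_cong[OF refl refl in2[symmetric]])
  finally have in3: "set_integrable lborel B (\<lambda>u. LINT x:{0<..}|lborel. ?f u x)" .
  have eq: "(LINT u:B|lborel. ?f u x) = x powr (z - 1) * laplace_powr B a x" for x
  proof -
    have "(LINT u:B|lborel. ?f u x) = (LINT u:B|lborel. x powr (z - 1) * (u powr (a - 1) * exp (- x * u)))"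
      by (rule set_lebesgue_integral_cong) (auto simp: mult_ac)
    then show ?thesis by (simp add: laplace_powr_def)
  qed
  have T: "set_integrable lborel {0<..} (\<lambda>x. LINT u:B|lborel. ?f u x)"
    "(LINT x:{0<..}|lborel. LINT u:B|lborel. ?f u x) = (LINT u:B|lborel. LINT x:{0<..}|lborel. ?f u x)"
    by (rule Tonelli_set_integral[OF _ _ _ _ in1 in3]; simp)+
  show "set_integrable lborel {0<..} (\<lambda>x. x powr (z - 1) * laplace_powr B a x)"
    using T(1) unfolding eq .
  have "(LINT u:B|lborel. LINT x:{0<..}|lborel. ?f u x) = (LINT u:B|lborel. Gamma z * u powr (a - z - 1))"
    by (rule set_lebesgue_integral_cong) (use in2 in auto)
  then show "(LINT x:{0<..}|lborel. x powr (z - 1) * laplace_powr B a x) =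
      Gamma z * (LINT u:B|lborel. u powr (a - z - 1))"
    using T(2) unfolding eq by simp
qed

text \<open>The integral over all x > 0 converges for the part u <= 1 if z < a and for the part u > 1 if
  z > a; the other part is eliminated through laplace_powr_add.\<close>

lemma mellin_laplace_powr_diff:
  fixes a z :: real
  assumes a: "0 < a" and z: "0 < z" and az: "a \<noteq> z"
  shows "(LINT x:{2<..}|lborel. x powr (z - 1) * laplace_powr {1<..} a x) -
      (LINT x:{0<..2}|lborel. x powr (z - 1) * laplace_powr {0<..1} a x) =
      Gamma a * 2 powr (z - a) / (a - z) - Gamma z / (a - z)"
proof -
  let ?L = "\<lambda>x. x powr (z - 1) * laplace_powr {0<..1} a x"
  let ?U = "\<lambda>x. x powr (z - 1) * laplace_powr {1<..} a x"
  have LU: "?L x + ?U x = Gamma a * x powr (z - a - 1)" if "0 < x" for x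
  proof -
    have "?L x + ?U x = x powr (z - 1) * (Gamma a * x powr (- a))"
      by (simp add: laplace_powr_add[OF a that] flip: distrib_left)
    also have "x powr (z - 1) * (Gamma a * x powr (- a)) = Gamma a * (x powr (z - 1) * x powr (- a))"
      by simp
    also have "x powr (z - 1) * x powr (- a) = x powr (z - a - 1)" by (simp flip: powr_add) (simp add: algebra_simps)
    finally show ?thesis .
  qed
  show ?thesis
  proof (cases "z < a")
    case True
    have p: "set_integrable lborel {0<..1} (\<lambda>u. u powr (a - z - 1))"
      "(LINT u:{0<..1}|lborel. u powr (a - z - 1)) = 1 / (a - z)"
      using integral_powr_Ioc[of "a - z" 1] True by simp_all
    have m: "set_integrable lborel {0<..} ?L" "(LINT x:{0<..}|lborel. ?L x) = Gamma z / (a - z)"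
      using mellin_laplace_powr[OF z _ _ p(1)] p(2) by (auto simp: subset_iff)
    have q: "set_integrable lborel {2<..} (\<lambda>x. x powr (z - a - 1))"
      "(LINT x:{2<..}|lborel. x powr (z - a - 1)) = 2 powr (z - a) / (a - z)"
      using integral_powr_Ioi[of "a - z" 2] True by simp_all
    have "(LINT x:{2<..}|lborel. ?U x) = (LINT x:{2<..}|lborel. Gamma a * x powr (z - a - 1) - ?L x)"
      by (rule set_lebesgue_integral_cong) (use LU in \<open>auto simp: algebra_simps\<close>)
    also have "\<dots> = (LINT x:{2<..}|lborel. Gamma a * x powr (z - a - 1)) - (LINT x:{2<..}|lborel. ?L x)"
      by (rule set_integral_diff(2)[OF set_integrable_mult_right[OF q(1)] set_integrable_subset[OF m(1)]])
        auto
    finally show ?thesis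
      using set_integral_Ioi_split[OF m(1), of 2] m(2) q(2) by simp
  next
    case False
    then have za: "a < z" using az by simp
    have p: "set_integrable lborel {1<..} (\<lambda>u. u powr (a - z - 1))"
      "(LINT u:{1<..}|lborel. u powr (a - z - 1)) = 1 / (z - a)"
      using integral_powr_Ioi[of "z - a" 1] za by simp_all
    have m: "set_integrable lborel {0<..} ?U" "(LINT x:{0<..}|lborel. ?U x) = Gamma z / (z - a)"
      using mellin_laplace_powr[OF z _ _ p(1)] p(2) by (auto simp: subset_iff)
    have q: "set_integrable lborel {0<..2} (\<lambda>x. x powr (z - a - 1))"
      "(LINT x:{0<..2}|lborel. x powr (z - a - 1)) = 2 powr (z - a) / (z - a)"
      using integral_powr_Ioc[of "z - a" 2] za by simp_all
    have "(LINT x:{0<..2}|lborel. ?L x) = (LINT x:{0<..2}|lborel. Gamma a * x powr (z - a - 1) - ?U x)"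
      by (rule set_lebesgue_integral_cong) (use LU in \<open>auto simp: algebra_simps\<close>)
    also have "\<dots> = (LINT x:{0<..2}|lborel. Gamma a * x powr (z - a - 1)) - (LINT x:{0<..2}|lborel. ?U x)"
      by (rule set_integral_diff(2)[OF set_integrable_mult_right[OF q(1)] set_integrable_subset[OF m(1)]])
        auto
    finally have "(LINT x:{2<..}|lborel. ?U x) - (LINT x:{0<..2}|lborel. ?L x) =
        Gamma z / (z - a) - Gamma a * (2 powr (z - a) / (z - a))"
      using set_integral_Ioi_split[OF m(1), of 2] m(2) q(2) by simp
    moreover have "t / (z - a) = - (t / (a - z))" for t :: real
      by (metis minus_diff_eq divide_minus_right)
    ultimately show ?thesis by simp
  qed
qed


section \<open>The binomial series and Mellin transform of (1 + x^a)^(-\<nu>)\<close>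

lemma summable_abs_gbinomial:
  fixes a x :: real
  assumes "0 \<le> x" "x < 1"
  shows "summable (\<lambda>l. \<bar>a gchoose l\<bar> * x ^ l)"
proof -
  have "ereal (norm x) < conv_radius (\<lambda>n. a gchoose n)"
    using assms by (simp add: conv_radius_gchoose)
  from abs_summable_in_conv_radius[OF this] show ?thesis
    using assms by (simp add: abs_mult power_abs)
qed

lemma sums_one_plus_powr:
  fixes a x \<nu> :: real
  assumes a: "0 < a" and x: "1 < x"
  shows "(\<lambda>l. (- \<nu> gchoose l) * x powr (- (a * (\<nu> + real l)))) sums ((1 + x powr a) powr (- \<nu>))"
proof -
  have "1 powr a < x powr a" using a x by (intro powr_less_mono2) auto
  then have "\<bar>1\<bar> < x powr a" by simp
  from gen_binomial_real''[OF this, of "- \<nu>"]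
  have "(\<lambda>l. (- \<nu> gchoose l) * (x powr a) powr (- \<nu> - real l) * 1 ^ l) sums ((x powr a + 1) powr (- \<nu>))" .
  moreover have "(x powr a) powr (- \<nu> - real l) = x powr (- (a * (\<nu> + real l)))" for l
    by (simp add: powr_powr algebra_simps)
  ultimately show ?thesis by (simp add: add.commute)
qed

text \<open>Replace (1 + x^a)^(-\<nu>) by 1/Gamma(\<nu>) times the integral of w^(\<nu>-1) exp(-w(1
  + x^a)) over w > 0 and integrate over x first. Two gamma integrals result, and the second one
  needs z < a \<nu>.\<close>

lemma mellin_one_plus_powr:
  fixes a z \<nu> :: real
  assumes a: "0 < a" and z: "0 < z" and za: "z < a * \<nu>"
  shows "set_integrable lborel {0<..} (\<lambda>x. x powr (z - 1) * (1 + x powr a) powr (- \<nu>))"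
    and "(LINT x:{0<..}|lborel. x powr (z - 1) * (1 + x powr a) powr (- \<nu>)) =
      Gamma (z / a) * Gamma (\<nu> - z / a) / (a * Gamma \<nu>)"
proof -
  have nu: "0 < \<nu>" using zero_less_mult_pos[OF less_trans[OF z za] a] .
  have nuz: "0 < \<nu> - z / a" using a za by (simp add: field_simps)
  let ?f = "\<lambda>w x :: real. w powr (\<nu> - 1) * exp (- w) * (x powr (z - 1) * exp (- w * x powr a))"
  have in1: "set_integrable lborel {0<..} (?f w)" if "w \<in> {0<..}" for w
    using that a z by (intro set_integrable_mult_right integral_powr_exp_powr(1)) auto
  have in2: "(LINT x:{0<..}|lborel. ?f w x) = Gamma (z / a) / a * (w powr (\<nu> - z / a - 1) * exp (- 1 * w))"
    if "w \<in> {0<..}" for w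
  proof -
    have "(LINT x:{0<..}|lborel. ?f w x) = w powr (\<nu> - 1) * exp (- w) * (Gamma (z / a) * w powr (- (z / a)) / \<bar>a\<bar>)"
      unfolding set_integral_mult_right using that a z by (subst integral_powr_exp_powr(2)) auto
    also have "\<dots> = Gamma (z / a) / a * ((w powr (\<nu> - 1) * w powr (- (z / a))) * exp (- 1 * w))"
      using a by simp
    also have "w powr (\<nu> - 1) * w powr (- (z / a)) = w powr (\<nu> - z / a - 1)"
      by (simp flip: powr_add) (simp add: algebra_simps)
    finally show ?thesis .
  qed
  note G = integral_powr_exp[OF nuz zero_less_one]
  have "set_integrable lborel {0<..} (\<lambda>w. Gamma (z / a) / a * (w powr (\<nu> - z / a - 1) * exp (- 1 * w)))"
    using G(1) by (rule set_integrable_mult_right)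
  also have "?this \<longleftrightarrow> set_integrable lborel {0<..} (\<lambda>w. LINT x:{0<..}|lborel. ?f w x)"
    by (rule set_integrable_cong[OF refl refl in2[symmetric]])
  finally have in3: "set_integrable lborel {0<..} (\<lambda>w. LINT x:{0<..}|lborel. ?f w x)" .
  have eq: "(LINT w:{0<..}|lborel. ?f w x) = Gamma \<nu> * (x powr (z - 1) * (1 + x powr a) powr (- \<nu>))" for x
  proof -
    have "0 < 1 + x powr a" by (intro add_pos_nonneg) auto
    note g = integral_powr_exp(2)[OF nu this]
    have "(LINT w:{0<..}|lborel. ?f w x) =
        (LINT w:{0<..}|lborel. x powr (z - 1) * (w powr (\<nu> - 1) * exp (- (1 + x powr a) * w)))"
    proof (rule set_lebesgue_integral_cong)
      have e: "exp (- (1 + x powr a) * w) = exp (- w) * exp (- w * x powr a)" for w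
        by (simp add: algebra_simps flip: exp_add)
      show "\<forall>w. w \<in> {0<..} \<longrightarrow> ?f w x = x powr (z - 1) * (w powr (\<nu> - 1) * exp (- (1 + x powr a) * w))"
        unfolding e by (simp only: mult_ac simp_thms)
    qed simp
    also have "\<dots> = x powr (z - 1) * (Gamma \<nu> * (1 + x powr a) powr (- \<nu>))"
      unfolding set_integral_mult_right g ..
    finally show ?thesis by simp
  qed
  have T: "set_integrable lborel {0<..} (\<lambda>x. LINT w:{0<..}|lborel. ?f w x)"
    "(LINT x:{0<..}|lborel. LINT w:{0<..}|lborel. ?f w x) = (LINT w:{0<..}|lborel. LINT x:{0<..}|lborel. ?f w x)"
    by (rule Tonelli_set_integral[OF _ _ _ _ in1 in3]; simp)+
  have Gnu: "0 < Gamma \<nu>" using nu by (rule Gamma_real_pos)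
  show "set_integrable lborel {0<..} (\<lambda>x. x powr (z - 1) * (1 + x powr a) powr (- \<nu>))"
    using T(1) Gnu unfolding eq by (subst (asm) set_integrable_mult_right_iff) auto
  have "(LINT w:{0<..}|lborel. LINT x:{0<..}|lborel. ?f w x) =
      (LINT w:{0<..}|lborel. Gamma (z / a) / a * (w powr (\<nu> - z / a - 1) * exp (- 1 * w)))"
    by (rule set_lebesgue_integral_cong) (use in2 in auto)
  also have "\<dots> = Gamma (z / a) / a * Gamma (\<nu> - z / a)"
    unfolding set_integral_mult_right G(2) by simp
  finally have "Gamma \<nu> * (LINT x:{0<..}|lborel. x powr (z - 1) * (1 + x powr a) powr (- \<nu>)) =
      Gamma (z / a) / a * Gamma (\<nu> - z / a)"
    using T(2) unfolding eq set_integral_mult_right by (simp only:)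
  moreover have "I = A * B / (a * C)" if "C * I = A / a * B" "0 < C" for A B C I :: real
    using that a by (simp add: field_simps)
  ultimately show "(LINT x:{0<..}|lborel. x powr (z - 1) * (1 + x powr a) powr (- \<nu>)) =
      Gamma (z / a) * Gamma (\<nu> - z / a) / (a * Gamma \<nu>)"
    using Gnu by blast
qed

text \<open>The full Mellin integral minus its part over x > 2. On that part the binomial series at
  infinity converges geometrically with ratio 2^(-a), up to the binomial coefficients, and is
  integrated term by term.\<close>

lemma truncated_mellin_sums_base:
  fixes a z \<nu> :: real
  assumes a: "0 < a" and z: "0 < z" and za: "z < a * \<nu>"
  shows "(\<lambda>l. (- \<nu> gchoose l) * 2 powr (z - a * (\<nu> + real l)) / (z - a * (\<nu> + real l))) sums
    ((LINT x:{0<..2}|lborel. x powr (z - 1) * (1 + x powr a) powr (- \<nu>)) -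
      Gamma (z / a) * Gamma (\<nu> - z / a) / (a * Gamma \<nu>))"
proof -
  let ?h = "\<lambda>x. x powr (z - 1) * (1 + x powr a) powr (- \<nu>)"
  let ?f = "\<lambda>l x. (- \<nu> gchoose l) * x powr (- (a * (\<nu> + real l) - z) - 1)"
  have s: "0 < a * (\<nu> + real l) - z" for l
  proof -
    have "a * \<nu> \<le> a * (\<nu> + real l)" using a by (intro mult_left_mono) auto
    then show ?thesis using za by simp
  qed
  note m = mellin_one_plus_powr[OF a z za]
  note p = integral_powr_Ioi[OF s, of 2, OF zero_less_numeral]
  have "(\<lambda>l. LINT x:{2<..}|lborel. ?f l x) sums (LINT x:{2<..}|lborel. (\<Sum>l. ?f l x))"
  proof (rule sums_set_integral_dominated(2)[where B = "\<lambda>l. \<bar>- \<nu> gchoose l\<bar> * (2 powr (- a)) ^ l"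
        and G = "\<lambda>x. 2 powr 0 * x powr (- (a * (\<nu> + real 0) - z) - 1)"])
    show "summable (\<lambda>l. \<bar>- \<nu> gchoose l\<bar> * (2 powr (- a)) ^ l)"
    proof (rule summable_abs_gbinomial)
      show "2 powr (- a) < (1::real)" using a powr_less_cancel_iff[of 2 "- a" 0] by simp
    qed simp
    show "set_integrable lborel {2<..} (\<lambda>x. 2 powr 0 * x powr (- (a * (\<nu> + real 0) - z) - 1))"
      by (rule set_integrable_mult_right[OF p(1)])
    fix l and x :: real assume x: "x \<in> {2<..}"
    have "x powr (- a * real l) \<le> 2 powr (- a * real l)"
      using x a by (intro powr_mono2') auto
    also have "\<dots> = (2 powr (- a)) ^ l"
      by (simp add: powr_powr flip: powr_realpow)
    finally have "x powr (- a * real l) * x powr (- (a * (\<nu> + real 0) - z) - 1) \<le>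
        (2 powr (- a)) ^ l * x powr (- (a * (\<nu> + real 0) - z) - 1)"
      by (rule mult_right_mono) simp
    also have "x powr (- a * real l) * x powr (- (a * (\<nu> + real 0) - z) - 1) = x powr (- (a * (\<nu> + real l) - z) - 1)"
      by (simp flip: powr_add) (simp add: algebra_simps)
    finally show "norm (?f l x) \<le> \<bar>- \<nu> gchoose l\<bar> * (2 powr (- a)) ^ l *
        (2 powr 0 * x powr (- (a * (\<nu> + real 0) - z) - 1))"
      by (auto simp: abs_mult mult.assoc intro!: mult_left_mono)
  qed auto
  moreover have "(LINT x:{2<..}|lborel. (\<Sum>l. ?f l x)) = (LINT x:{2<..}|lborel. ?h x)"
  proof (rule set_lebesgue_integral_cong)
    show "\<forall>x. x \<in> {2<..} \<longrightarrow> (\<Sum>l. ?f l x) = ?h x"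
    proof (intro allI impI)
      fix x :: real assume "x \<in> {2<..}"
      then have x: "1 < x" by simp
      have "x powr (z - 1) * ((- \<nu> gchoose l) * x powr (- (a * (\<nu> + real l)))) = ?f l x" for l
      proof -
        have "x powr (z - 1) * x powr (- (a * (\<nu> + real l))) = x powr (- (a * (\<nu> + real l) - z) - 1)"
          by (simp flip: powr_add) (simp add: algebra_simps)
        then show ?thesis by (metis mult.left_commute)
      qed
      with sums_mult[OF sums_one_plus_powr[OF a x, of \<nu>], of "x powr (z - 1)"]
      have "(\<lambda>l. ?f l x) sums ?h x" by (simp only:)
      then show "(\<Sum>l. ?f l x) = ?h x" by (simp only: sums_iff)
    qed
  qed simp
  moreover have "(LINT x:{2<..}|lborel. ?h x) =
      Gamma (z / a) * Gamma (\<nu> - z / a) / (a * Gamma \<nu>) - (LINT x:{0<..2}|lborel. ?h x)"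
    using set_integral_Ioi_split[OF m(1), of 2] m(2) by simp
  moreover have "(LINT x:{2<..}|lborel. ?f l x) =
      - ((- \<nu> gchoose l) * 2 powr (z - a * (\<nu> + real l)) / (z - a * (\<nu> + real l)))" for l
  proof -
    have "z - a * (\<nu> + real l) = - (a * (\<nu> + real l) - z)" by simp
    then show ?thesis
      unfolding set_integral_mult_right p(2) by (simp only: divide_minus_right minus_minus) simp
  qed
  ultimately have "(\<lambda>l. - ((- \<nu> gchoose l) * 2 powr (z - a * (\<nu> + real l)) / (z - a * (\<nu> + real l)))) sums
      (Gamma (z / a) * Gamma (\<nu> - z / a) / (a * Gamma \<nu>) - (LINT x:{0<..2}|lborel. ?h x))"
    by simp
  from sums_minus[OF this] show ?thesis by simp
qed

lemma set_integrable_truncated_mellin: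
  fixes a z \<nu> :: real
  assumes z: "0 < z" and nu: "0 \<le> \<nu>"
  shows "set_integrable lborel {0<..2} (\<lambda>x. x powr (z - 1) * (1 + x powr a) powr (- \<nu>))"
proof (rule set_integrable_bound[OF integral_powr_Ioc(1)[OF z, of 2]])
  show "set_borel_measurable lborel {0<..2} (\<lambda>x. x powr (z - 1) * (1 + x powr a) powr (- \<nu>))"
    unfolding set_borel_measurable_def by measurable
  have "(1 + x powr a) powr (- \<nu>) \<le> 1 powr (- \<nu>)" for x
    using nu by (intro powr_mono2') auto
  then show "AE x in lborel. x \<in> {0<..2} \<longrightarrow>
      norm (x powr (z - 1) * (1 + x powr a) powr (- \<nu>)) \<le> norm (x powr (z - 1))"
    by (intro AE_I2) (auto simp: abs_mult intro!: mult_left_le)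
qed simp

text \<open>The sum of the integrands is the derivative of x^z (1 + x^a)^(-\<nu>). Writing the
  factor x^a as (1 + x^a) - 1 keeps the exponent \<open>z\<close> and changes only \<nu>, so an
  induction can run in \<nu> with \<open>z\<close> fixed.\<close>

lemma truncated_mellin_rec:
  fixes a z \<nu> :: real
  assumes a: "0 < a" and z: "0 < z" and nu: "0 < \<nu>"
  shows "(z - \<nu> * a) * (LINT x:{0<..2}|lborel. x powr (z - 1) * (1 + x powr a) powr (- \<nu>)) +
      \<nu> * a * (LINT x:{0<..2}|lborel. x powr (z - 1) * (1 + x powr a) powr (- (\<nu> + 1))) =
      2 powr z * (1 + 2 powr a) powr (- \<nu>)"
proof -
  let ?h = "\<lambda>\<nu> x. x powr (z - 1) * (1 + x powr a) powr (- \<nu>)"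
  let ?f = "\<lambda>x. (z - \<nu> * a) * ?h \<nu> x + \<nu> * a * ?h (\<nu> + 1) x"
  have int: "set_integrable lborel {0<..2} (?h \<nu>)" "set_integrable lborel {0<..2} (?h (\<nu> + 1))"
    using nu by (intro set_integrable_truncated_mellin z; simp)+
  have "(LINT x:{0<..2}|lborel. ?f x) = 2 powr z * (1 + 2 powr a) powr (- \<nu>)"
  proof (rule set_integral_FTC_Ioc)
    fix x :: real assume x: "0 < x"
    define y where "y = 1 + x powr a"
    have y: "0 < y" unfolding y_def by (intro add_pos_nonneg) auto
    have "((\<lambda>x. x powr z * (1 + x powr a) powr (- \<nu>)) has_real_derivative
        (z * x powr (z - 1)) * y powr (- \<nu>) + x powr z * (- \<nu> * y powr (- \<nu> - 1) * (a * x powr (a - 1)))) (at x)"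
      using x y unfolding y_def by (auto intro!: derivative_eq_intros)
    moreover have "(z * x powr (z - 1)) * y powr (- \<nu>) + x powr z * (- \<nu> * y powr (- \<nu> - 1) * (a * x powr (a - 1))) = ?f x"
    proof -
      define X Y where "X = x powr (z - 1)" and "Y = y powr (- (\<nu> + 1))"
      have "x powr z * x powr (a - 1) = X * (y - 1)"
        using x by (simp add: X_def y_def algebra_simps flip: powr_add)
      moreover have "y powr (- \<nu> - 1) = Y" unfolding Y_def by (rule arg_cong) simp
      moreover have "x powr z * (- \<nu> * Y * (a * x powr (a - 1))) = - (\<nu> * a) * (x powr z * x powr (a - 1)) * Y"
        by simp
      ultimately have "x powr z * (- \<nu> * y powr (- \<nu> - 1) * (a * x powr (a - 1))) = - (\<nu> * a) * (X * (y - 1)) * Y"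
        by (simp only:)
      moreover have "y powr (- \<nu>) = y * Y"
        using y by (simp add: Y_def powr_diff powr_minus powr_add field_simps)
      ultimately show ?thesis
        unfolding y_def[symmetric] X_def[symmetric] Y_def[symmetric] by (simp add: algebra_simps)
    qed
    ultimately show "((\<lambda>x. x powr z * (1 + x powr a) powr (- \<nu>)) has_real_derivative ?f x) (at x)"
      by (simp only:)
  next
    have "1 + x powr a \<noteq> 0" for x :: real
      using powr_ge_zero[of x a] by linarith
    then show "continuous_on {0<..} ?f"
      by (auto intro!: continuous_intros)
    show "set_integrable lborel {0<..2} ?f"
      by (intro set_integral_add set_integrable_mult_right int)
    have p0: "((\<lambda>x::real. x powr c) \<longlongrightarrow> 0) (at_right 0)" if "0 < c" for c :: real
      using that by (intro tendsto_zero_powrI[where b = c] tendsto_ident_at tendsto_const)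
        (auto intro: eventually_mono[OF eventually_at_right_less])
    have "((\<lambda>x. x powr z * (1 + x powr a) powr (- \<nu>)) \<longlongrightarrow> 0 * (1 + 0) powr (- \<nu>)) (at_right 0)"
      using a z by (intro tendsto_intros p0) auto
    then show "((\<lambda>x. x powr z * (1 + x powr a) powr (- \<nu>)) \<longlongrightarrow> 0) (at_right 0)" by simp
  qed simp
  moreover have "(LINT x:{0<..2}|lborel. ?f x) =
      (z - \<nu> * a) * (LINT x:{0<..2}|lborel. ?h \<nu> x) + \<nu> * a * (LINT x:{0<..2}|lborel. ?h (\<nu> + 1) x)"
    by (subst set_integral_add(2)[OF set_integrable_mult_right[OF int(1)] set_integrable_mult_right[OF int(2)]])
      (simp only: set_integral_mult_right)
  ultimately show ?thesis by simp
qed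


text \<open>For z < a nu the integral over (0, infinity) converges; partial integration replaces nu by nu + 1
  and so extends the range of z.\<close>

lemma truncated_mellin_sums:
  fixes a z \<nu> :: real
  assumes a: "0 < a" and z: "0 < z" and nu: "0 < \<nu>" and ne: "\<And>l. z \<noteq> a * (\<nu> + real l)"
  shows "(\<lambda>l. (- \<nu> gchoose l) * 2 powr (z - a * (\<nu> + real l)) / (z - a * (\<nu> + real l))) sums
    ((LINT x:{0<..2}|lborel. x powr (z - 1) * (1 + x powr a) powr (- \<nu>)) -
      Gamma (z / a) * Gamma (\<nu> - z / a) / (a * Gamma \<nu>))"
proof -
  define t where "t \<nu> l = (- \<nu> gchoose l) * 2 powr (z - a * (\<nu> + real l)) / (z - a * (\<nu> + real l))" for \<nu> l
  define H where "H \<nu> = (LINT x:{0<..2}|lborel. x powr (z - 1) * (1 + x powr a) powr (- \<nu>))" for \<nu>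
  define C where "C \<nu> = Gamma (z / a) * Gamma (\<nu> - z / a) / (a * Gamma \<nu>)" for \<nu>
  have "t \<nu> sums (H \<nu> - C \<nu>)"
    if "z < a * (\<nu> + real m)" "0 < \<nu>" "\<And>l. z \<noteq> a * (\<nu> + real l)" for m \<nu>
    using that
  proof (induction m arbitrary: \<nu>)
    case 0
    then show ?case
      unfolding t_def H_def C_def by (intro truncated_mellin_sums_base a z) auto
  next
    case (Suc m)
    have ne: "z - a * (\<nu> + real l) \<noteq> 0" for l using Suc.prems(3)[of l] by simp
    have D: "z - \<nu> * a \<noteq> 0" using ne[of 0] by (simp add: mult.commute)
    have IH: "t (\<nu> + 1) sums (H (\<nu> + 1) - C (\<nu> + 1))"
    proof (rule Suc.IH)
      show "z < a * (\<nu> + 1 + real m)" using Suc.prems(1) by (simp add: algebra_simps)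
      show "z \<noteq> a * (\<nu> + 1 + real l)" for l using Suc.prems(3)[of "Suc l"] by (simp add: algebra_simps)
    qed (use Suc.prems(2) in simp)
    \<comment> \<open>From (z - a \<nu>)/(z - a(\<nu>+l)) = 1 + a l/(z - a(\<nu>+l)). The absorption
      identity turns l times the binomial coefficient of -\<nu> into -\<nu> times that of -(\<nu>+1)
      at index l-1, so the second summand contributes minus the shifted series
      \<open>v\<close>.\<close>
    define v where "v l = (case l of 0 \<Rightarrow> 0 | Suc i \<Rightarrow> \<nu> * a * t (\<nu> + 1) i)" for l
    have "(\<lambda>i. v (Suc i)) sums (\<nu> * a * (H (\<nu> + 1) - C (\<nu> + 1)))"
      using sums_mult[OF IH, of "\<nu> * a"] by (simp add: v_def)
    then have v: "v sums (\<nu> * a * (H (\<nu> + 1) - C (\<nu> + 1)))"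
      by (subst (asm) sums_Suc_iff) (simp add: v_def)
    let ?u = "\<lambda>l. 2 powr z * ((- \<nu> gchoose l) * 2 powr (- (a * (\<nu> + real l))))"
    have u: "?u sums (2 powr z * (1 + 2 powr a) powr (- \<nu>))"
      by (intro sums_mult sums_one_plus_powr a) simp
    have "(\<lambda>l. (?u l - v l) / (z - \<nu> * a)) sums
        ((2 powr z * (1 + 2 powr a) powr (- \<nu>) - \<nu> * a * (H (\<nu> + 1) - C (\<nu> + 1))) / (z - \<nu> * a))"
      by (intro sums_divide sums_diff u v)
    moreover have "(?u l - v l) / (z - \<nu> * a) = t \<nu> l" for l
    proof -
      define P where "P = 2 powr (z - a * (\<nu> + real l))"
      have ul: "?u l = (- \<nu> gchoose l) * P"
      proof -
        have "P = 2 powr z * 2 powr (- (a * (\<nu> + real l)))" unfolding P_def by (simp flip: powr_add)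
        then show ?thesis by (simp only: mult.left_commute)
      qed
      have vl: "v l = - (a * real l) * (- \<nu> gchoose l) * P / (z - a * (\<nu> + real l))"
      proof (cases l)
        case (Suc i)
        have "real (Suc i) * (- \<nu> gchoose Suc i) = - \<nu> * ((- \<nu> - 1) gchoose i)"
          using gbinomial_absorption[of i "- \<nu>"] by simp
        then have g: "\<nu> * (- (\<nu> + 1) gchoose i) = - (real l * (- \<nu> gchoose l))"
          unfolding Suc by simp
        have "v l = a * (\<nu> * (- (\<nu> + 1) gchoose i)) * P / (z - a * (\<nu> + real l))"
          unfolding v_def Suc nat.case t_def by (simp add: P_def Suc add.assoc)
        then show ?thesis unfolding g by simp
      qed (simp add: v_def)
      have "X * P - - L * X * P / E = (E + L) * (X * P / E)" if "E \<noteq> 0" for X L E :: real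
        using that by (simp add: field_simps)
      from this[OF ne[of l], of "- \<nu> gchoose l" "a * real l"]
      have "?u l - v l = (z - \<nu> * a) * t \<nu> l"
        unfolding ul vl t_def P_def[symmetric] by (simp add: algebra_simps)
      then show ?thesis using D by simp
    qed
    moreover have "(2 powr z * (1 + 2 powr a) powr (- \<nu>) - \<nu> * a * (H (\<nu> + 1) - C (\<nu> + 1))) / (z - \<nu> * a) =
        H \<nu> - C \<nu>"
    proof -
      have "(z - \<nu> * a) * H \<nu> + \<nu> * a * H (\<nu> + 1) = 2 powr z * (1 + 2 powr a) powr (- \<nu>)"
        unfolding H_def by (rule truncated_mellin_rec[OF a z Suc.prems(2)])
      \<comment> \<open>The gamma quotient satisfies the recursion of
        \<open>truncated_mellin_rec\<close> without the boundary term at 2; hence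
        \<open>H - C\<close> obeys the same recursion as the series. By \<open>ne\<close>, \<nu> -
        z/a is not a pole of Gamma.\<close>
      moreover have "(z - \<nu> * a) * C \<nu> + \<nu> * a * C (\<nu> + 1) = 0"
      proof -
        have n: "\<nu> - z / a \<notin> \<int>\<^sub>\<le>\<^sub>0"
        proof
          assume "\<nu> - z / a \<in> \<int>\<^sub>\<le>\<^sub>0"
          then obtain k where "\<nu> - z / a = - real k" by (auto elim: nonpos_Ints_cases')
          then have "z = a * (\<nu> + real k)" using a by (simp add: field_simps)
          then show False using Suc.prems(3) by blast
        qed
        have "Gamma (\<nu> + 1 - z / a) = (\<nu> - z / a) * Gamma (\<nu> - z / a)"
          using Gamma_plus1[of "\<nu> - z / a"] n by (auto simp: algebra_simps)
        moreover have "Gamma (\<nu> + 1) = \<nu> * Gamma \<nu>"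
          using Gamma_plus1[of \<nu>] Suc.prems(2) by (force elim: nonpos_Ints_cases')
        moreover have "0 < Gamma \<nu>" using Suc.prems(2) by (rule Gamma_real_pos)
        ultimately show ?thesis
        proof -
          have "(z - \<nu> * a) * (A * B / (a * G)) + \<nu> * a * (A * ((\<nu> - z / a) * B) / (a * (\<nu> * G))) = 0"
            if "0 < G" for A B G :: real
            using a Suc.prems(2) that by (simp add: field_simps)
          moreover assume "Gamma (\<nu> + 1 - z / a) = (\<nu> - z / a) * Gamma (\<nu> - z / a)"
            "Gamma (\<nu> + 1) = \<nu> * Gamma \<nu>" "0 < Gamma \<nu>"
          ultimately show ?thesis unfolding C_def by (simp only:)
        qed
      qed
      ultimately have "2 powr z * (1 + 2 powr a) powr (- \<nu>) - \<nu> * a * (H (\<nu> + 1) - C (\<nu> + 1)) =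
          (z - \<nu> * a) * (H \<nu> - C \<nu>)"
        by (simp add: algebra_simps)
      then show ?thesis using D by simp
    qed
    ultimately show ?case by (simp only:)
  qed
  moreover obtain m :: nat where m: "z / a - \<nu> < real m" using reals_Archimedean2 by blast
  moreover have "z < a * (\<nu> + real m)" using m a by (simp add: field_simps)
  ultimately have "t \<nu> sums (H \<nu> - C \<nu>)" using nu ne by blast
  then show ?thesis unfolding t_def H_def C_def .
qed

section \<open>Splitting the Laplace transform\<close>

text \<open>Only the part of the gamma integral over (4,5] is kept; there u^(a-1) = u^a/u >= 4^a/5
  and exp(-u) >= exp(-5).\<close>

lemma Gamma_ge_powr:
  fixes a :: real
  assumes a: "0 < a"
  shows "4 powr a * (exp (- 5) / 5) \<le> Gamma a"
proof -
  note p = integral_powr_exp[OF a zero_less_one]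
  have "4 powr a * (exp (- 5) / 5) = (LINT u:{4<..5::real}|lborel. 4 powr a * (exp (- 5) / 5))"
    by (simp add: set_lebesgue_integral_def)
  also have "\<dots> \<le> (LINT u:{4<..5}|lborel. u powr (a - 1) * exp (- 1 * u))"
  proof (rule set_integral_mono)
    show "set_integrable lborel {4<..5} (\<lambda>u. u powr (a - 1) * exp (- 1 * u))"
      by (rule set_integrable_subset[OF p(1)]) auto
    fix u :: real assume u: "u \<in> {4<..5}"
    have "4 powr a / 5 \<le> u powr a / u"
      using u a by (intro frac_le powr_mono2) auto
    also have "\<dots> = u powr (a - 1)" using u by (simp add: powr_diff)
    finally have "4 powr a / 5 * exp (- 5) \<le> u powr (a - 1) * exp (- 1 * u)"
      using u by (intro mult_mono) auto
    then show "4 powr a * (exp (- 5) / 5) \<le> u powr (a - 1) * exp (- 1 * u)" by simp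
  qed (simp add: set_integrable_def)
  also have "\<dots> \<le> (LINT u:{0<..}|lborel. u powr (a - 1) * exp (- 1 * u))"
    unfolding set_lebesgue_integral_def
  proof (rule integral_mono)
    have "set_integrable lborel {4<..5} (\<lambda>u. u powr (a - 1) * exp (- 1 * u))"
      by (rule set_integrable_subset[OF p(1)]) auto
    then show "integrable lborel (\<lambda>u. indicator {4<..5} u *\<^sub>R (u powr (a - 1) * exp (- 1 * u)))"
      by (simp add: set_integrable_def)
  qed (use p(1) in \<open>auto simp: set_integrable_def indicator_def\<close>)
  also have "\<dots> = Gamma a" using p(2) by simp
  finally show ?thesis .
qed

text \<open>The coefficients of the three-parameter Mittag-Leffler function, i.e. of the termwise inverse
  Laplace transform of the binomial series.\<close>

definition ml_coeff :: "real \<Rightarrow> real \<Rightarrow> nat \<Rightarrow> real" where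
  "ml_coeff a \<nu> l = (- \<nu> gchoose l) / Gamma (a * (\<nu> + real l))"

text \<open>By \<open>Gamma_ge_powr\<close> the factor 1/Gamma supplies 4^(-a l) = 2^(-a l) 2^(-a
  l): one half makes the series of binomial coefficients converge, the other absorbs the polynomial.
  The weight (1 + l)^k is the price of the small denominators in
  \<open>not_liouville_gap\<close>.\<close>

lemma summable_ml_coeff:
  assumes a: "0 < a" and nu: "0 < \<nu>"
  shows "summable (\<lambda>l. \<bar>ml_coeff a \<nu> l\<bar> * (1 + real l) ^ k)"
proof -
  have "(\<lambda>l. (1 + real l) powr real k * 2 powr (- a * real l)) \<longlonglongrightarrow> 0"
    using a by real_asymp
  then have "Bseq (\<lambda>l. (1 + real l) powr real k * 2 powr (- a * real l))"
    by (rule convergent_imp_Bseq[OF convergentI])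
  then obtain K where K: "0 < K" "\<And>l. norm ((1 + real l) powr real k * 2 powr (- a * real l)) \<le> K"
    by (auto simp: Bseq_def)
  let ?c = "5 * exp 5 * 4 powr (- (a * \<nu>)) * K"
  show ?thesis
  proof (rule summable_comparison_test')
    have "2 powr (- a) < (1::real)" using a powr_less_cancel_iff[of 2 "- a" 0] by simp
    then show "summable (\<lambda>l. ?c * (\<bar>- \<nu> gchoose l\<bar> * (2 powr (- a)) ^ l))"
      by (intro summable_mult summable_abs_gbinomial) auto
    fix l
    let ?g = "a * (\<nu> + real l)"
    have gp: "0 < ?g" using a nu by (simp add: mult_pos_pos add_pos_nonneg)
    have "1 / Gamma ?g \<le> 1 / (4 powr ?g * (exp (- 5) / 5))"
      by (rule divide_left_mono[OF Gamma_ge_powr[OF gp]])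
        (auto intro!: mult_pos_pos Gamma_real_pos gp)
    also have "\<dots> = 5 * exp 5 * 4 powr (- ?g)"
    proof -
      have "1 / (P * (inverse E / 5)) = 5 * E * inverse P" for P E :: real by (simp add: field_simps)
      then show ?thesis unfolding exp_minus powr_minus by blast
    qed
    also have "4 powr (- ?g) = 4 powr (- (a * \<nu>)) * ((2 powr (- a)) ^ l * 2 powr (- a * real l))"
    proof -
      have "4 powr x = 2 powr x * 2 powr x" for x :: real
        by (simp flip: powr_mult)
      then have "4 powr (- (a * real l)) = 2 powr (- a * real l) * 2 powr (- a * real l)" by simp
      moreover have "(2 powr (- a)) ^ l = 2 powr (- a * real l)"
        by (simp add: powr_powr flip: powr_realpow)
      moreover have "4 powr (- ?g) = 4 powr (- (a * \<nu>)) * 4 powr (- (a * real l))"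
        by (simp flip: powr_add) (simp add: algebra_simps)
      ultimately show ?thesis by simp
    qed
    finally have G: "1 / Gamma ?g \<le> 5 * exp 5 * 4 powr (- (a * \<nu>)) * ((2 powr (- a)) ^ l * 2 powr (- a * real l))"
      by simp
    have "0 < Gamma ?g" using gp by (rule Gamma_real_pos)
    then have "\<bar>ml_coeff a \<nu> l\<bar> * (1 + real l) ^ k = \<bar>- \<nu> gchoose l\<bar> * (1 / Gamma ?g) * (1 + real l) ^ k"
      by (simp add: ml_coeff_def abs_mult)
    also have "\<dots> \<le> \<bar>- \<nu> gchoose l\<bar> * (5 * exp 5 * 4 powr (- (a * \<nu>)) * ((2 powr (- a)) ^ l * 2 powr (- a * real l))) * (1 + real l) ^ k"
      by (intro mult_right_mono mult_left_mono G) auto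
    also have "\<dots> = (5 * exp 5 * 4 powr (- (a * \<nu>)) * (\<bar>- \<nu> gchoose l\<bar> * (2 powr (- a)) ^ l)) *
        ((1 + real l) powr real k * 2 powr (- a * real l))"
      by (simp add: powr_realpow)
    also have "\<dots> \<le> (5 * exp 5 * 4 powr (- (a * \<nu>)) * (\<bar>- \<nu> gchoose l\<bar> * (2 powr (- a)) ^ l)) * K"
      using K(2)[of l] by (intro mult_left_mono) auto
    finally show "norm (\<bar>ml_coeff a \<nu> l\<bar> * (1 + real l) ^ k) \<le> ?c * (\<bar>- \<nu> gchoose l\<bar> * (2 powr (- a)) ^ l)"
      by (simp add: mult_ac)
  qed
qed

text \<open>With \<nu> = e/f the difference equals Q/(4f) (\<alpha> - p/Q) for the integers Q = 2(e
  + l f) and p = 2f(n + 2j), so an exponent \<open>m\<close> at which \<alpha> fails the Liouville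
  condition bounds it below. The bound involves \<open>Q\<close> alone and is thus uniform in j; Q
  <= 2(e + f)(1 + l) gives the constant \<open>C\<close>.\<close>

lemma not_liouville_gap:
  fixes \<alpha> \<nu> :: real and e f n :: nat
  assumes e: "1 \<le> e" and f: "1 \<le> f" and nu: "\<nu> = real e / real f"
    and irr: "\<alpha> \<notin> \<rat>" and L: "\<not> liouville_number \<alpha>"
  obtains C k where "0 < C"
    "\<And>l j. C / (1 + real l) ^ k \<le> \<bar>\<alpha> / 2 * (\<nu> + real l) - (real n / 2 + real j)\<bar>"
proof -
  obtain m :: nat where
    m: "\<And>p q :: int. 2 \<le> q \<Longrightarrow> 1 / of_int q ^ m < \<bar>\<alpha> - of_int p / of_int q\<bar>"
  proof -
    from irr L obtain m :: nat where
      "\<nexists>p q :: int. 2 \<le> q \<and> \<bar>\<alpha> - of_int p / of_int q\<bar> \<le> 1 / of_int q ^ m"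
      unfolding liouville_number_def by blast
    then show thesis by (intro that[of m]) (metis not_le)
  qed
  define C where "C = 1 / (4 * real f * (2 * (real e + real f)) ^ m)"
  show thesis
  proof (rule that)
    show "0 < C" using f e by (simp add: C_def)
    fix l j :: nat
    \<comment> \<open>The natural fraction f(n + 2j)/(e + l f) is expanded by 2, so that the
      denominator is at least 2 even for e = 1 and l = 0, as the Liouville condition
      demands.\<close>
    define q where "q = 2 * (int e + int l * int f)"
    define p where "p = 2 * int f * (int n + 2 * int j)"
    define Q where "Q = 2 * (real e + real l * real f)"
    have "0 \<le> int l * int f" by simp
    moreover have "1 \<le> int e" using e by simp
    ultimately have "1 + 0 \<le> int e + int l * int f" by (intro add_mono)
    moreover have "2 \<le> 2 * X" if "1 + 0 \<le> X" for X :: int using that by simp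
    ultimately have q2: "2 \<le> q" unfolding q_def by blast
    have Q: "of_int q = Q" by (simp add: q_def Q_def)
    have Q1: "1 \<le> Q" using q2 Q by linarith
    have f0: "0 < real f" using f by simp
    have "real_of_int p = 2 * real f * (real n + 2 * real j)" by (simp add: p_def)
    then have "(\<alpha> * Q - of_int p) / (4 * real f) = \<alpha> / 2 * (\<nu> + real l) - (real n / 2 + real j)"
      unfolding nu using f0 by (simp add: Q_def field_simps)
    moreover have "Q / (4 * real f) * (\<alpha> - of_int p / Q) = (\<alpha> * Q - of_int p) / (4 * real f)"
      using f0 Q1 by (simp add: field_simps)
    ultimately have eq: "\<alpha> / 2 * (\<nu> + real l) - (real n / 2 + real j) = Q / (4 * real f) * (\<alpha> - of_int p / of_int q)"
      unfolding Q by simp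
    have "Q \<le> 2 * (real e + real f) * (1 + real l)"
      by (simp add: Q_def algebra_simps)
    then have "Q ^ m \<le> (2 * (real e + real f)) ^ m * (1 + real l) ^ m"
      using Q1 by (subst power_mult_distrib[symmetric]) (intro power_mono, auto)
    then have "C / (1 + real l) ^ m \<le> 1 / (4 * real f * Q ^ m)"
      unfolding C_def using f0 Q1 e by (simp add: field_simps) 
    also have "\<dots> \<le> Q / (4 * real f) * (1 / Q ^ m)"
      using f0 Q1 by (simp add: field_simps)
    also have "\<dots> \<le> Q / (4 * real f) * \<bar>\<alpha> - of_int p / of_int q\<bar>"
      using m[OF q2, of p] Q f0 Q1 by (intro mult_left_mono) auto
    also have "\<dots> = \<bar>\<alpha> / 2 * (\<nu> + real l) - (real n / 2 + real j)\<bar>"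
      unfolding eq using f0 Q1 by (simp add: abs_mult)
    finally show "C / (1 + real l) ^ m \<le> \<bar>\<alpha> / 2 * (\<nu> + real l) - (real n / 2 + real j)\<bar>" .
  qed
qed

lemma abs_exp_minus_diff_le:
  fixes s t :: real
  assumes "0 \<le> s" "0 \<le> t"
  shows "\<bar>exp (- s) - exp (- t)\<bar> \<le> \<bar>s - t\<bar>"
proof -
  have 1: "\<bar>exp (- s) - exp (- t)\<bar> \<le> t - s" if "s \<le> t" "0 \<le> s" for s t :: real
  proof -
    have "exp (- t) = exp (- s) * exp (- (t - s))" by (simp flip: exp_add)
    then have "exp (- s) - exp (- t) = exp (- s) * (1 - exp (- (t - s)))"
      by (simp only: right_diff_distrib mult_1_right)
    also have "\<dots> \<le> 1 * (t - s)"
    proof (rule mult_mono)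
      show "1 - exp (- (t - s)) \<le> t - s" using exp_ge_add_one_self[of "- (t - s)"] by linarith
    qed (use that in auto)
    finally show ?thesis using that by simp
  qed
  show ?thesis
  proof (cases "s \<le> t")
    case True
    with 1[of s t] assms show ?thesis by linarith
  next
    case False
    with 1[of t s] assms show ?thesis by linarith
  qed
qed

section \<open>The function S and the two parts of the transform\<close>

locale ml_param =
  fixes a \<nu> :: real
  assumes a: "0 < a" and nu: "0 < \<nu>"
begin

abbreviation c :: "nat \<Rightarrow> real" where "c \<equiv> ml_coeff a \<nu>"
abbreviation ex :: "nat \<Rightarrow> real" where "ex l \<equiv> a * (\<nu> + real l)"

definition S :: "real \<Rightarrow> real" where "S u = (\<Sum>l. c l * u powr (ex l - 1))"
definition high :: "real \<Rightarrow> real" where "high x = (LINT u:{0<..1}|lborel. S u * exp (- x * u))"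
definition low :: "real \<Rightarrow> real" where "low x = (1 + x powr a) powr (- \<nu>) - high x"

lemma ex_pos: "0 < ex l"
  using a nu by (simp add: mult_pos_pos add_pos_nonneg)

lemma ex_ge: "a * \<nu> \<le> ex l"
  using a by (intro mult_left_mono) auto

lemma summable_abs_c: "summable (\<lambda>l. \<bar>c l\<bar>)"
  using summable_ml_coeff[OF a nu, of 0] by simp

lemma S_measurable [measurable]: "S \<in> borel_measurable borel"
  unfolding S_def by measurable

text \<open>On (0,1] every power in S is at most the one with l = 0, namely u^(a \<nu> - 1), which
  is integrable; summability of the coefficients then suffices. The weights to come are 1, exp(-xu)
  and u^(-n/2) exp(-b/u).\<close>

lemma S_weight:
  fixes w :: "real \<Rightarrow> real"
  assumes [measurable]: "w \<in> borel_measurable borel"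
    and M: "\<And>u. u \<in> {0<..1} \<Longrightarrow> \<bar>w u\<bar> \<le> M"
  shows "set_integrable lborel {0<..1} (\<lambda>u. S u * w u)"
    and "(\<lambda>l. c l * (LINT u:{0<..1}|lborel. u powr (ex l - 1) * w u)) sums (LINT u:{0<..1}|lborel. S u * w u)"
    and "summable (\<lambda>l. \<bar>c l * (LINT u:{0<..1}|lborel. u powr (ex l - 1) * w u)\<bar>)"
proof -
  let ?f = "\<lambda>l u. c l * (u powr (ex l - 1) * w u)"
  have int: "set_integrable lborel {0<..1} (\<lambda>u. M * u powr (a * \<nu> - 1))"
    using a nu by (intro set_integrable_mult_right integral_powr_Ioc) auto
  have bd: "norm (?f l u) \<le> \<bar>c l\<bar> * (M * u powr (a * \<nu> - 1))" if "u \<in> {0<..1}" for l u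
  proof -
    have "u powr (ex l - 1) \<le> u powr (a * \<nu> - 1)"
      using that ex_ge[of l] by (intro powr_mono') auto
    then have "u powr (ex l - 1) * \<bar>w u\<bar> \<le> u powr (a * \<nu> - 1) * M"
      using M[OF that] by (intro mult_mono) auto
    then have "\<bar>c l\<bar> * (u powr (ex l - 1) * \<bar>w u\<bar>) \<le> \<bar>c l\<bar> * (u powr (a * \<nu> - 1) * M)"
      by (rule mult_left_mono) simp
    then show ?thesis by (simp add: abs_mult mult_ac)
  qed
  have meas: "?f l \<in> borel_measurable lborel" for l by measurable
  have sm: "(\<Sum>l. ?f l u) = S u * w u" if "u \<in> {0<..1}" for u
  proof -
    have "summable (\<lambda>l. c l * u powr (ex l - 1))"
    proof (rule summable_comparison_test')
      show "summable (\<lambda>l. \<bar>c l\<bar> * u powr (a * \<nu> - 1))"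
        by (intro summable_mult2 summable_abs_c)
      show "norm (c l * u powr (ex l - 1)) \<le> \<bar>c l\<bar> * u powr (a * \<nu> - 1)" for l
        unfolding norm_mult using that ex_ge[of l] by (auto intro!: mult_left_mono powr_mono')
    qed
    from suminf_mult2[OF this, of "w u"] show ?thesis by (simp add: S_def mult.assoc)
  qed
  note * = sums_set_integral_dominated[where f = ?f and M = lborel and A = "{0<..1}",
      OF meas _ bd summable_abs_c int, simplified]
  have cong: "set_integrable lborel {0<..1} (\<lambda>u. \<Sum>l. ?f l u) \<longleftrightarrow> set_integrable lborel {0<..1} (\<lambda>u. S u * w u)"
    by (rule set_integrable_cong[OF refl refl sm])
  show "set_integrable lborel {0<..1} (\<lambda>u. S u * w u)"
    using *(1) unfolding cong[symmetric] by simp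
  have "(LINT u:{0<..1}|lborel. (\<Sum>l. ?f l u)) = (LINT u:{0<..1}|lborel. S u * w u)"
    by (rule set_lebesgue_integral_cong) (use sm in auto)
  then show "(\<lambda>l. c l * (LINT u:{0<..1}|lborel. u powr (ex l - 1) * w u)) sums (LINT u:{0<..1}|lborel. S u * w u)"
    using *(2) by simp
  show "summable (\<lambda>l. \<bar>c l * (LINT u:{0<..1}|lborel. u powr (ex l - 1) * w u)\<bar>)"
    using *(3) by simp
qed

lemma S_integrable: "set_integrable lborel {0<..1} S"
  using S_weight(1)[of "\<lambda>_. 1" 1] by simp

lemma high_sums:
  assumes "0 \<le> x"
  shows "(\<lambda>l. c l * laplace_powr {0<..1} (ex l) x) sums high x"
  using S_weight(2)[of "\<lambda>u. exp (- x * u)" 1] assms unfolding high_def laplace_powr_def by simp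

text \<open>For u <= 1 and nonnegative arguments x -> exp(-xu) is Lipschitz with constant 1. What
  matters is the consequence that \<open>low\<close> is continuous up to x = 0, both for its bound
  on [0,2] and for Weierstrass approximation.\<close>

lemma high_lipschitz:
  assumes x: "0 \<le> x" and y: "0 \<le> y"
  shows "\<bar>high x - high y\<bar> \<le> (LINT u:{0<..1}|lborel. \<bar>S u\<bar>) * \<bar>x - y\<bar>"
proof -
  have int: "set_integrable lborel {0<..1} (\<lambda>u. S u * exp (- t * u))" if "0 \<le> t" for t
    by (rule S_weight(1)[where M = 1]) (use that in auto)
  have eq: "high x - high y = (LINT u:{0<..1}|lborel. S u * exp (- x * u) - S u * exp (- y * u))"
    unfolding high_def by (rule set_integral_diff(2)[OF int[OF x] int[OF y], symmetric])
  have "\<bar>high x - high y\<bar> \<le> (LINT u:{0<..1}|lborel. \<bar>S u * exp (- x * u) - S u * exp (- y * u)\<bar>)"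
    unfolding eq
    by (rule set_integral_norm_bound[OF set_integral_diff(1)[OF int[OF x] int[OF y]], unfolded real_norm_def])
  also have "\<dots> \<le> (LINT u:{0<..1}|lborel. \<bar>S u\<bar> * \<bar>x - y\<bar>)"
  proof (rule set_integral_mono)
    show "set_integrable lborel {0<..1} (\<lambda>u. \<bar>S u * exp (- x * u) - S u * exp (- y * u)\<bar>)"
      by (rule set_integrable_abs[OF set_integral_diff(1)[OF int[OF x] int[OF y]]])
    show "set_integrable lborel {0<..1} (\<lambda>u. \<bar>S u\<bar> * \<bar>x - y\<bar>)"
      by (rule set_integrable_mult_left[OF set_integrable_abs[OF S_integrable]])
    fix u :: real assume u: "u \<in> {0<..1}"
    have "\<bar>exp (- x * u) - exp (- y * u)\<bar> \<le> \<bar>x * u - y * u\<bar>"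
      using abs_exp_minus_diff_le[of "x * u" "y * u"] u x y by simp
    also have "\<dots> = \<bar>(x - y) * u\<bar>" by (simp only: left_diff_distrib)
    also have "\<dots> = \<bar>x - y\<bar> * u" using u by (simp add: abs_mult)
    also have "\<dots> \<le> \<bar>x - y\<bar>" using u by (intro mult_left_le) auto
    finally have "\<bar>S u\<bar> * \<bar>exp (- x * u) - exp (- y * u)\<bar> \<le> \<bar>S u\<bar> * \<bar>x - y\<bar>"
      by (rule mult_left_mono) simp
    moreover have "S u * p - S u * q = S u * (p - q)" for p q :: real
      by (rule right_diff_distrib[symmetric])
    ultimately show "\<bar>S u * exp (- x * u) - S u * exp (- y * u)\<bar> \<le> \<bar>S u\<bar> * \<bar>x - y\<bar>"
      by (simp only: abs_mult)
  qed
  finally show ?thesis unfolding set_integral_mult_left .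
qed

lemma continuous_on_low: "continuous_on {0..} low"
proof -
  have "((LINT u:{0<..1}|lborel. \<bar>S u\<bar>))-lipschitz_on {0..} high"
  proof (rule lipschitz_onI)
    show "dist (high x) (high y) \<le> (LINT u:{0<..1}|lborel. \<bar>S u\<bar>) * dist x y"
      if "x \<in> {0..}" "y \<in> {0..}" for x y
      using high_lipschitz[of x y] that by (simp add: dist_real_def)
    show "0 \<le> (LINT u:{0<..1}|lborel. \<bar>S u\<bar>)"
      unfolding set_lebesgue_integral_def by (intro Bochner_Integration.integral_nonneg) auto
  qed
  then have "continuous_on {0..} high" by (rule lipschitz_on_continuous_on)
  moreover have "1 + x powr a \<noteq> 0" for x :: real
    using powr_ge_zero[of x a] by linarith
  moreover have "continuous_on {0..} (\<lambda>x::real. x powr a)"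
    using a by (intro continuous_on_powr') (auto intro!: continuous_intros)
  ultimately show ?thesis
    unfolding low_def
    by (intro continuous_on_diff continuous_on_powr[OF continuous_on_add[OF continuous_on_const] continuous_on_const]) auto
qed

text \<open>The binomial coefficient is c_l Gamma(a(\<nu>+l)), so each term of the binomial series
  is c_l times a Laplace integral over all u > 0, and subtracting \<open>high\<close> removes the
  part u <= 1.\<close>

lemma low_sums:
  assumes x: "2 \<le> x"
  shows "(\<lambda>l. c l * laplace_powr {1<..} (ex l) x) sums low x"
proof -
  have "(\<lambda>l. (- \<nu> gchoose l) * x powr (- ex l) - c l * laplace_powr {0<..1} (ex l) x) sums low x"
    unfolding low_def using x by (intro sums_diff high_sums sums_one_plus_powr a) auto
  moreover have "(- \<nu> gchoose l) * x powr (- ex l) - c l * laplace_powr {0<..1} (ex l) x =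
      c l * laplace_powr {1<..} (ex l) x" for l
  proof -
    have "(- \<nu> gchoose l) = c l * Gamma (ex l)"
      using Gamma_real_pos[OF ex_pos[of l]] by (simp add: ml_coeff_def)
    then have "(- \<nu> gchoose l) * x powr (- ex l) = c l * (Gamma (ex l) * x powr (- ex l))" by simp
    also have "Gamma (ex l) * x powr (- ex l) = laplace_powr {0<..1} (ex l) x + laplace_powr {1<..} (ex l) x"
      using x by (intro laplace_powr_add[OF ex_pos, symmetric]) auto
    finally show ?thesis by (simp add: algebra_simps)
  qed
  ultimately show ?thesis by simp
qed

text \<open>Gamma cancels the denominator of c_l; what remains is the binomial series at x = 2 in
  absolute values.\<close>

lemma summable_c_Gamma: "summable (\<lambda>l. \<bar>c l\<bar> * (Gamma (ex l) * 2 powr (- ex l)))"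
proof -
  have "2 powr (- a) < (1::real)" using a powr_less_cancel_iff[of 2 "- a" 0] by simp
  then have "summable (\<lambda>l. 2 powr (- (a * \<nu>)) * (\<bar>- \<nu> gchoose l\<bar> * (2 powr (- a)) ^ l))"
    by (intro summable_mult summable_abs_gbinomial) auto
  moreover have "\<bar>c l\<bar> * (Gamma (ex l) * 2 powr (- ex l)) = 2 powr (- (a * \<nu>)) * (\<bar>- \<nu> gchoose l\<bar> * (2 powr (- a)) ^ l)" for l
  proof -
    have "2 powr (- ex l) = 2 powr (- (a * \<nu>)) * 2 powr (- (a * real l))"
      by (simp flip: powr_add) (simp add: algebra_simps)
    moreover have "(2 powr (- a)) ^ l = 2 powr (- (a * real l))"
      by (simp add: powr_powr flip: powr_realpow)
    ultimately show ?thesis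
      using Gamma_real_pos[OF ex_pos[of l]] by (simp add: ml_coeff_def abs_mult)
  qed
  ultimately show ?thesis by simp
qed

lemma c_laplace_le:
  assumes x: "2 \<le> x"
  shows "\<bar>c l * laplace_powr {1<..} (ex l) x\<bar> \<le> \<bar>c l\<bar> * (Gamma (ex l) * 2 powr (- ex l)) * exp (2 - x)"
proof -
  have "\<bar>c l\<bar> * laplace_powr {1<..} (ex l) x \<le> \<bar>c l\<bar> * (Gamma (ex l) * 2 powr (- ex l) * exp (2 - x))"
    by (intro mult_left_mono laplace_powr_Ioi_le ex_pos x) auto
  then show ?thesis
    using laplace_powr_nonneg[of "{1<..}" "ex l" x] by (simp add: abs_mult mult.assoc)
qed

text \<open>For x >= 2 the series \<open>low_sums\<close> gives the decay. On [0,2], which contains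
  points where the binomial series diverges, continuity on a compact interval is enough, as exp(2 -
  x) >= 1 there.\<close>

lemma low_bound:
  obtains C where "\<And>x. 0 \<le> x \<Longrightarrow> \<bar>low x\<bar> \<le> C * exp (- x)"
proof -
  let ?K = "\<Sum>l. \<bar>c l\<bar> * (Gamma (ex l) * 2 powr (- ex l))"
  have 1: "\<bar>low x\<bar> \<le> (?K * exp 2) * exp (- x)" if x: "2 \<le> x" for x
  proof -
    note sm = summable_mult2[OF summable_c_Gamma, of "exp (2 - x)"]
    have s: "summable (\<lambda>l. \<bar>c l * laplace_powr {1<..} (ex l) x\<bar>)"
      by (rule summable_comparison_test'[OF sm]) (use c_laplace_le[OF x] in auto)
    have "\<bar>low x\<bar> = \<bar>\<Sum>l. c l * laplace_powr {1<..} (ex l) x\<bar>"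
      using low_sums[OF x] by (simp add: sums_iff)
    also have "\<dots> \<le> (\<Sum>l. \<bar>c l * laplace_powr {1<..} (ex l) x\<bar>)"
      by (rule summable_rabs[OF s])
    also have "\<dots> \<le> (\<Sum>l. \<bar>c l\<bar> * (Gamma (ex l) * 2 powr (- ex l)) * exp (2 - x))"
      by (rule suminf_le[OF c_laplace_le[OF x] s sm])
    also have "\<dots> = ?K * exp (2 - x)" by (rule suminf_mult2[OF summable_c_Gamma, symmetric])
    also have "\<dots> = (?K * exp 2) * exp (- x)" by (simp add: exp_diff exp_minus field_simps)
    finally show ?thesis .
  qed
  have "compact (low ` {0..2})"
    by (intro compact_continuous_image continuous_on_subset[OF continuous_on_low]) auto
  then obtain B where B: "\<And>x. x \<in> {0..2} \<Longrightarrow> \<bar>low x\<bar> \<le> B"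
    by (meson bounded_real compact_imp_bounded imageI)
  have B0: "0 \<le> B" using B[of 0] by simp
  have K0: "0 \<le> ?K * exp 2"
    using Gamma_real_pos[OF ex_pos] by (intro mult_nonneg_nonneg suminf_nonneg summable_c_Gamma) (auto simp: less_imp_le)
  have 2: "\<bar>low x\<bar> \<le> (B * exp 2) * exp (- x)" if "x \<in> {0..2}" for x
  proof -
    have "\<bar>low x\<bar> \<le> B * 1" using B[OF that] by simp
    also have "\<dots> \<le> B * exp (2 - x)" using that B0 by (intro mult_left_mono) auto
    finally show ?thesis by (simp add: exp_diff exp_minus field_simps)
  qed
  show thesis
  proof (rule that)
    fix x :: real assume x: "0 \<le> x"
    show "\<bar>low x\<bar> \<le> (?K * exp 2 + B * exp 2) * exp (- x)"
    proof (cases "2 \<le> x")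
      case True
      have "\<bar>low x\<bar> \<le> (?K * exp 2) * exp (- x)" using 1[OF True] .
      also have "\<dots> \<le> (?K * exp 2 + B * exp 2) * exp (- x)" using B0 by (intro mult_right_mono) auto
      finally show ?thesis .
    next
      case False
      have "\<bar>low x\<bar> \<le> (B * exp 2) * exp (- x)" using 2[of x] x False by auto
      also have "\<dots> \<le> (?K * exp 2 + B * exp 2) * exp (- x)" using K0 by (intro mult_right_mono) auto
      finally show ?thesis .
    qed
  qed
qed


lemma high_measurable [measurable]: "high \<in> borel_measurable borel"
  unfolding high_def set_lebesgue_integral_def by measurable

lemma low_measurable [measurable]: "low \<in> borel_measurable borel"
  unfolding low_def by measurable

section \<open>Mellin moments of the rapidly decaying part\<close>

lemma low_mellin_integrable:
  assumes z: "0 < z"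
  shows "set_integrable lborel {0<..} (\<lambda>x. x powr (z - 1) * low x)"
proof -
  obtain C where C: "\<And>x. 0 \<le> x \<Longrightarrow> \<bar>low x\<bar> \<le> C * exp (- x)" using low_bound by blast
  have "set_integrable lborel {0<..} (\<lambda>x. C * (x powr (z - 1) * exp (- 1 * x)))"
    by (rule set_integrable_mult_right[OF integral_powr_exp(1)[OF z zero_less_one]])
  then show ?thesis
  proof (rule set_integrable_bound)
    show "set_borel_measurable lborel {0<..} (\<lambda>x. x powr (z - 1) * low x)"
      unfolding set_borel_measurable_def by measurable
    have "norm (x powr (z - 1) * low x) \<le> norm (C * (x powr (z - 1) * exp (- 1 * x)))" if "x \<in> {0<..}" for x
    proof -
      have "x powr (z - 1) * \<bar>low x\<bar> \<le> x powr (z - 1) * (C * exp (- x))"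
        using that by (intro mult_left_mono C) auto
      also have "\<dots> = C * (x powr (z - 1) * exp (- 1 * x))" by simp
      also have "\<dots> \<le> norm (C * (x powr (z - 1) * exp (- 1 * x)))" by (simp only: real_norm_def abs_ge_self)
      finally show ?thesis by (simp add: abs_mult)
    qed
    then show "AE x in lborel. x \<in> {0<..} \<longrightarrow> norm (x powr (z - 1) * low x) \<le> norm (C * (x powr (z - 1) * exp (- 1 * x)))"
      by (intro AE_I2) auto
  qed
qed

text \<open>The integrals over u <= 1 are at most 1/(a(\<nu>+l)) <= 1/(a \<nu>) for all x >= 0.
  Unlike the binomial series, this expansion can therefore be integrated down to x = 0.\<close>

lemma mellin_high_sums:
  assumes z: "0 < z"
  shows "(\<lambda>l. c l * (LINT x:{0<..2}|lborel. x powr (z - 1) * laplace_powr {0<..1} (ex l) x)) sums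
      (LINT x:{0<..2}|lborel. x powr (z - 1) * high x)"
    and "set_integrable lborel {0<..2} (\<lambda>x. x powr (z - 1) * high x)"
proof -
  let ?f = "\<lambda>l x. c l * (x powr (z - 1) * laplace_powr {0<..1} (ex l) x)"
  have bd: "norm (?f l x) \<le> \<bar>c l\<bar> * (1 / (a * \<nu>) * x powr (z - 1))" if "x \<in> {0<..2}" for l x
  proof -
    have "laplace_powr {0<..1} (ex l) x \<le> 1 / ex l"
      using that by (intro laplace_powr_Ioc_le(2) ex_pos) auto
    also have "\<dots> \<le> 1 / (a * \<nu>)"
      using ex_ge[of l] a nu by (intro divide_left_mono) (auto intro!: mult_pos_pos)
    finally have "x powr (z - 1) * laplace_powr {0<..1} (ex l) x \<le> x powr (z - 1) * (1 / (a * \<nu>))"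
      by (rule mult_left_mono) simp
    then have "\<bar>c l\<bar> * (x powr (z - 1) * laplace_powr {0<..1} (ex l) x) \<le> \<bar>c l\<bar> * (x powr (z - 1) * (1 / (a * \<nu>)))"
      by (rule mult_left_mono) simp
    then show ?thesis
      using laplace_powr_nonneg[of "{0<..1}" "ex l" x] by (simp only: abs_mult real_norm_def abs_of_nonneg powr_ge_zero mult_ac)
  qed
  have sm: "(\<Sum>l. ?f l x) = x powr (z - 1) * high x" if "x \<in> {0<..2}" for x
  proof -
    have "(\<lambda>l. x powr (z - 1) * (c l * laplace_powr {0<..1} (ex l) x)) sums (x powr (z - 1) * high x)"
      using that by (intro sums_mult high_sums) auto
    then have "(\<lambda>l. ?f l x) sums (x powr (z - 1) * high x)" by (simp only: mult.left_commute)
    then show ?thesis by (simp only: sums_iff)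
  qed
  have int: "set_integrable lborel {0<..2} (\<lambda>x. 1 / (a * \<nu>) * x powr (z - 1))"
    by (intro set_integrable_mult_right integral_powr_Ioc z) simp
  have meas: "?f l \<in> borel_measurable lborel" for l by measurable
  have A: "{0<..2::real} \<in> sets lborel" by simp
  note * = sums_set_integral_dominated[OF meas A bd summable_abs_c int]
  have "(LINT x:{0<..2}|lborel. (\<Sum>l. ?f l x)) = (LINT x:{0<..2}|lborel. x powr (z - 1) * high x)"
    by (rule set_lebesgue_integral_cong) (use sm in auto)
  then show "(\<lambda>l. c l * (LINT x:{0<..2}|lborel. x powr (z - 1) * laplace_powr {0<..1} (ex l) x)) sums
      (LINT x:{0<..2}|lborel. x powr (z - 1) * high x)"
    using *(2) by (simp only: set_integral_mult_right)
  have "set_integrable lborel {0<..2} (\<lambda>x. \<Sum>l. ?f l x) \<longleftrightarrow> set_integrable lborel {0<..2} (\<lambda>x. x powr (z - 1) * high x)"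
    by (rule set_integrable_cong[OF refl refl sm])
  with *(1) show "set_integrable lborel {0<..2} (\<lambda>x. x powr (z - 1) * high x)" by blast
qed

lemma mellin_low_tail_sums:
  assumes z: "0 < z"
  shows "(\<lambda>l. c l * (LINT x:{2<..}|lborel. x powr (z - 1) * laplace_powr {1<..} (ex l) x)) sums
      (LINT x:{2<..}|lborel. x powr (z - 1) * low x)"
proof -
  let ?f = "\<lambda>l x. c l * (x powr (z - 1) * laplace_powr {1<..} (ex l) x)"
  have bd: "norm (?f l x) \<le> \<bar>c l\<bar> * (Gamma (ex l) * 2 powr (- ex l)) * (exp 2 * (x powr (z - 1) * exp (- 1 * x)))"
    if "x \<in> {2<..}" for l x
  proof -
    let ?K = "\<bar>c l\<bar> * (Gamma (ex l) * 2 powr (- ex l))"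
    have "x powr (z - 1) * \<bar>c l * laplace_powr {1<..} (ex l) x\<bar> \<le> x powr (z - 1) * (?K * exp (2 - x))"
      using that by (intro mult_left_mono c_laplace_le) auto
    moreover have "exp (2 - x) = exp 2 * exp (- 1 * x)" by (simp flip: exp_add)
    ultimately have "x powr (z - 1) * \<bar>c l * laplace_powr {1<..} (ex l) x\<bar> \<le> ?K * (exp 2 * (x powr (z - 1) * exp (- 1 * x)))"
      by (simp only: mult_ac)
    then show ?thesis by (simp only: abs_mult real_norm_def abs_of_nonneg powr_ge_zero mult.left_commute)
  qed
  have sm: "(\<Sum>l. ?f l x) = x powr (z - 1) * low x" if "x \<in> {2<..}" for x
  proof -
    have "(\<lambda>l. x powr (z - 1) * (c l * laplace_powr {1<..} (ex l) x)) sums (x powr (z - 1) * low x)"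
      using that by (intro sums_mult low_sums) auto
    then have "(\<lambda>l. ?f l x) sums (x powr (z - 1) * low x)" by (simp only: mult.left_commute)
    then show ?thesis by (simp only: sums_iff)
  qed
  have int: "set_integrable lborel {2<..} (\<lambda>x. exp 2 * (x powr (z - 1) * exp (- 1 * x)))"
    by (intro set_integrable_mult_right set_integrable_subset[OF integral_powr_exp(1)[OF z zero_less_one]]) auto
  have meas: "?f l \<in> borel_measurable lborel" for l by measurable
  have A: "{2::real<..} \<in> sets lborel" by simp
  note * = sums_set_integral_dominated[OF meas A bd summable_c_Gamma int]
  have "(LINT x:{2<..}|lborel. (\<Sum>l. ?f l x)) = (LINT x:{2<..}|lborel. x powr (z - 1) * low x)"
    by (rule set_lebesgue_integral_cong) (use sm in auto)
  then show ?thesis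
    using *(2) by (simp only: set_integral_mult_right)
qed

text \<open>The moment of \<open>low\<close> is that of (1 + x^a)^(-\<nu>) over (0,2], minus that of
  \<open>high\<close> over (0,2], plus that of \<open>low\<close> over (2, infinity). Each piece has
  a series in l, and the three series collapse to simple fractions. The gamma quotient is the Mellin
  transform of (1 + x^a)^(-\<nu>), used here also for z > a \<nu>, where the integral itself
  diverges.\<close>

lemma low_mellin_sums:
  assumes z: "0 < z" and ne: "\<And>l. z \<noteq> ex l"
  shows "(\<lambda>l. c l / (ex l - z)) sums
    ((Gamma (z / a) * Gamma (\<nu> - z / a) / (a * Gamma \<nu>) - (LINT x:{0<..}|lborel. x powr (z - 1) * low x)) / Gamma z)"
proof -
  let ?H = "LINT x:{0<..2}|lborel. x powr (z - 1) * (1 + x powr a) powr (- \<nu>)"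
  let ?L = "LINT x:{0<..2}|lborel. x powr (z - 1) * high x"
  let ?U = "LINT x:{2<..}|lborel. x powr (z - 1) * low x"
  let ?N = "LINT x:{0<..}|lborel. x powr (z - 1) * low x"
  let ?C = "Gamma (z / a) * Gamma (\<nu> - z / a) / (a * Gamma \<nu>)"
  have "?N = (LINT x:{0<..2}|lborel. x powr (z - 1) * low x) + ?U"
    by (rule set_integral_Ioi_split[OF low_mellin_integrable[OF z]]) simp
  also have "(LINT x:{0<..2}|lborel. x powr (z - 1) * low x) = ?H - ?L"
  proof -
    have "(LINT x:{0<..2}|lborel. x powr (z - 1) * low x) =
        (LINT x:{0<..2}|lborel. x powr (z - 1) * (1 + x powr a) powr (- \<nu>) - x powr (z - 1) * high x)"
      by (rule set_lebesgue_integral_cong) (auto simp: low_def right_diff_distrib)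
    also have "\<dots> = ?H - ?L"
      by (rule set_integral_diff(2)[OF set_integrable_truncated_mellin[OF z less_imp_le[OF nu]] mellin_high_sums(2)[OF z]])
    finally show ?thesis .
  qed
  finally have N: "?N = ?H - ?L + ?U" .
  have Gz: "0 < Gamma z" using z by (rule Gamma_real_pos)
  note t1 = truncated_mellin_sums[OF a z nu ne]
  have "(\<lambda>l. ((- \<nu> gchoose l) * 2 powr (z - ex l) / (z - ex l) +
      (c l * (LINT x:{2<..}|lborel. x powr (z - 1) * laplace_powr {1<..} (ex l) x) -
       c l * (LINT x:{0<..2}|lborel. x powr (z - 1) * laplace_powr {0<..1} (ex l) x))) / (- Gamma z)) sums
      ((?H - ?C + (?U - ?L)) / (- Gamma z))"
    by (intro sums_divide sums_add t1 sums_diff mellin_low_tail_sums[OF z] mellin_high_sums(1)[OF z])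
  moreover have "((- \<nu> gchoose l) * 2 powr (z - ex l) / (z - ex l) +
      (c l * (LINT x:{2<..}|lborel. x powr (z - 1) * laplace_powr {1<..} (ex l) x) -
       c l * (LINT x:{0<..2}|lborel. x powr (z - 1) * laplace_powr {0<..1} (ex l) x))) / (- Gamma z) =
      c l / (ex l - z)" for l
  proof -
    have "ex l \<noteq> z" using ne[of l] by auto
    note d = mellin_laplace_powr_diff[OF ex_pos z this]
    have g: "(- \<nu> gchoose l) = c l * Gamma (ex l)"
      using Gamma_real_pos[OF ex_pos[of l]] by (simp add: ml_coeff_def)
    \<comment> \<open>The contributions of the cut x = 2, with P = 2^(z-E), cancel:
      \<open>truncated_mellin_sums\<close> and \<open>mellin_laplace_powr_diff\<close> contain them
      with opposite denominators.\<close>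
    have "(C * G * P / (z - E) + C * (G * P / (E - z) - Z / (E - z))) / (- Z) = C / (E - z)"
      if "E \<noteq> z" "0 < Z" for C G P E Z :: real
    proof -
      have "C * G * P / (z - E) = - (C * (G * P / (E - z)))"
        using that by (simp add: field_simps)
      then show ?thesis using that by (simp add: right_diff_distrib)
    qed
    from this[OF \<open>ex l \<noteq> z\<close> Gz] show ?thesis
      unfolding g d right_diff_distrib[of "c l", symmetric] .
  qed
  moreover have "(?H - ?C + (?U - ?L)) / (- Gamma z) = (?C - ?N) / Gamma z"
    unfolding N using Gz by (simp add: field_simps)
  ultimately show ?thesis by (simp only:)
qed

end

section \<open>Gaussian and radial Fourier integrals\<close>

lemma exp_square_normal_density:
  fixes v :: real
  assumes v: "0 < v"
  shows "exp (- v * t\<^sup>2) = sqrt (pi / v) * normal_density 0 (1 / sqrt (2 * v)) t"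
proof -
  have "(1 / sqrt (2 * v))\<^sup>2 = 1 / (2 * v)" using v by (simp add: power_divide)
  then show ?thesis
    using v by (simp add: normal_density_def real_sqrt_divide field_simps)
qed

lemma gaussian_fourier_real:
  fixes v y :: real
  assumes v: "0 < v"
  shows "integrable lborel (\<lambda>t. iexp (y * t) * complex_of_real (exp (- v * t\<^sup>2)))"
    and "(\<integral>t. iexp (y * t) * complex_of_real (exp (- v * t\<^sup>2)) \<partial>lborel) =
      complex_of_real (sqrt (pi / v) * exp (- y\<^sup>2 / (4 * v)))"
proof -
  let ?F = "\<lambda>t. iexp (y * t) * complex_of_real (exp (- v * t\<^sup>2))"
  define s where "s = 1 / sqrt (2 * v)"
  have s: "0 < s" using v by (simp add: s_def)
  have s2: "v * s\<^sup>2 = 1 / 2" using v by (simp add: s_def power_divide)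
  have "integrable lborel (\<lambda>t. exp (- v * t\<^sup>2))"
    unfolding exp_square_normal_density[OF v] using v by simp
  then show "integrable lborel ?F"
    by (rule Bochner_Integration.integrable_bound) (auto simp: norm_mult)
  have F: "?F (0 + s * x) = complex_of_real (sqrt (2 * pi)) * (complex_of_real (std_normal_density x) * iexp (y * s * x))" for x
  proof -
    have "- v * (s * x)\<^sup>2 = - (v * s\<^sup>2) * x\<^sup>2" by (simp add: power_mult_distrib)
    then have "exp (- v * (s * x)\<^sup>2) = sqrt (2 * pi) * std_normal_density x"
      unfolding s2 by (simp add: normal_density_def)
    then show ?thesis by (simp add: mult_ac)
  qed
  have "(\<integral>t. ?F t \<partial>lborel) = \<bar>s\<bar> *\<^sub>R (\<integral>x. ?F (0 + s * x) \<partial>lborel)"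
    using s by (intro lborel_integral_real_affine) auto
  also have "(\<integral>x. ?F (0 + s * x) \<partial>lborel) =
      complex_of_real (sqrt (2 * pi)) * (\<integral>x. complex_of_real (std_normal_density x) * iexp (y * s * x) \<partial>lborel)"
    unfolding F by simp
  also have "(\<integral>x. complex_of_real (std_normal_density x) * iexp (y * s * x) \<partial>lborel) = char std_normal_distribution (y * s)"
    unfolding char_def by (subst integral_density) (auto simp: scaleR_conv_of_real)
  also have "\<dots> = complex_of_real (exp (- ((y * s)\<^sup>2) / 2))"
    by (simp only: char_std_normal_distribution)
  also have "(y * s)\<^sup>2 / 2 = y\<^sup>2 / (4 * v)"
    using v by (simp add: s_def power_mult_distrib power_divide)
  then have "- ((y * s)\<^sup>2) / 2 = - y\<^sup>2 / (4 * v)" by simp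
  also have "\<bar>s\<bar> *\<^sub>R (complex_of_real (sqrt (2 * pi)) * complex_of_real (exp (- y\<^sup>2 / (4 * v)))) =
      complex_of_real ((s * sqrt (2 * pi)) * exp (- y\<^sup>2 / (4 * v)))"
    using s by (simp add: scaleR_conv_of_real)
  also have "s * sqrt (2 * pi) = sqrt (pi / v)"
    using v by (simp add: s_def real_sqrt_mult real_sqrt_divide)
  finally show "(\<integral>t. ?F t \<partial>lborel) = complex_of_real (sqrt (pi / v) * exp (- y\<^sup>2 / (4 * v)))" .
qed

text \<open>Both exponentials factor over the coordinates, so the integral is a product of
  one-dimensional ones.\<close>

lemma gaussian_fourier:
  fixes x :: "'a::euclidean_space"
  assumes v: "0 < v"
  shows "integrable lborel (\<lambda>t. iexp (x \<bullet> t) * complex_of_real (exp (- v * (norm t)\<^sup>2)))"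
    and "(\<integral>t. iexp (x \<bullet> t) * complex_of_real (exp (- v * (norm t)\<^sup>2)) \<partial>lborel) =
      complex_of_real ((pi / v) powr (DIM('a) / 2) * exp (- (norm x)\<^sup>2 / (4 * v)))"
proof -
  interpret product_sigma_finite "\<lambda>_::'a. lborel :: real measure" ..
  let ?F = "\<lambda>t::'a. iexp (x \<bullet> t) * complex_of_real (exp (- v * (norm t)\<^sup>2))"
  let ?f = "\<lambda>b s. iexp ((x \<bullet> b) * s) * complex_of_real (exp (- v * s\<^sup>2))"
  let ?P = "\<lambda>f. \<Sum>b\<in>(Basis :: 'a set). f b *\<^sub>R b"
  have F: "?F (?P s) = (\<Prod>b\<in>Basis. ?f b (s b))" for s
  proof -
    have n: "(norm (?P s))\<^sup>2 = (\<Sum>b\<in>Basis. (s b)\<^sup>2)"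
      by (simp only: power2_norm_eq_inner, subst euclidean_inner) (simp add: power2_eq_square)
    have "x \<bullet> ?P s = (\<Sum>b\<in>Basis. (x \<bullet> b) * s b)"
      by (simp add: inner_sum_right mult.commute)
    then have "iexp (x \<bullet> ?P s) = (\<Prod>b\<in>Basis. iexp ((x \<bullet> b) * s b))"
      by (simp add: sum_distrib_left flip: exp_sum)
    moreover have "exp (- v * (norm (?P s))\<^sup>2) = (\<Prod>b\<in>Basis. exp (- v * (s b)\<^sup>2))"
      unfolding n by (simp add: sum_distrib_left sum_negf flip: exp_sum)
    ultimately show ?thesis by (simp add: prod.distrib)
  qed
  have meas: "?F \<in> borel_measurable borel" by measurable
  have meas2: "?P \<in> measurable (Pi\<^sub>M Basis (\<lambda>_. lborel)) borel" by measurable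
  note g = gaussian_fourier_real[OF v]
  have "integrable (Pi\<^sub>M Basis (\<lambda>_. lborel)) (\<lambda>s. \<Prod>b\<in>Basis. ?f b (s b))"
    by (rule product_integrable_prod[OF finite_Basis]) (rule g(1))
  then show "integrable lborel ?F"
    by (subst lborel_eq) (simp only: integrable_distr_eq[OF meas2 meas] F)
  have "(\<integral>t. ?F t \<partial>lborel) = (\<integral>s. (\<Prod>b\<in>Basis. ?f b (s b)) \<partial>Pi\<^sub>M Basis (\<lambda>_. lborel))"
    by (subst lborel_eq) (simp only: integral_distr[OF meas2 meas] F)
  also have "\<dots> = (\<Prod>b\<in>Basis. (\<integral>t. ?f b t \<partial>lborel))"
    by (rule product_integral_prod[OF finite_Basis]) (rule g(1))
  also have "\<dots> = (\<Prod>b\<in>(Basis :: 'a set). complex_of_real (sqrt (pi / v) * exp (- (x \<bullet> b)\<^sup>2 / (4 * v))))"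
    by (simp only: g(2))
  also have "\<dots> = complex_of_real (sqrt (pi / v) ^ DIM('a) * exp (- (norm x)\<^sup>2 / (4 * v)))"
  proof -
    have "(norm x)\<^sup>2 = (\<Sum>b\<in>Basis. (x \<bullet> b)\<^sup>2)"
      by (simp only: power2_norm_eq_inner, subst euclidean_inner) (simp add: power2_eq_square)
    then have "(\<Prod>b\<in>Basis. exp (- (x \<bullet> b)\<^sup>2 / (4 * v))) = exp (- (norm x)\<^sup>2 / (4 * v))"
      by (simp add: sum_divide_distrib sum_negf flip: exp_sum)
    then show ?thesis by (simp add: prod.distrib flip: of_real_prod of_real_power)
  qed
  also have "sqrt (pi / v) ^ DIM('a) = (pi / v) powr (DIM('a) / 2)"
    using v by (simp add: powr_half_sqrt[symmetric] powr_powr flip: powr_realpow)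
  finally show "(\<integral>t. ?F t \<partial>lborel) = complex_of_real ((pi / v) powr (DIM('a) / 2) * exp (- (norm x)\<^sup>2 / (4 * v)))" .
qed

lemma gaussian_integral:
  assumes v: "0 < v"
  shows "integrable lborel (\<lambda>t::'a::euclidean_space. exp (- v * (norm t)\<^sup>2))"
    and "(\<integral>t. exp (- v * (norm (t::'a::euclidean_space))\<^sup>2) \<partial>lborel) = (pi / v) powr (DIM('a) / 2)"
proof -
  have "integrable lborel (\<lambda>t::'a. complex_of_real (exp (- v * (norm t)\<^sup>2)))"
    using gaussian_fourier(1)[OF v, of "0::'a"] by simp
  then show "integrable lborel (\<lambda>t::'a. exp (- v * (norm t)\<^sup>2))"
    by (simp only: complex_of_real_integrable_eq)
  have "complex_of_real (\<integral>t. exp (- v * (norm (t::'a))\<^sup>2) \<partial>lborel) = complex_of_real ((pi / v) powr (DIM('a) / 2))"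
    using gaussian_fourier(2)[OF v, of "0::'a"] by (simp flip: integral_complex_of_real)
  then show "(\<integral>t. exp (- v * (norm (t::'a))\<^sup>2) \<partial>lborel) = (pi / v) powr (DIM('a) / 2)"
    by (simp only: of_real_eq_iff)
qed

section \<open>Fourier integrals of radial functions\<close>

text \<open>Substitute y = exp(-x), so that sums of exponentials become polynomials on [0,1], and
  apply Weierstrass to G(y) = g(-ln y) y^(-1/2). The decay exp(-x) is split in two halves: one makes
  |G(y)| <= C sqrt(y), hence \<open>G\<close> continuous with value 0 at y = 0, and the other
  remains as the weight exp(-x/2) of the error.\<close>

lemma approx_exp_sum:
  fixes g :: "real \<Rightarrow> real"
  assumes cont: "continuous_on {0..} g" and C: "\<And>x. 0 \<le> x \<Longrightarrow> \<bar>g x\<bar> \<le> C * exp (- x)" and d: "0 < d"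
  obtains q :: "nat \<Rightarrow> real" and m where
    "\<And>x. 0 \<le> x \<Longrightarrow> \<bar>g x - (\<Sum>i\<le>m. q i * exp (- (1 / 2 + real i) * x))\<bar> \<le> d * exp (- x / 2)"
proof -
  define G where "G y = (if y \<le> 0 then 0 else g (- ln y) * y powr (- 1 / 2))" for y :: real
  have "continuous_on {0..1} G"
    unfolding continuous_on_eq_continuous_within
  proof
    fix y :: real assume y: "y \<in> {0..1}"
    show "continuous (at y within {0..1}) G"
    proof (cases "y = 0")
      case True
      have "((\<lambda>y. C * sqrt y) \<longlongrightarrow> C * sqrt 0) (at 0 within {0..1})"
        by (intro tendsto_intros)
      then have "((\<lambda>y. C * sqrt y) \<longlongrightarrow> 0) (at 0 within {0..1})" by simp
      then have "(G \<longlongrightarrow> 0) (at 0 within {0..1})"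
      proof (rule Lim_null_comparison[rotated])
        have "norm (G y) \<le> C * sqrt y" if "y \<in> {0..1}" "y \<noteq> 0" for y
        proof -
          have "\<bar>g (- ln y)\<bar> \<le> C * y"
            using C[of "- ln y"] that by simp
          then have "\<bar>g (- ln y)\<bar> * y powr (- 1 / 2) \<le> C * y * y powr (- 1 / 2)"
            by (rule mult_right_mono) simp
          also have "y * y powr (- 1 / 2) = sqrt y"
            using that powr_mult_base[of y "- 1 / 2"] by (simp add: powr_half_sqrt)
          then have "C * y * y powr (- 1 / 2) = C * sqrt y" by simp
          finally show ?thesis using that by (simp add: G_def abs_mult)
        qed
        then show "\<forall>\<^sub>F y in at 0 within {0..1}. norm (G y) \<le> C * sqrt y"
          by (auto simp: eventually_at_filter)
      qed
      then show ?thesis using True by (simp add: continuous_within G_def)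
    next
      case False
      have "continuous_on {0<..1} (\<lambda>y. g (- ln y) * y powr (- 1 / 2))"
        by (intro continuous_intros continuous_on_compose2[OF cont]) auto
      then have "continuous_on {0<..1} G"
        by (rule continuous_on_eq) (auto simp: G_def)
      then have "continuous (at y within {0<..1}) G"
        using y False by (auto simp: continuous_on_eq_continuous_within)
      moreover have "at y within {0<..1} = at y within {0..1}"
        by (rule at_within_nhd[of y "{0<..}"]) (use y False in auto)
      ultimately show ?thesis by simp
    qed
  qed
  then obtain P where "real_polynomial_function P" and P: "\<And>y. y \<in> {0..1} \<Longrightarrow> \<bar>G y - P y\<bar> < d"
    using Stone_Weierstrass_real_polynomial_function[of "{0..1}" G d] d by auto
  then obtain q m where q: "P = (\<lambda>y. \<Sum>i\<le>m. q i * y ^ i)"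
    by (auto simp: real_polynomial_function_iff_sum)
  show thesis
  proof (rule that)
    fix x :: real assume x: "0 \<le> x"
    have g: "g x = exp (- x / 2) * G (exp (- x))"
      by (simp add: G_def powr_def flip: exp_add)
    have "(\<Sum>i\<le>m. q i * exp (- (1 / 2 + real i) * x)) = exp (- x / 2) * P (exp (- x))"
      unfolding q sum_distrib_left
    proof (rule sum.cong)
      fix i
      have "exp (- (1 / 2 + real i) * x) = exp (- x / 2) * exp (- x) ^ i"
        by (simp add: algebra_simps flip: exp_add exp_of_nat_mult)
      then show "q i * exp (- (1 / 2 + real i) * x) = exp (- x / 2) * (q i * exp (- x) ^ i)" by simp
    qed simp
    then have "\<bar>g x - (\<Sum>i\<le>m. q i * exp (- (1 / 2 + real i) * x))\<bar> = exp (- x / 2) * \<bar>G (exp (- x)) - P (exp (- x))\<bar>"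
      unfolding g by (simp add: abs_mult flip: right_diff_distrib)
    also have "\<dots> \<le> exp (- x / 2) * d"
      using P[of "exp (- x)"] x by (intro mult_left_mono) auto
    finally show "\<bar>g x - (\<Sum>i\<le>m. q i * exp (- (1 / 2 + real i) * x))\<bar> \<le> d * exp (- x / 2)"
      by (simp add: mult.commute)
  qed
qed


lemma abs_mellin_le:
  fixes h :: "real \<Rightarrow> real"
  assumes h: "set_integrable lborel {0<..} (\<lambda>x. x powr (z - 1) * h x)" and z: "0 < z" and v: "0 < v"
    and bd: "\<And>x. 0 \<le> x \<Longrightarrow> \<bar>h x\<bar> \<le> d * exp (- v * x)"
  shows "\<bar>LINT x:{0<..}|lborel. x powr (z - 1) * h x\<bar> \<le> d * (Gamma z * v powr (- z))"
proof -
  have "\<bar>LINT x:{0<..}|lborel. x powr (z - 1) * h x\<bar> \<le> (LINT x:{0<..}|lborel. \<bar>x powr (z - 1) * h x\<bar>)"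
    by (rule set_integral_norm_bound[OF h, unfolded real_norm_def])
  also have "\<dots> \<le> (LINT x:{0<..}|lborel. d * (x powr (z - 1) * exp (- v * x)))"
  proof (rule set_integral_mono)
    show "set_integrable lborel {0<..} (\<lambda>x. \<bar>x powr (z - 1) * h x\<bar>)"
      by (rule set_integrable_abs[OF h])
    show "set_integrable lborel {0<..} (\<lambda>x. d * (x powr (z - 1) * exp (- v * x)))"
      by (rule set_integrable_mult_right[OF integral_powr_exp(1)[OF z v]])
    fix x :: real assume "x \<in> {0<..}"
    then have "x powr (z - 1) * \<bar>h x\<bar> \<le> x powr (z - 1) * (d * exp (- v * x))"
      by (intro mult_left_mono bd) auto
    then show "\<bar>x powr (z - 1) * h x\<bar> \<le> d * (x powr (z - 1) * exp (- v * x))"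
      by (simp add: abs_mult mult.left_commute)
  qed
  also have "\<dots> = d * (Gamma z * v powr (- z))"
    unfolding set_integral_mult_right integral_powr_exp(2)[OF z v] ..
  finally show ?thesis .
qed

text \<open>Both sides are continuous in g for the norm sup |g(y)| exp(y/2), and for g an exponential the
  identity is the Gaussian Fourier integral; linear combinations of exponentials are dense by
  Weierstrass. This replaces integration in polar coordinates.\<close>

lemma radial_fourier_sums:
  fixes x :: "'a::euclidean_space" and g :: "real \<Rightarrow> real"
  defines "n \<equiv> real DIM('a)" and "b \<equiv> (norm x)\<^sup>2 / 4"
  assumes cont: "continuous_on {0..} g" and C: "\<And>y. 0 \<le> y \<Longrightarrow> \<bar>g y\<bar> \<le> C * exp (- y)"
    and g [measurable]: "g \<in> borel_measurable borel"
    and gi: "\<And>z. 0 < z \<Longrightarrow> set_integrable lborel {0<..} (\<lambda>y. y powr (z - 1) * g y)"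
  shows "integrable lborel (\<lambda>t. iexp (x \<bullet> t) * complex_of_real (g ((norm t)\<^sup>2)))"
    and "(\<lambda>j. pi powr (n / 2) * (- b) ^ j / (fact j * Gamma (n / 2 + real j)) *
        (LINT y:{0<..}|lborel. y powr (n / 2 + real j - 1) * g y)) sums
      Re (\<integral>t. iexp (x \<bullet> t) * complex_of_real (g ((norm t)\<^sup>2)) \<partial>lborel)"
    and "Im (\<integral>t. iexp (x \<bullet> t) * complex_of_real (g ((norm t)\<^sup>2)) \<partial>lborel) = 0"
    and "summable (\<lambda>j. \<bar>pi powr (n / 2) * (- b) ^ j / (fact j * Gamma (n / 2 + real j)) *
        (LINT y:{0<..}|lborel. y powr (n / 2 + real j - 1) * g y)\<bar>)"
proof -
  define z where "z j = n / 2 + real j" for j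
  have n: "0 < n" by (simp add: n_def)
  have z: "0 < z j" for j using n by (simp add: z_def)
  have b: "0 \<le> b" by (simp add: b_def)
  define K where "K j = pi powr (n / 2) * (- b) ^ j / (fact j * Gamma (z j))" for j
  define N where "N h j = (LINT y:{0<..}|lborel. y powr (z j - 1) * h y)" for h :: "real \<Rightarrow> real" and j
  define J where "J h = (\<integral>t. iexp (x \<bullet> t) * complex_of_real (h ((norm t)\<^sup>2)) \<partial>lborel)" for h :: "real \<Rightarrow> real"
  define W where "W h \<longleftrightarrow> integrable lborel (\<lambda>t. iexp (x \<bullet> t) * complex_of_real (h ((norm t)\<^sup>2)))" for h :: "real \<Rightarrow> real"
  have pi_powr: "(pi / v) powr s = pi powr s * v powr (- s)" if "0 < v" for v s :: real
    using that by (simp add: powr_divide powr_minus_divide)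
  have absK: "\<bar>K j\<bar> * Gamma (z j) = pi powr (n / 2) * (b ^ j / fact j)" for j
    using Gamma_real_pos[OF z[of j]] b by (simp add: K_def abs_mult power_abs)
  \<comment> \<open>Here \<open>v\<close> is the decay rate of \<open>h\<close>: 1 for
    \<open>g\<close> itself and 1/2 for the error of its approximation. The moment is at most d
    Gamma(z_j) v^(-z_j), and its gamma factor cancels against that in \<open>K j\<close>.\<close>
  have KN_bound: "\<bar>K j * N h j\<bar> \<le> d * ((pi / v) powr (n / 2) * ((b / v) ^ j / fact j))"
    if "set_integrable lborel {0<..} (\<lambda>y. y powr (z j - 1) * h y)" "0 < v"
      "\<And>y. 0 \<le> y \<Longrightarrow> \<bar>h y\<bar> \<le> d * exp (- v * y)" for h d v j
  proof -
    have "\<bar>K j * N h j\<bar> \<le> \<bar>K j\<bar> * (d * (Gamma (z j) * v powr (- z j)))"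
      unfolding abs_mult N_def using that by (intro mult_left_mono abs_mellin_le z) auto
    also have "\<dots> = d * ((\<bar>K j\<bar> * Gamma (z j)) * v powr (- z j))" by simp
    also have "v powr (- z j) = v powr (- (n / 2)) / v ^ j"
      using that by (simp add: z_def powr_diff powr_realpow flip: powr_minus)
    also have "(\<bar>K j\<bar> * Gamma (z j)) * (v powr (- (n / 2)) / v ^ j) = (pi / v) powr (n / 2) * ((b / v) ^ j / fact j)"
      unfolding absK using that by (simp add: powr_divide powr_minus power_divide field_simps)
    finally show ?thesis .
  qed
  have sK: "summable (\<lambda>j. d * ((pi / v) powr (n / 2) * ((b / v) ^ j / fact j)))" for d v
    by (intro summable_mult summable_power_div_fact)
  have sumsK: "(\<lambda>j. d * ((pi / v) powr (n / 2) * ((b / v) ^ j / fact j))) sums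
      (d * ((pi / v) powr (n / 2) * exp (b / v)))" for d v
    by (intro sums_mult sums_exp_real)
  have C1: "\<bar>g y\<bar> \<le> C * exp (- 1 * y)" if "0 \<le> y" for y using C[OF that] by simp
  have sg: "summable (\<lambda>j. \<bar>K j * N g j\<bar>)"
    by (rule summable_comparison_test'[OF sK[of C 1]]) (use KN_bound[OF gi[OF z] zero_less_one C1] in auto)
  then show "summable (\<lambda>j. \<bar>pi powr (n / 2) * (- b) ^ j / (fact j * Gamma (n / 2 + real j)) *
        (LINT y:{0<..}|lborel. y powr (n / 2 + real j - 1) * g y)\<bar>)"
    by (simp only: K_def N_def z_def)
  have Wg: "W g"
    unfolding W_def
  proof (rule Bochner_Integration.integrable_bound)
    show "integrable lborel (\<lambda>t::'a. C * exp (- 1 * (norm t)\<^sup>2))"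
      by (intro integrable_mult_right gaussian_integral) auto
    show "AE t in lborel. norm (iexp (x \<bullet> t) * complex_of_real (g ((norm t)\<^sup>2))) \<le> norm (C * exp (- 1 * (norm t)\<^sup>2))"
    proof (rule AE_I2)
      fix t
      show "norm (iexp (x \<bullet> t) * complex_of_real (g ((norm t)\<^sup>2))) \<le> norm (C * exp (- 1 * (norm t)\<^sup>2))"
        using C1[of "(norm t)\<^sup>2"] by (simp add: norm_mult)
    qed
  qed measurable
  then show "integrable lborel (\<lambda>t. iexp (x \<bullet> t) * complex_of_real (g ((norm t)\<^sup>2)))"
    by (simp only: W_def)
  define R where "R = (\<Sum>j. K j * N g j)"
  \<comment> \<open>The error d exp(-y/2) changes the Fourier integral by at most d (2 pi)^(n/2) and
    the series by at most that times exp(2b): these are (pi/v)^(n/2) and exp(b/v) at v = 1/2. For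
    the sum of exponentials \<open>P\<close> the two sides agree exactly.\<close>
  have "norm (J g - complex_of_real R) \<le> d * ((2 * pi) powr (n / 2) * (1 + exp (2 * b)))" if d: "0 < d" for d
  proof -
    obtain q :: "nat \<Rightarrow> real" and m where
      q: "\<And>y. 0 \<le> y \<Longrightarrow> \<bar>g y - (\<Sum>i\<le>m. q i * exp (- (1 / 2 + real i) * y))\<bar> \<le> d * exp (- y / 2)"
      using approx_exp_sum[OF cont C d] by blast
    define e where "e i y = exp (- (1 / 2 + real i) * y)" for i and y :: real
    define P where "P y = (\<Sum>i\<le>m. q i * e i y)" for y
    have v: "0 < 1 / 2 + real i" for i by simp
    have We: "W (e i)" and Je: "J (e i) = complex_of_real ((pi / (1 / 2 + real i)) powr (n / 2) * exp (- b / (1 / 2 + real i)))" for i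
      using gaussian_fourier[OF v[of i], of x]
      by (simp_all only: W_def J_def e_def n_def b_def divide_divide_eq_left minus_divide_left)
    have ei: "set_integrable lborel {0<..} (\<lambda>y. y powr (z j - 1) * e i y)" for i j
      unfolding e_def by (rule integral_powr_exp(1)[OF z v])
    have "K j * N (e i) j = (pi / (1 / 2 + real i)) powr (n / 2) * ((- b / (1 / 2 + real i)) ^ j / fact j)" for i j
    proof -
      let ?v = "1 / 2 + real i"
      have "N (e i) j = Gamma (z j) * ?v powr (- z j)"
        unfolding N_def e_def by (rule integral_powr_exp(2)[OF z v])
      moreover have "?v powr (- z j) = ?v powr (- (n / 2)) / ?v ^ j"
        using v[of i] by (simp only: z_def minus_add_distrib powr_add powr_minus[of _ "real j"] powr_realpow divide_inverse)
      moreover have "(pi / ?v) powr (n / 2) = pi powr (n / 2) * ?v powr (- (n / 2))"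
        by (rule pi_powr[OF v])
      ultimately show ?thesis
        using Gamma_real_pos[OF z[of j]] by (simp only: K_def power_divide) (simp add: field_simps)
    qed
    then have Re: "(\<lambda>j. K j * N (e i) j) sums ((pi / (1 / 2 + real i)) powr (n / 2) * exp (- b / (1 / 2 + real i)))" for i
      by (simp only:) (intro sums_mult sums_exp_real)
    have WP: "W P" and JP: "J P = (\<Sum>i\<le>m. complex_of_real (q i) * J (e i))"
    proof -
      have "(\<lambda>t. iexp (x \<bullet> t) * complex_of_real (P ((norm t)\<^sup>2))) =
          (\<lambda>t. \<Sum>i\<le>m. complex_of_real (q i) * (iexp (x \<bullet> t) * complex_of_real (e i ((norm t)\<^sup>2))))"
        by (simp add: P_def sum_distrib_left mult.left_commute)
      then show "W P" "J P = (\<Sum>i\<le>m. complex_of_real (q i) * J (e i))"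
        using We unfolding W_def J_def by simp_all
    qed
    have Pi: "set_integrable lborel {0<..} (\<lambda>y. y powr (z j - 1) * P y)"
      and NP: "N P j = (\<Sum>i\<le>m. q i * N (e i) j)" for j
    proof -
      have eq: "indicator {0<..} y *\<^sub>R (y powr (z j - 1) * P y) =
          (\<Sum>i\<le>m. q i * (indicator {0<..} y *\<^sub>R (y powr (z j - 1) * e i y)))" for y :: real
        by (simp add: P_def sum_distrib_left mult.left_commute)
      have int: "integrable lborel (\<lambda>y. q i * (indicator {0<..} y *\<^sub>R (y powr (z j - 1) * e i y)))" for i
        using ei[of j i] unfolding set_integrable_def by (rule integrable_mult_right)
      show "set_integrable lborel {0<..} (\<lambda>y. y powr (z j - 1) * P y)"
        unfolding set_integrable_def eq by (intro Bochner_Integration.integrable_sum int)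
      show "N P j = (\<Sum>i\<le>m. q i * N (e i) j)"
        unfolding N_def set_lebesgue_integral_def eq Bochner_Integration.integral_sum[OF int]
        by simp
    qed
    have "(\<lambda>j. \<Sum>i\<le>m. q i * (K j * N (e i) j)) sums (\<Sum>i\<le>m. q i * ((pi / (1 / 2 + real i)) powr (n / 2) * exp (- b / (1 / 2 + real i))))"
      by (intro sums_sum sums_mult Re)
    moreover have "(\<Sum>i\<le>m. q i * (K j * N (e i) j)) = K j * N P j" for j
      unfolding NP by (simp add: sum_distrib_left mult.left_commute)
    ultimately have sP: "(\<lambda>j. K j * N P j) sums (\<Sum>i\<le>m. q i * ((pi / (1 / 2 + real i)) powr (n / 2) * exp (- b / (1 / 2 + real i))))"
      by simp
    have JPR: "J P = complex_of_real (\<Sum>j. K j * N P j)"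
      unfolding JP Je sums_unique[OF sP, symmetric] by simp
    have gP: "\<bar>g y - P y\<bar> \<le> d * exp (- (1 / 2) * y)" if "0 \<le> y" for y
      using q[OF that] by (simp add: P_def e_def)
    have "norm (J g - J P) \<le> d * (2 * pi) powr (n / 2)"
    proof -
      have "J g - J P = (\<integral>t. iexp (x \<bullet> t) * complex_of_real (g ((norm t)\<^sup>2)) - iexp (x \<bullet> t) * complex_of_real (P ((norm t)\<^sup>2)) \<partial>lborel)"
        unfolding J_def using Wg WP unfolding W_def by (rule Bochner_Integration.integral_diff[symmetric])
      also have "norm \<dots> \<le> (\<integral>t. d * exp (- (1 / 2) * (norm (t::'a))\<^sup>2) \<partial>lborel)"
      proof (rule Bochner_Integration.integral_norm_bound_integral)
        show "integrable lborel (\<lambda>t. iexp (x \<bullet> t) * complex_of_real (g ((norm t)\<^sup>2)) - iexp (x \<bullet> t) * complex_of_real (P ((norm t)\<^sup>2)))"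
          using Wg WP unfolding W_def by (rule Bochner_Integration.integrable_diff)
        show "integrable lborel (\<lambda>t::'a. d * exp (- (1 / 2) * (norm t)\<^sup>2))"
          by (intro integrable_mult_right gaussian_integral) auto
        fix t :: 'a
        have "norm (iexp (x \<bullet> t) * complex_of_real (g ((norm t)\<^sup>2)) - iexp (x \<bullet> t) * complex_of_real (P ((norm t)\<^sup>2))) =
            \<bar>g ((norm t)\<^sup>2) - P ((norm t)\<^sup>2)\<bar>"
          by (simp add: norm_mult flip: right_diff_distrib of_real_diff)
        then show "norm (iexp (x \<bullet> t) * complex_of_real (g ((norm t)\<^sup>2)) - iexp (x \<bullet> t) * complex_of_real (P ((norm t)\<^sup>2))) \<le>
            d * exp (- (1 / 2) * (norm t)\<^sup>2)"
          using gP[of "(norm t)\<^sup>2"] by simp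
      qed
      also have "\<dots> = d * (pi / (1 / 2)) powr (n / 2)"
        using gaussian_integral(2)[where 'a = 'a, of "1 / 2"] by (simp add: n_def)
      finally show ?thesis by (simp add: mult.commute)
    qed
    moreover have "norm (J P - complex_of_real R) \<le> d * ((2 * pi) powr (n / 2) * exp (2 * b))"
    proof -
      have s1: "summable (\<lambda>j. K j * N g j)" using sg by (rule summable_rabs_cancel)
      have diff: "K j * N P j - K j * N g j = - (K j * N (\<lambda>y. g y - P y) j)"
        and int: "set_integrable lborel {0<..} (\<lambda>y. y powr (z j - 1) * (g y - P y))" for j
        unfolding N_def right_diff_distrib[of "_ powr _"]
        using gi[OF z[of j]] Pi[of j] by (simp_all add: right_diff_distrib set_integral_diff)
      note bd = KN_bound[OF int _ gP, simplified]
      have "J P - complex_of_real R = complex_of_real (\<Sum>j. K j * N P j - K j * N g j)"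
        by (simp only: JPR R_def suminf_diff[OF sums_summable[OF sP] s1, symmetric] of_real_diff)
      also have "norm \<dots> = \<bar>\<Sum>j. K j * N P j - K j * N g j\<bar>" by simp
      also have "\<dots> \<le> (\<Sum>j. \<bar>K j * N P j - K j * N g j\<bar>)"
        by (intro summable_rabs summable_comparison_test'[OF sK[of d "1 / 2"]]) (use bd in \<open>simp add: diff\<close>)
      also have "\<dots> \<le> (\<Sum>j. d * ((pi / (1 / 2)) powr (n / 2) * ((b / (1 / 2)) ^ j / fact j)))"
        by (intro suminf_le sK summable_comparison_test'[OF sK[of d "1 / 2"]]) (use bd in \<open>simp_all add: diff\<close>)
      also have "\<dots> = d * ((pi / (1 / 2)) powr (n / 2) * exp (b / (1 / 2)))"
        by (rule sums_unique[OF sumsK, symmetric])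
      finally show ?thesis by (simp add: mult.commute)
    qed
    ultimately have "norm (J g - J P) + norm (J P - complex_of_real R) \<le> d * ((2 * pi) powr (n / 2) * (1 + exp (2 * b)))"
      by (simp add: algebra_simps)
    then show ?thesis
      using norm_triangle_ineq[of "J g - J P" "J P - complex_of_real R"] by simp
  qed
  note est = this
  have "J g = complex_of_real R"
  proof (rule ccontr)
    assume "J g \<noteq> complex_of_real R"
    then have p: "0 < norm (J g - complex_of_real R)" by simp
    have k: "0 < (2 * pi) powr (n / 2) * (1 + exp (2 * b))" by (simp add: add_pos_pos)
    have half: "X / (2 * k) * k = X / 2" if "0 < k" for X k :: real using that by simp
    let ?X = "norm (J g - complex_of_real R)" and ?k = "(2 * pi) powr (n / 2) * (1 + exp (2 * b))"
    have "0 < ?X / (2 * ?k)" by (intro divide_pos_pos mult_pos_pos p k) simp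
    from est[OF this] p show False unfolding half[OF k] by linarith
  qed
  moreover have "(\<lambda>j. K j * N g j) sums R"
    unfolding R_def by (rule summable_sums[OF summable_rabs_cancel[OF sg]])
  ultimately show "(\<lambda>j. pi powr (n / 2) * (- b) ^ j / (fact j * Gamma (n / 2 + real j)) *
        (LINT y:{0<..}|lborel. y powr (n / 2 + real j - 1) * g y)) sums
      Re (\<integral>t. iexp (x \<bullet> t) * complex_of_real (g ((norm t)\<^sup>2)) \<partial>lborel)"
    "Im (\<integral>t. iexp (x \<bullet> t) * complex_of_real (g ((norm t)\<^sup>2)) \<partial>lborel) = 0"
    by (simp_all only: J_def K_def N_def z_def Re_complex_of_real Im_complex_of_real)
qed

section \<open>Gaussian smoothing of a density\<close>

text \<open>\<open>p\<close> may be unbounded, for instance near the origin, so away from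
  \<open>x\<close> it is controlled through its total mass and the supremum of the kernel, which
  still tends to 0. Inside the proof \<open>n\<close> denotes half the dimension.\<close>

lemma gaussian_approximate_identity:
  fixes p :: "'a::euclidean_space \<Rightarrow> real" and \<epsilon> :: "nat \<Rightarrow> real"
  assumes p: "integrable lborel p" and nonneg: "\<And>y. 0 \<le> p y" and cont: "isCont p x"
    and pos: "\<And>k. 0 < \<epsilon> k" and lim: "\<epsilon> \<longlonglongrightarrow> 0"
  shows "(\<lambda>k. (4 * pi * \<epsilon> k) powr (- (DIM('a) / 2)) *
      (\<integral>y. p y * exp (- (norm (y - x))\<^sup>2 / (4 * \<epsilon> k)) \<partial>lborel)) \<longlonglongrightarrow> p x"
proof -
  define n where "n = real DIM('a) / 2"
  define G where "G s y = (4 * pi * s) powr (- n) * exp (- (norm (y - x))\<^sup>2 / (4 * s))" for s and y :: 'a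
  have n: "0 < n" by (simp add: n_def)
  have G0: "0 \<le> G s y" for s y by (simp add: G_def)
  have Gmeas [measurable]: "G s \<in> borel_measurable borel" for s unfolding G_def by measurable
  have Gint: "integrable lborel (G s)" and Gval: "(\<integral>y. G s y \<partial>lborel) = 1" if s: "0 < s" for s
  proof -
    let ?g = "\<lambda>t::'a. (4 * pi * s) powr (- n) * exp (- (1 / (4 * s)) * (norm t)\<^sup>2)"
    have v: "0 < 1 / (4 * s)" using s by simp
    have i: "integrable lborel ?g" by (intro integrable_mult_right gaussian_integral v)
    have G_eq: "G s y = ?g (- x + y)" for y by (simp add: G_def)
    have m: "?g \<in> borel_measurable borel" by measurable
    have "integrable (distr lborel borel ((+) (- x))) ?g" using i by (simp only: lborel_distr_plus)
    then show "integrable lborel (G s)"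
      by (subst (asm) integrable_distr_eq[OF _ m]) (simp_all add: G_eq[abs_def])
    have "(\<integral>y. G s y \<partial>lborel) = integral\<^sup>L (distr lborel borel ((+) (- x))) ?g"
      by (subst integral_distr[OF _ m]) (simp_all add: G_eq[abs_def])
    also have "\<dots> = (4 * pi * s) powr (- n) * (pi / (1 / (4 * s))) powr n"
      unfolding lborel_distr_plus using gaussian_integral(2)[OF v, where 'a = 'a] by (simp add: n_def)
    also have "\<dots> = 1"
    proof -
      have "pi / (1 / (4 * s)) = 4 * pi * s" using s by simp
      moreover have "0 < 4 * pi * s" using s by simp
      moreover have "X powr (- n) * X powr n = 1" if "0 < X" for X :: real
        using that by (simp add: powr_minus)
      ultimately show ?thesis by (simp only:)
    qed
    finally show "(\<integral>y. G s y \<partial>lborel) = 1" .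
  qed
  have Gle: "G s y \<le> (4 * pi * s) powr (- n)" if "0 < s" for s y
    unfolding G_def using that by (intro mult_left_le) auto
  have pGint: "integrable lborel (\<lambda>y. p y * G s y)" if s: "0 < s" for s
  proof (rule Bochner_Integration.integrable_bound)
    show "integrable lborel (\<lambda>y. (4 * pi * s) powr (- n) * p y)" by (rule integrable_mult_right[OF p])
    show "AE y in lborel. norm (p y * G s y) \<le> norm ((4 * pi * s) powr (- n) * p y)"
      using mult_left_mono[OF Gle[OF s] nonneg] nonneg G0 by (intro AE_I2) (simp add: abs_mult mult.commute)
    show "(\<lambda>y. p y * G s y) \<in> borel_measurable lborel"
      using borel_measurable_integrable[OF p] by measurable
  qed
  have est: "norm ((\<integral>y. p y * G s y \<partial>lborel) - p x) \<le>
      \<eta> + 2 powr n * (exp (- (d\<^sup>2 / 8) / s) * (8 * pi * s) powr (- n)) * (\<integral>y. p y \<partial>lborel) +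
      p x * (2 powr n * exp (- (d\<^sup>2 / 8) / s))"
    if s: "0 < s" and d: "0 < d" and \<eta>: "0 < \<eta>" and near: "\<And>y. dist y x < d \<Longrightarrow> \<bar>p y - p x\<bar> \<le> \<eta>" for s d \<eta>
  proof -
    define E where "E = exp (- (d\<^sup>2 / 8) / s)"
    have s2: "0 < 2 * s" using s by simp
    \<comment> \<open>One half of the Gaussian exponent is spent on the factor \<open>E\<close>, the
      other half is a kernel of parameter 2s, again of integral 1; \<open>2 powr n\<close> is the
      quotient of the normalisations.\<close>
    have far: "G s y \<le> 2 powr n * E * G (2 * s) y" if "d \<le> dist y x" for y
    proof -
      have "d\<^sup>2 \<le> (norm (y - x))\<^sup>2" using that d by (intro power_mono) (auto simp: dist_norm)
      then have "- (norm (y - x))\<^sup>2 / (4 * s) \<le> - (d\<^sup>2 / 8) / s + - (norm (y - x))\<^sup>2 / (4 * (2 * s))"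
        using s by (simp add: field_simps)
      then have "exp (- (norm (y - x))\<^sup>2 / (4 * s)) \<le> E * exp (- (norm (y - x))\<^sup>2 / (4 * (2 * s)))"
        unfolding E_def exp_add[symmetric] by simp
      then have "G s y \<le> (4 * pi * s) powr (- n) * (E * exp (- (norm (y - x))\<^sup>2 / (4 * (2 * s))))"
        unfolding G_def by (rule mult_left_mono) simp
      also have "(4 * pi * s) powr (- n) = 2 powr n * (4 * pi * (2 * s)) powr (- n)"
      proof -
        have "(4 * pi * (2 * s)) powr (- n) = (2 * (4 * pi * s)) powr (- n)" by (simp add: mult_ac)
        also have "\<dots> = 2 powr (- n) * (4 * pi * s) powr (- n)" using s by (subst powr_mult) auto
        finally show ?thesis by (simp flip: mult.assoc powr_add)
      qed
      finally show ?thesis by (simp add: G_def mult_ac)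
    qed
    \<comment> \<open>The first summand serves the points near \<open>x\<close>. The other two serve
      the distant ones: there p(y) is multiplied by the supremum of the kernel, and the constant
      p(x) by an integrable kernel.\<close>
    let ?B = "\<lambda>y. \<eta> * G s y + 2 powr n * (E * (8 * pi * s) powr (- n)) * p y + p x * (2 powr n * E * G (2 * s) y)"
    have bd: "norm (p y * G s y - p x * G s y) \<le> ?B y" for y
    proof (cases "dist y x < d")
      case True
      have "norm (p y * G s y - p x * G s y) = \<bar>p y - p x\<bar> * G s y"
        using G0[of s y] by (simp add: abs_mult flip: left_diff_distrib)
      also have "\<dots> \<le> \<eta> * G s y" by (intro mult_right_mono near True G0)
      also have "\<dots> \<le> ?B y"
        using nonneg[of y] nonneg[of x] G0[of "2 * s" y] by (simp add: E_def)
      finally show ?thesis .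
    next
      case False
      then have f: "G s y \<le> 2 powr n * E * G (2 * s) y" using far by simp
      also have "\<dots> \<le> 2 powr n * E * (4 * pi * (2 * s)) powr (- n)"
        by (intro mult_left_mono Gle s2) (simp add: E_def)
      finally have f2: "G s y \<le> 2 powr n * (E * (8 * pi * s) powr (- n))" by (simp add: mult_ac)
      have "norm (p y * G s y - p x * G s y) \<le> \<bar>p y * G s y\<bar> + \<bar>p x * G s y\<bar>"
        unfolding real_norm_def by (rule abs_triangle_ineq4)
      also have "\<dots> = G s y * p y + p x * G s y"
        using nonneg G0 by (simp add: abs_mult mult.commute)
      also have "\<dots> \<le> 2 powr n * (E * (8 * pi * s) powr (- n)) * p y + p x * (2 powr n * E * G (2 * s) y)"
        by (intro add_mono mult_right_mono mult_left_mono f f2 nonneg)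
      also have "\<dots> \<le> ?B y" using \<eta> G0[of s y] by simp
      finally show ?thesis .
    qed
    have i1: "integrable lborel (\<lambda>y. p x * G s y)" by (rule integrable_mult_right[OF Gint[OF s]])
    have iB: "integrable lborel ?B"
      by (rule Bochner_Integration.integrable_add[OF Bochner_Integration.integrable_add[OF
            integrable_mult_right[OF Gint[OF s]] integrable_mult_right[OF p]]
            integrable_mult_right[OF integrable_mult_right[OF Gint[OF s2]]]])
    have "(\<integral>y. p y * G s y \<partial>lborel) - (\<integral>y. p x * G s y \<partial>lborel) = (\<integral>y. p y * G s y - p x * G s y \<partial>lborel)"
      by (rule Bochner_Integration.integral_diff[OF pGint[OF s] i1, symmetric])
    then have eq: "(\<integral>y. p y * G s y \<partial>lborel) - p x = (\<integral>y. p y * G s y - p x * G s y \<partial>lborel)"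
      unfolding integral_mult_right_zero Gval[OF s] by simp
    have "norm ((\<integral>y. p y * G s y \<partial>lborel) - p x) \<le> (\<integral>y. ?B y \<partial>lborel)"
      unfolding eq
      by (rule Bochner_Integration.integral_norm_bound_integral[OF Bochner_Integration.integrable_diff[OF pGint[OF s] i1] iB bd])
    also have "\<dots> = \<eta> + 2 powr n * (E * (8 * pi * s) powr (- n)) * (\<integral>y. p y \<partial>lborel) + p x * (2 powr n * E)"
      using Gint[OF s] Gint[OF s2] p Gval[OF s] Gval[OF s2] by simp
    finally show ?thesis unfolding E_def .
  qed
  have "(\<lambda>k. \<integral>y. p y * G (\<epsilon> k) y \<partial>lborel) \<longlonglongrightarrow> p x"
  proof (rule LIMSEQ_I)
    fix r :: real assume r: "0 < r"
    obtain d where d: "0 < d" and near: "\<And>y. dist y x < d \<Longrightarrow> \<bar>p y - p x\<bar> \<le> r / 2"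
    proof -
      obtain d where d: "0 < d" "\<forall>y. y \<noteq> x \<and> dist y x < d \<longrightarrow> dist (p y) (p x) < r / 2"
        using metric_LIM_D[OF cont[unfolded isCont_def] half_gt_zero[OF r]] by blast
      have "\<bar>p y - p x\<bar> \<le> r / 2" if "dist y x < d" for y
        using d(2) that r by (cases "y = x") (auto simp: dist_real_def less_imp_le)
      then show thesis using d(1) that by blast
    qed
    let ?T = "\<lambda>s. 2 powr n * (exp (- (d\<^sup>2 / 8) / s) * (8 * pi * s) powr (- n)) * (\<integral>y. p y \<partial>lborel) +
      p x * (2 powr n * exp (- (d\<^sup>2 / 8) / s))"
    have "(\<epsilon> \<longlongrightarrow> 0) sequentially \<and> (\<forall>\<^sub>F k in sequentially. 0 < \<epsilon> k)" using lim pos by simp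
    then have lim': "filterlim \<epsilon> (at_right 0) sequentially"
      by (auto simp: filterlim_at eventually_mono)
    have d8: "0 < d\<^sup>2 / 8" using d by simp
    have "((\<lambda>s. (8 * pi) powr (- n) * (s powr (- n) * exp (- (d\<^sup>2 / 8) / s))) \<longlongrightarrow> (8 * pi) powr (- n) * 0) (at_right 0)"
      by (intro tendsto_mult tendsto_const tendsto_powr_exp_inverse_at_right_0 d8)
    moreover have "\<forall>\<^sub>F s in at_right 0. (8 * pi) powr (- n) * (s powr (- n) * exp (- (d\<^sup>2 / 8) / s)) =
        exp (- (d\<^sup>2 / 8) / s) * (8 * pi * s) powr (- n)"
      using eventually_at_right_less[of "0::real"] by eventually_elim (simp add: powr_mult)
    ultimately have "((\<lambda>s. exp (- (d\<^sup>2 / 8) / s) * (8 * pi * s) powr (- n)) \<longlongrightarrow> (8 * pi) powr (- n) * 0) (at_right 0)"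
      by (rule Lim_transform_eventually)
    then have 1: "((\<lambda>s. exp (- (d\<^sup>2 / 8) / s) * (8 * pi * s) powr (- n)) \<longlongrightarrow> 0) (at_right 0)"
      unfolding mult_zero_right .
    have "((\<lambda>s. s powr 0 * exp (- (d\<^sup>2 / 8) / s)) \<longlongrightarrow> 0) (at_right 0)"
      by (rule tendsto_powr_exp_inverse_at_right_0[OF d8])
    moreover have "\<forall>\<^sub>F s in at_right 0. s powr 0 * exp (- (d\<^sup>2 / 8) / s) = exp (- (d\<^sup>2 / 8) / s)"
      using eventually_at_right_less[of "0::real"] by eventually_elim simp
    ultimately have 2: "((\<lambda>s. exp (- (d\<^sup>2 / 8) / s)) \<longlongrightarrow> 0) (at_right 0)"
      by (rule Lim_transform_eventually)
    have "(?T \<longlongrightarrow> 2 powr n * 0 * (\<integral>y. p y \<partial>lborel) + p x * (2 powr n * 0)) (at_right 0)"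
      by (intro tendsto_intros 1 2)
    then have "(?T \<longlongrightarrow> 0) (at_right 0)" by simp
    from filterlim_compose[OF this lim'] have "(\<lambda>k. ?T (\<epsilon> k)) \<longlonglongrightarrow> 0" .
    from order_tendstoD(2)[OF this, of "r / 2"] r
    have "\<forall>\<^sub>F k in sequentially. ?T (\<epsilon> k) < r / 2" by simp
    then show "\<exists>N. \<forall>k\<ge>N. norm ((\<integral>y. p y * G (\<epsilon> k) y \<partial>lborel) - p x) < r"
      unfolding eventually_sequentially
    proof (elim exE, intro exI allI impI)
      fix N k assume "\<forall>k\<ge>N. ?T (\<epsilon> k) < r / 2" "N \<le> k"
      then have "?T (\<epsilon> k) < r / 2" by blast
      moreover have "norm ((\<integral>y. p y * G (\<epsilon> k) y \<partial>lborel) - p x) \<le> r / 2 + ?T (\<epsilon> k)"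
        using est[OF pos d half_gt_zero[OF r] near] by (simp only: add.assoc)
      ultimately show "norm ((\<integral>y. p y * G (\<epsilon> k) y \<partial>lborel) - p x) < r" by linarith
    qed
  qed
  moreover have "(\<integral>y. p y * G s y \<partial>lborel) =
      (4 * pi * s) powr (- n) * (\<integral>y. p y * exp (- (norm (y - x))\<^sup>2 / (4 * s)) \<partial>lborel)" for s
    unfolding G_def mult.left_commute[of "p _"] by (rule integral_mult_right_zero)
  ultimately show ?thesis by (simp only: n_def)
qed

text \<open>The heat kernel is itself a Gaussian Fourier integral. After inserting it, Fubini
  applies thanks to the factor exp(-\<epsilon> |t|^2), whether or not the characteristic function is
  integrable.\<close>

lemma gaussian_smoothing_fourier:
  fixes p :: "'a::euclidean_space \<Rightarrow> real"
  assumes p: "integrable lborel p" and e: "0 < \<epsilon>"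
  shows "complex_of_real ((4 * pi * \<epsilon>) powr (- (DIM('a) / 2)) *
      (\<integral>y. p y * exp (- (norm (y - x))\<^sup>2 / (4 * \<epsilon>)) \<partial>lborel)) =
    complex_of_real ((2 * pi) powr (- real DIM('a))) *
      (\<integral>t. (\<integral>y. iexp (y \<bullet> t) * complex_of_real (p y) \<partial>lborel) *
        (iexp (- x \<bullet> t) * complex_of_real (exp (- \<epsilon> * (norm t)\<^sup>2))) \<partial>lborel)"
proof -
  define n where "n = real DIM('a)"
  let ?f = "\<lambda>y t. complex_of_real (p y) * (iexp ((y - x) \<bullet> t) * complex_of_real (exp (- \<epsilon> * (norm t)\<^sup>2)))"
  have [measurable]: "p \<in> borel_measurable borel" using borel_measurable_integrable[OF p] by simp
  have F: "integrable (lborel \<Otimes>\<^sub>M lborel) (case_prod ?f)"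
  proof (rule lborel_pair.Fubini_integrable)
    show "case_prod ?f \<in> borel_measurable (lborel \<Otimes>\<^sub>M lborel)"
      unfolding case_prod_beta by measurable
    have "(\<integral>t. norm (case_prod ?f (y, t)) \<partial>lborel) = \<bar>p y\<bar> * (pi / \<epsilon>) powr (DIM('a) / 2)" for y
      using gaussian_integral(2)[OF e, where 'a = 'a] by (simp add: norm_mult)
    then show "integrable lborel (\<lambda>y. \<integral>t. norm (case_prod ?f (y, t)) \<partial>lborel)"
      using p by simp
    show "AE y in lborel. integrable lborel (\<lambda>t. case_prod ?f (y, t))"
      unfolding prod.case by (intro AE_I2 integrable_mult_right gaussian_fourier(1) e)
  qed
  have "complex_of_real ((pi / \<epsilon>) powr (n / 2) * (\<integral>y. p y * exp (- (norm (y - x))\<^sup>2 / (4 * \<epsilon>)) \<partial>lborel)) =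
      (\<integral>y. complex_of_real (p y * ((pi / \<epsilon>) powr (n / 2) * exp (- (norm (y - x))\<^sup>2 / (4 * \<epsilon>)))) \<partial>lborel)"
    unfolding integral_complex_of_real mult.left_commute[of "p _"] by simp
  also have "\<dots> = (\<integral>y. \<integral>t. ?f y t \<partial>lborel \<partial>lborel)"
    by (simp only: integral_mult_right_zero gaussian_fourier(2)[OF e, where 'a = 'a] n_def of_real_mult)
  also have "\<dots> = (\<integral>t. \<integral>y. ?f y t \<partial>lborel \<partial>lborel)"
    by (rule lborel_pair.Fubini_integral[OF F, symmetric])
  also have "\<dots> = (\<integral>t. (\<integral>y. iexp (y \<bullet> t) * complex_of_real (p y) \<partial>lborel) *
        (iexp (- x \<bullet> t) * complex_of_real (exp (- \<epsilon> * (norm t)\<^sup>2))) \<partial>lborel)"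
  proof (rule Bochner_Integration.integral_cong[OF refl])
    fix t
    have "?f y t = (iexp (y \<bullet> t) * complex_of_real (p y)) * (iexp (- x \<bullet> t) * complex_of_real (exp (- \<epsilon> * (norm t)\<^sup>2)))" for y
    proof -
      have "iexp ((y - x) \<bullet> t) = iexp (y \<bullet> t) * iexp (- x \<bullet> t)"
        by (simp add: inner_diff_left ring_distribs flip: exp_add)
      then show ?thesis by (simp only: mult_ac)
    qed
    then show "(\<integral>y. ?f y t \<partial>lborel) = (\<integral>y. iexp (y \<bullet> t) * complex_of_real (p y) \<partial>lborel) *
        (iexp (- x \<bullet> t) * complex_of_real (exp (- \<epsilon> * (norm t)\<^sup>2)))"
      by (simp only: integral_mult_left_zero)
  qed
  finally have *: "complex_of_real ((pi / \<epsilon>) powr (n / 2) * (\<integral>y. p y * exp (- (norm (y - x))\<^sup>2 / (4 * \<epsilon>)) \<partial>lborel)) = \<dots>" .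
  have "(4 * pi * \<epsilon>) powr (- (n / 2)) = (2 * pi) powr (- n) * (pi / \<epsilon>) powr (n / 2)"
  proof -
    have "(2 * pi) powr (- n) = (2 * pi) powr (2 * (- (n / 2)))" by simp
    also have "\<dots> = ((2 * pi) powr 2) powr (- (n / 2))" by (simp only: powr_powr)
    also have "(2 * pi) powr 2 = (4 * pi * \<epsilon>) * (pi / \<epsilon>)" using e by (simp add: power2_eq_square)
    also have "\<dots> powr (- (n / 2)) = (4 * pi * \<epsilon>) powr (- (n / 2)) * (pi / \<epsilon>) powr (- (n / 2))"
      using e by (subst powr_mult) auto
    finally show ?thesis using e by (simp add: powr_minus)
  qed
  then show ?thesis unfolding *[symmetric] n_def[symmetric] by simp
qed

section \<open>The density as a sum of two series\<close>

lemma power_div_fact_le_exp: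
  fixes x :: real
  assumes "0 \<le> x"
  shows "x ^ m / fact m \<le> exp x"
proof -
  have "(\<Sum>j\<in>{m}. x ^ j / fact j) \<le> (\<Sum>j. x ^ j / fact j)"
    by (rule sum_le_suminf[OF summable_power_div_fact]) (use assms in auto)
  then show ?thesis using sums_unique[OF sums_exp_real[of x]] by simp
qed

text \<open>One term of the exponential series suffices: exp(-b/w) <= m! (w/b)^m with m >= s. The
  range up to 2 accommodates w = u + \<epsilon> with u and \<epsilon> at most 1.\<close>

lemma powr_exp_inverse_bounded:
  fixes b s :: real
  assumes b: "0 < b" and s: "0 \<le> s"
  obtains M where "\<And>w. 0 < w \<Longrightarrow> w \<le> 2 \<Longrightarrow> w powr (- s) * exp (- b / w) \<le> M"
proof -
  obtain m :: nat where m: "s \<le> real m" using real_arch_simple by blast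
  show thesis
  proof (rule that)
    fix w :: real assume w: "0 < w" "w \<le> 2"
    have p: "0 < (b / w) ^ m / fact m" using b w by simp
    have "exp (- b / w) = 1 / exp (b / w)" by (simp add: exp_minus divide_inverse)
    also have "\<dots> \<le> 1 / ((b / w) ^ m / fact m)"
      using power_div_fact_le_exp[of "b / w" m] b w p by (intro divide_left_mono) auto
    also have "\<dots> = fact m / b ^ m * w powr real m"
      using b w by (simp add: powr_realpow power_divide)
    finally have "w powr (- s) * exp (- b / w) \<le> w powr (- s) * (fact m / b ^ m * w powr real m)"
      by (rule mult_left_mono) simp
    also have "\<dots> = fact m / b ^ m * w powr (real m - s)"
      by (simp add: mult_ac flip: powr_add)
    also have "\<dots> \<le> fact m / b ^ m * 2 powr (real m - s)"
      using b w m by (intro mult_left_mono powr_mono2) auto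
    finally show "w powr (- s) * exp (- b / w) \<le> fact m / b ^ m * 2 powr (real m - s)" .
  qed
qed

text \<open>Sums over j are integrals for the counting measure, so this is dominated exchange of sum
  and integral.\<close>

lemma suminf_swap_dominated:
  fixes f :: "nat \<Rightarrow> nat \<Rightarrow> real"
  assumes bd: "\<And>l j. \<bar>f l j\<bar> \<le> A l * B j" and A: "summable A" and B: "summable B"
    and B0: "\<And>j. 0 \<le> B j"
  shows "(\<lambda>l. \<Sum>j. f l j) sums (\<Sum>j. \<Sum>l. f l j)"
    and "summable (\<lambda>l. \<bar>\<Sum>j. f l j\<bar>)" and "summable (\<lambda>j. \<bar>\<Sum>l. f l j\<bar>)"
proof -
  have int_iff: "set_integrable (count_space UNIV) UNIV g \<longleftrightarrow> summable (\<lambda>j. \<bar>g j\<bar>)" for g :: "nat \<Rightarrow> real"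
    by (simp add: set_integrable_def integrable_count_space_nat_iff)
  have val: "(LINT j:UNIV|count_space UNIV. g j) = (\<Sum>j. g j)" if "summable (\<lambda>j. \<bar>g j\<bar>)" for g :: "nat \<Rightarrow> real"
    using that by (simp add: set_lebesgue_integral_def integral_count_space_nat integrable_count_space_nat_iff)
  have "set_integrable (count_space UNIV) UNIV B"
    unfolding int_iff using B B0 by simp
  note * = sums_set_integral_dominated[where f = f and M = "count_space UNIV" and A = UNIV, OF _ _ _ A this,
      unfolded int_iff]
  have sl: "summable (\<lambda>j. \<bar>f l j\<bar>)" for l by (rule *(4)) (use bd in auto)
  show sj: "summable (\<lambda>j. \<bar>\<Sum>l. f l j\<bar>)" by (rule *(1)) (use bd in auto)
  show "(\<lambda>l. \<Sum>j. f l j) sums (\<Sum>j. \<Sum>l. f l j)"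
    using *(2) bd unfolding val[OF sl] val[OF sj] by simp
  show "summable (\<lambda>l. \<bar>\<Sum>j. f l j\<bar>)"
    using *(3) bd unfolding val[OF sl] by simp
qed

section \<open>The Fourier side of the smoothed density\<close>

context ml_param
begin

lemma abs_high_le:
  assumes x: "0 \<le> x"
  shows "\<bar>high x\<bar> \<le> (LINT u:{0<..1}|lborel. \<bar>S u\<bar>)"
proof -
  have int: "set_integrable lborel {0<..1} (\<lambda>u. S u * exp (- x * u))"
    by (rule S_weight(1)[where M = 1]) (use x in auto)
  have "\<bar>high x\<bar> \<le> (LINT u:{0<..1}|lborel. \<bar>S u * exp (- x * u)\<bar>)"
    unfolding high_def by (rule set_integral_norm_bound[OF int, unfolded real_norm_def])
  also have "\<dots> \<le> (LINT u:{0<..1}|lborel. \<bar>S u\<bar>)"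
  proof (rule set_integral_mono)
    fix u :: real assume "u \<in> {0<..1}"
    then show "\<bar>S u * exp (- x * u)\<bar> \<le> \<bar>S u\<bar>"
      using x unfolding abs_mult by (intro mult_left_le) auto
  qed (intro set_integrable_abs int S_integrable)+
  finally show ?thesis .
qed

text \<open>Insert the integral defining \<open>high\<close>; then exp(-u |t|^2) and the smoothing
  factor merge into a Gaussian with parameter u + \<epsilon>. The smoothing provides decay in t
  uniformly in u, which justifies Fubini.\<close>

lemma high_fourier_gauss:
  fixes x :: "'a::euclidean_space"
  assumes e: "0 < \<epsilon>"
  shows "integrable lborel (\<lambda>t. complex_of_real (high ((norm t)\<^sup>2)) * (iexp (x \<bullet> t) * complex_of_real (exp (- \<epsilon> * (norm t)\<^sup>2))))"
    and "(\<integral>t. complex_of_real (high ((norm t)\<^sup>2)) * (iexp (x \<bullet> t) * complex_of_real (exp (- \<epsilon> * (norm t)\<^sup>2))) \<partial>lborel) =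
      complex_of_real (LINT u:{0<..1}|lborel. S u * ((pi / (u + \<epsilon>)) powr (DIM('a) / 2) * exp (- (norm x)\<^sup>2 / (4 * (u + \<epsilon>)))))"
proof -
  define Q where "Q = (LINT u:{0<..1}|lborel. \<bar>S u\<bar>)"
  let ?E = "\<lambda>t::'a. exp (- \<epsilon> * (norm t)\<^sup>2)"
  note gi = gaussian_integral(1)[OF e, where 'a = 'a]
  show "integrable lborel (\<lambda>t. complex_of_real (high ((norm t)\<^sup>2)) * (iexp (x \<bullet> t) * complex_of_real (?E t)))"
  proof (rule Bochner_Integration.integrable_bound[OF integrable_mult_right[OF gi, of Q]])
    have "\<bar>high ((norm t)\<^sup>2)\<bar> * ?E t \<le> Q * ?E t" for t :: 'a
      unfolding Q_def by (intro mult_right_mono abs_high_le) auto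
    then have "norm (complex_of_real (high ((norm t)\<^sup>2)) * (iexp (x \<bullet> t) * complex_of_real (?E t))) \<le> norm (Q * ?E t)" for t
    proof -
      have "norm (complex_of_real (high ((norm t)\<^sup>2)) * (iexp (x \<bullet> t) * complex_of_real (?E t))) = \<bar>high ((norm t)\<^sup>2)\<bar> * ?E t"
        by (simp add: norm_mult)
      then show ?thesis
        using \<open>\<And>t. \<bar>high ((norm t)\<^sup>2)\<bar> * ?E t \<le> Q * ?E t\<close>[of t] abs_ge_self[of "Q * ?E t"]
        unfolding real_norm_def by linarith
    qed
    then show "AE t in lborel. norm (complex_of_real (high ((norm t)\<^sup>2)) * (iexp (x \<bullet> t) * complex_of_real (?E t))) \<le> norm (Q * ?E t)"
      by (rule AE_I2)
  qed measurable
  let ?f = "\<lambda>t u. complex_of_real (indicator {0<..1} u * S u * exp (- (norm t)\<^sup>2 * u)) * (iexp (x \<bullet> t) * complex_of_real (?E t))"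
  have F: "integrable (lborel \<Otimes>\<^sub>M lborel) (case_prod ?f)"
  proof (rule lborel_pair.Fubini_integrable)
    show "case_prod ?f \<in> borel_measurable (lborel \<Otimes>\<^sub>M lborel)"
      unfolding case_prod_beta by measurable
    have int: "integrable lborel (\<lambda>u. indicator {0<..1} u * (S u * exp (- (norm t)\<^sup>2 * u)))" for t :: 'a
      using S_weight(1)[of "\<lambda>u. exp (- (norm t)\<^sup>2 * u)" 1] by (simp add: set_integrable_def)
    have intc: "integrable lborel (?f t)" for t
      using integrable_mult_left[OF integrable_of_real[OF int[of t]], of "iexp (x \<bullet> t) * complex_of_real (?E t)"]
      by (simp only: mult.assoc)
    then show "AE t in lborel. integrable lborel (\<lambda>u. case_prod ?f (t, u))" by simp
    have le: "(\<integral>u. norm (?f t u) \<partial>lborel) \<le> Q * ?E t" for t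
    proof -
      have "(\<integral>u. norm (?f t u) \<partial>lborel) \<le> (\<integral>u. (indicator {0<..1} u *\<^sub>R \<bar>S u\<bar>) * ?E t \<partial>lborel)"
      proof (rule integral_mono)
        show "integrable lborel (\<lambda>u. norm (?f t u))" by (rule integrable_norm[OF intc])
        show "integrable lborel (\<lambda>u. (indicator {0<..1} u *\<^sub>R \<bar>S u\<bar>) * ?E t)"
          using set_integrable_abs[OF S_integrable] unfolding set_integrable_def by (rule integrable_mult_left)
        fix u :: real
        have "\<bar>S u\<bar> * (exp (- (norm t)\<^sup>2 * u) * ?E t) \<le> \<bar>S u\<bar> * (1 * ?E t)" if "0 < u"
          using that by (intro mult_left_mono mult_right_mono) auto
        then show "norm (?f t u) \<le> (indicator {0<..1} u *\<^sub>R \<bar>S u\<bar>) * ?E t"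
          by (auto simp: indicator_def norm_mult abs_mult mult.assoc)
      qed
      also have "\<dots> = Q * ?E t" by (simp add: Q_def set_lebesgue_integral_def)
      finally show ?thesis .
    qed
    show "integrable lborel (\<lambda>t. \<integral>u. norm (case_prod ?f (t, u)) \<partial>lborel)"
    proof (rule Bochner_Integration.integrable_bound[OF integrable_mult_right[OF gi, of Q]])
      show "AE t in lborel. norm (\<integral>u. norm (case_prod ?f (t, u)) \<partial>lborel) \<le> norm (Q * ?E t)"
      proof (rule AE_I2)
        fix t
        have "0 \<le> (\<integral>u. norm (?f t u) \<partial>lborel)" by (rule Bochner_Integration.integral_nonneg) simp
        then show "norm (\<integral>u. norm (case_prod ?f (t, u)) \<partial>lborel) \<le> norm (Q * ?E t)"
          using le[of t] unfolding prod.case real_norm_def by linarith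
      qed
    qed measurable
  qed
  have "(\<integral>t. complex_of_real (high ((norm t)\<^sup>2)) * (iexp (x \<bullet> t) * complex_of_real (?E t)) \<partial>lborel) = (\<integral>t. \<integral>u. ?f t u \<partial>lborel \<partial>lborel)"
    unfolding integral_mult_left_zero integral_complex_of_real
    by (simp add: high_def set_lebesgue_integral_def mult.assoc)
  also have "\<dots> = (\<integral>u. \<integral>t. ?f t u \<partial>lborel \<partial>lborel)"
    by (rule lborel_pair.Fubini_integral[OF F, symmetric])
  also have "\<dots> = (\<integral>u. complex_of_real (indicator {0<..1} u *\<^sub>R (S u * ((pi / (u + \<epsilon>)) powr (DIM('a) / 2) * exp (- (norm x)\<^sup>2 / (4 * (u + \<epsilon>)))))) \<partial>lborel)"
  proof (rule Bochner_Integration.integral_cong[OF refl])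
    fix u :: real
    show "(\<integral>t. ?f t u \<partial>lborel) =
        complex_of_real (indicator {0<..1} u *\<^sub>R (S u * ((pi / (u + \<epsilon>)) powr (DIM('a) / 2) * exp (- (norm x)\<^sup>2 / (4 * (u + \<epsilon>))))))"
    proof (cases "u \<in> {0<..1}")
      case True
      then have ue: "0 < u + \<epsilon>" using e by simp
      have "?f t u = complex_of_real (S u) * (iexp (x \<bullet> t) * complex_of_real (exp (- (u + \<epsilon>) * (norm t)\<^sup>2)))" for t
      proof -
        have "exp (- (u + \<epsilon>) * (norm t)\<^sup>2) = exp (- (norm t)\<^sup>2 * u) * ?E t"
          by (simp add: algebra_simps flip: exp_add)
        then show ?thesis using True by (simp add: mult_ac)
      qed
      then show ?thesis
        using True by (simp only: integral_mult_right_zero gaussian_fourier(2)[OF ue]) simp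
    qed simp
  qed
  also have "\<dots> = complex_of_real (LINT u:{0<..1}|lborel. S u * ((pi / (u + \<epsilon>)) powr (DIM('a) / 2) * exp (- (norm x)\<^sup>2 / (4 * (u + \<epsilon>)))))"
    unfolding set_lebesgue_integral_def by (rule integral_complex_of_real)
  finally show "(\<integral>t. complex_of_real (high ((norm t)\<^sup>2)) * (iexp (x \<bullet> t) * complex_of_real (?E t)) \<partial>lborel) = \<dots>" .
qed

text \<open>For x \<noteq> 0 the factor exp(-|x|^2/(4w)) compensates the singularity w^(-n/2) of the
  heat kernel at w = 0, so a constant multiple of |S| is an integrable majorant.\<close>

lemma high_fourier_gauss_tendsto:
  fixes x :: "'a::euclidean_space" and \<epsilon> :: "nat \<Rightarrow> real"
  assumes x: "x \<noteq> 0" and pos: "\<And>k. 0 < \<epsilon> k" and le: "\<And>k. \<epsilon> k \<le> 1" and lim: "\<epsilon> \<longlonglongrightarrow> 0"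
  shows "(\<lambda>k. LINT u:{0<..1}|lborel. S u * ((pi / (u + \<epsilon> k)) powr (DIM('a) / 2) * exp (- (norm x)\<^sup>2 / (4 * (u + \<epsilon> k)))))
    \<longlonglongrightarrow> (LINT u:{0<..1}|lborel. S u * ((pi / u) powr (DIM('a) / 2) * exp (- (norm x)\<^sup>2 / (4 * u))))"
proof -
  define b where "b = (norm x)\<^sup>2 / 4"
  define s where "s = real DIM('a) / 2"
  have b: "0 < b" and s: "0 \<le> s" using x by (auto simp: b_def s_def)
  obtain M where M: "\<And>w. 0 < w \<Longrightarrow> w \<le> 2 \<Longrightarrow> w powr (- s) * exp (- b / w) \<le> M"
    using powr_exp_inverse_bounded[OF b s] by blast
  let ?w = "\<lambda>w. (pi / w) powr s * exp (- (norm x)\<^sup>2 / (4 * w))"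
  have w: "?w w = pi powr s * (w powr (- s) * exp (- b / w))" if "0 < w" for w
    using that by (simp add: b_def powr_divide powr_minus_divide)
  have wb: "\<bar>?w w\<bar> \<le> pi powr s * M" if "0 < w" "w \<le> 2" for w
    using M[OF that] unfolding w[OF that(1)] by (simp add: mult_left_mono)
  show ?thesis
    unfolding s_def[symmetric] set_lebesgue_integral_def
  proof (rule integral_dominated_convergence[where w = "\<lambda>u. indicator {0<..1} u *\<^sub>R (\<bar>S u\<bar> * (pi powr s * M))"])
    show "integrable lborel (\<lambda>u. indicator {0<..1} u *\<^sub>R (\<bar>S u\<bar> * (pi powr s * M)))"
      using set_integrable_mult_left[OF set_integrable_abs[OF S_integrable]] unfolding set_integrable_def .
    show "AE u in lborel. (\<lambda>k. indicator {0<..1} u *\<^sub>R (S u * ?w (u + \<epsilon> k))) \<longlonglongrightarrow> indicator {0<..1} u *\<^sub>R (S u * ?w u)"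
    proof (rule AE_I2)
      fix u :: real
      show "(\<lambda>k. indicator {0<..1} u *\<^sub>R (S u * ?w (u + \<epsilon> k))) \<longlonglongrightarrow> indicator {0<..1} u *\<^sub>R (S u * ?w u)"
      proof (cases "u \<in> {0<..1}")
        case True
        then have "u \<noteq> 0" by auto
        moreover have "(\<lambda>k. u + \<epsilon> k) \<longlonglongrightarrow> u" using tendsto_add[OF tendsto_const lim, of u] by simp
        ultimately have "(\<lambda>k. ?w (u + \<epsilon> k)) \<longlonglongrightarrow> ?w u"
          by (intro tendsto_intros) auto
        then show ?thesis by (rule tendsto_scaleR[OF tendsto_const tendsto_mult[OF tendsto_const]])
      qed simp
    qed
    fix k
    show "AE u in lborel. norm (indicator {0<..1} u *\<^sub>R (S u * ?w (u + \<epsilon> k))) \<le> indicator {0<..1} u *\<^sub>R (\<bar>S u\<bar> * (pi powr s * M))"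
    proof (rule AE_I2)
      fix u :: real
      have "\<bar>S u\<bar> * \<bar>?w (u + \<epsilon> k)\<bar> \<le> \<bar>S u\<bar> * (pi powr s * M)" if "u \<in> {0<..1}"
        using that pos[of k] le[of k] by (intro mult_left_mono wb) auto
      then show "norm (indicator {0<..1} u *\<^sub>R (S u * ?w (u + \<epsilon> k))) \<le> indicator {0<..1} u *\<^sub>R (\<bar>S u\<bar> * (pi powr s * M))"
        by (cases "u \<in> {0<..1}") (simp_all add: abs_mult)
    qed
  qed measurable
qed

lemma low_fourier_gauss_tendsto:
  fixes x :: "'a::euclidean_space" and \<epsilon> :: "nat \<Rightarrow> real"
  assumes pos: "\<And>k. 0 < \<epsilon> k" and lim: "\<epsilon> \<longlonglongrightarrow> 0"
  shows "(\<lambda>k. \<integral>t. complex_of_real (low ((norm t)\<^sup>2)) * (iexp (x \<bullet> t) * complex_of_real (exp (- \<epsilon> k * (norm t)\<^sup>2))) \<partial>lborel)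
      \<longlonglongrightarrow> (\<integral>t. iexp (x \<bullet> t) * complex_of_real (low ((norm t)\<^sup>2)) \<partial>lborel)"
    and "\<And>k. integrable lborel (\<lambda>t. complex_of_real (low ((norm t)\<^sup>2)) * (iexp (x \<bullet> t) * complex_of_real (exp (- \<epsilon> k * (norm t)\<^sup>2))))"
proof -
  obtain C where C: "\<And>y. 0 \<le> y \<Longrightarrow> \<bar>low y\<bar> \<le> C * exp (- y)" using low_bound by blast
  let ?s = "\<lambda>k t. complex_of_real (low ((norm t)\<^sup>2)) * (iexp (x \<bullet> t) * complex_of_real (exp (- \<epsilon> k * (norm t)\<^sup>2)))"
  let ?f = "\<lambda>t. iexp (x \<bullet> t) * complex_of_real (low ((norm t)\<^sup>2))"
  have wi: "integrable lborel (\<lambda>t::'a. C * exp (- 1 * (norm t)\<^sup>2))"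
    by (intro integrable_mult_right gaussian_integral) simp
  have mf: "?f \<in> borel_measurable lborel" by measurable
  have ms: "?s k \<in> borel_measurable lborel" for k by measurable
  have l: "AE t in lborel. (\<lambda>k. ?s k t) \<longlonglongrightarrow> ?f t"
  proof (rule AE_I2)
    fix t :: 'a
    have "(\<lambda>k. ?s k t) \<longlonglongrightarrow> complex_of_real (low ((norm t)\<^sup>2)) * (iexp (x \<bullet> t) * complex_of_real (exp (- 0 * (norm t)\<^sup>2)))"
      by (intro tendsto_intros lim)
    then show "(\<lambda>k. ?s k t) \<longlonglongrightarrow> ?f t" by (simp add: mult.commute)
  qed
  have bd: "AE t in lborel. norm (?s k t) \<le> C * exp (- 1 * (norm t)\<^sup>2)" for k
  proof (rule AE_I2)
    fix t :: 'a
    have "norm (?s k t) = \<bar>low ((norm t)\<^sup>2)\<bar> * exp (- \<epsilon> k * (norm t)\<^sup>2)" by (simp add: norm_mult)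
    also have "\<dots> \<le> \<bar>low ((norm t)\<^sup>2)\<bar>" using pos[of k] by (intro mult_left_le) auto
    also have "\<dots> \<le> C * exp (- 1 * (norm t)\<^sup>2)" using C[of "(norm t)\<^sup>2"] by simp
    finally show "norm (?s k t) \<le> C * exp (- 1 * (norm t)\<^sup>2)" .
  qed
  show "(\<lambda>k. \<integral>t. ?s k t \<partial>lborel) \<longlonglongrightarrow> (\<integral>t. ?f t \<partial>lborel)"
    by (rule integral_dominated_convergence[OF mf ms wi l bd])
  show "integrable lborel (?s k)" for k
    by (rule integrable_dominated_convergence2[OF mf ms wi l bd])
qed

lemma density_decomposition:
  fixes p :: "'a::euclidean_space \<Rightarrow> real"
  defines "n \<equiv> real DIM('a)"
  assumes p: "integrable lborel p" and nonneg: "\<And>y. 0 \<le> p y" and cont: "isCont p x" and x: "x \<noteq> 0"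
    and cf: "\<And>t. (\<integral>y. iexp (y \<bullet> t) * complex_of_real (p y) \<partial>lborel) =
      complex_of_real ((1 + ((norm t)\<^sup>2) powr a) powr (- \<nu>))"
  shows "p x = (2 * pi) powr (- n) *
    ((LINT u:{0<..1}|lborel. S u * ((pi / u) powr (n / 2) * exp (- (norm x)\<^sup>2 / (4 * u)))) +
     Re (\<integral>t. iexp (- x \<bullet> t) * complex_of_real (low ((norm t)\<^sup>2)) \<partial>lborel))"
proof -
  define \<epsilon> where "\<epsilon> k = inverse (real (Suc k))" for k
  have pos: "0 < \<epsilon> k" and le: "\<epsilon> k \<le> 1" for k
    by (simp_all add: \<epsilon>_def inverse_le_1_iff)
  have lim: "\<epsilon> \<longlonglongrightarrow> 0"
    unfolding \<epsilon>_def by (rule LIMSEQ_inverse_real_of_nat)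
  let ?P = "\<lambda>k. (4 * pi * \<epsilon> k) powr (- (DIM('a) / 2)) * (\<integral>y. p y * exp (- (norm (y - x))\<^sup>2 / (4 * \<epsilon> k)) \<partial>lborel)"
  define A where "A k = (LINT u:{0<..1}|lborel. S u * ((pi / (u + \<epsilon> k)) powr (DIM('a) / 2) * exp (- (norm (- x))\<^sup>2 / (4 * (u + \<epsilon> k)))))" for k
  let ?Ainf = "LINT u:{0<..1}|lborel. S u * ((pi / u) powr (DIM('a) / 2) * exp (- (norm (- x))\<^sup>2 / (4 * u)))"
  let ?E = "\<lambda>k t. iexp (- x \<bullet> t) * complex_of_real (exp (- \<epsilon> k * (norm t)\<^sup>2))"
  let ?B = "\<lambda>k. \<integral>t. complex_of_real (low ((norm t)\<^sup>2)) * ?E k t \<partial>lborel"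
  let ?Binf = "\<integral>t. iexp (- x \<bullet> t) * complex_of_real (low ((norm t)\<^sup>2)) \<partial>lborel"
  have eq: "complex_of_real (?P k) = complex_of_real ((2 * pi) powr (- n)) * (complex_of_real (A k) + ?B k)" for k
  proof -
    have "(\<integral>t. complex_of_real ((1 + ((norm t)\<^sup>2) powr a) powr (- \<nu>)) * ?E k t \<partial>lborel) =
        (\<integral>t. complex_of_real (high ((norm t)\<^sup>2)) * ?E k t + complex_of_real (low ((norm t)\<^sup>2)) * ?E k t \<partial>lborel)"
      by (simp add: low_def flip: distrib_right)
    also have "\<dots> = complex_of_real (A k) + ?B k"
      unfolding A_def high_fourier_gauss(2)[OF pos, symmetric]
      by (rule Bochner_Integration.integral_add[OF high_fourier_gauss(1)[OF pos] low_fourier_gauss_tendsto(2)[OF pos lim]])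
    finally show ?thesis
      unfolding gaussian_smoothing_fourier[OF p pos] cf n_def by (simp only:)
  qed
  have "(\<lambda>k. complex_of_real (?P k)) \<longlonglongrightarrow> complex_of_real (p x)"
    by (intro tendsto_of_real gaussian_approximate_identity p nonneg cont pos lim)
  moreover have "(\<lambda>k. complex_of_real (?P k)) \<longlonglongrightarrow> complex_of_real ((2 * pi) powr (- n)) * (complex_of_real ?Ainf + ?Binf)"
    unfolding eq A_def using x
    by (intro tendsto_mult tendsto_const tendsto_add tendsto_of_real high_fourier_gauss_tendsto low_fourier_gauss_tendsto pos le lim) simp
  ultimately have "complex_of_real (p x) = complex_of_real ((2 * pi) powr (- n)) * (complex_of_real ?Ainf + ?Binf)"
    by (rule LIMSEQ_unique)
  from arg_cong[OF this, of Re] show ?thesis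
    by (simp add: n_def)
qed


section \<open>Rearrangement of the double series\<close>

text \<open>Here \<open>b\<close> stands for |x|^2/4. The bracket is the gamma term of
  \<open>integral_powr_exp_inverse_sums\<close> at d = a(\<nu>+l) - n/2.\<close>

definition A1_coeff :: "real \<Rightarrow> real \<Rightarrow> nat \<Rightarrow> real" where
  "A1_coeff n b l = c l * (b powr (ex l - n / 2) * Gamma (n / 2 - ex l))"

text \<open>The weight of the j-th moment in \<open>radial_fourier_sums\<close>, without pi^(n/2),
  times the continued Mellin transform of (1 + x^a)^(-\<nu>) at n/2 + j.\<close>

definition A2_coeff :: "real \<Rightarrow> real \<Rightarrow> nat \<Rightarrow> real" where
  "A2_coeff n b j = (- b) ^ j / (fact j * Gamma (n / 2 + real j)) *
    (Gamma ((n / 2 + real j) / a) * Gamma (\<nu> - (n / 2 + real j) / a) / (a * Gamma \<nu>))"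

text \<open>The terms \<kappa> are summed in both orders. The sum over j for fixed l is c_l I_l
  minus the A1 term, the sum over l for fixed j is the A2 term minus the term L_j of the Fourier
  integral of \<open>low\<close>. Equality of the double sums, with the A1 terms and L moved to the
  other sides, is the claim.\<close>

lemma regrouped_series:
  fixes n b C :: real and k :: nat
  assumes n: "0 < n" and b: "0 < b" and C: "0 < C"
    and gap: "\<And>l j. C / (1 + real l) ^ k \<le> \<bar>ex l - (n / 2 + real j)\<bar>"
  shows "summable (\<lambda>l. \<bar>A1_coeff n b l\<bar>)" and "summable (\<lambda>j. \<bar>A2_coeff n b j\<bar>)"
    and "(LINT u:{0<..1}|lborel. S u * (u powr (- (n / 2)) * exp (- b / u))) +
      (\<Sum>j. (- b) ^ j / (fact j * Gamma (n / 2 + real j)) *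
        (LINT y:{0<..}|lborel. y powr (n / 2 + real j - 1) * low y)) =
      (\<Sum>l. A1_coeff n b l) + (\<Sum>j. A2_coeff n b j)"
proof -
  define z where "z j = n / 2 + real j" for j
  define N where "N j = (LINT y:{0<..}|lborel. y powr (z j - 1) * low y)" for j
  define d where "d l = ex l - n / 2" for l
  define \<kappa> where "\<kappa> l j = c l * ((- b) ^ j / fact j / (d l - real j))" for l j
  define L where "L j = (- b) ^ j / (fact j * Gamma (z j)) * N j" for j
  define I where "I l = (LINT u:{0<..1}|lborel. u powr (d l - 1) * exp (- b / u))" for l
  have z: "0 < z j" for j using n by (simp add: z_def)
  have gap': "0 < \<bar>d l - real j\<bar>" "C / (1 + real l) ^ k \<le> \<bar>d l - real j\<bar>" for l j
  proof -
    show g: "C / (1 + real l) ^ k \<le> \<bar>d l - real j\<bar>" using gap[of l j] by (simp add: d_def algebra_simps)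
    have "0 < C / (1 + real l) ^ k" using C by simp
    then show "0 < \<bar>d l - real j\<bar>" using g by linarith
  qed
  have dN: "d l \<notin> \<nat>" for l using gap'(1)[of l] by (auto elim!: Nats_cases)
  have zne: "z j \<noteq> ex l" for j l using gap'(1)[of l j] by (auto simp: d_def z_def)
  \<comment> \<open>Since the bound for the denominator does not depend on j, the majorant is a
    product of a sequence in l and a sequence in j, as \<open>suminf_swap_dominated\<close>
    requires.\<close>
  have \<kappa>_bound: "\<bar>\<kappa> l j\<bar> \<le> (\<bar>c l\<bar> * (1 + real l) ^ k / C) * (b ^ j / fact j)" for l j
  proof -
    have "1 / \<bar>d l - real j\<bar> \<le> 1 / (C / (1 + real l) ^ k)"
      using gap'[of l j] C by (intro divide_left_mono) (auto intro!: mult_pos_pos)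
    then have "(\<bar>c l\<bar> * (b ^ j / fact j)) * (1 / \<bar>d l - real j\<bar>) \<le> (\<bar>c l\<bar> * (b ^ j / fact j)) * (1 / (C / (1 + real l) ^ k))"
      by (rule mult_left_mono) (use b in auto)
    then show ?thesis
      using b by (simp add: \<kappa>_def abs_mult power_abs mult_ac)
  qed
  have sA: "summable (\<lambda>l. \<bar>c l\<bar> * (1 + real l) ^ k / C)"
    by (rule summable_divide[OF summable_ml_coeff[OF a nu]])
  note sw = suminf_swap_dominated[of \<kappa>, OF \<kappa>_bound sA summable_power_div_fact]
  have sw1: "(\<lambda>l. \<Sum>j. \<kappa> l j) sums (\<Sum>j. \<Sum>l. \<kappa> l j)" "summable (\<lambda>l. \<bar>\<Sum>j. \<kappa> l j\<bar>)" "summable (\<lambda>j. \<bar>\<Sum>l. \<kappa> l j\<bar>)"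
    using sw b by simp_all
  have row: "(\<Sum>j. \<kappa> l j) = c l * I l - A1_coeff n b l" for l
  proof -
    have "(\<lambda>j. \<kappa> l j) sums (c l * (I l - b powr d l * Gamma (- d l)))"
      unfolding \<kappa>_def I_def by (intro sums_mult integral_powr_exp_inverse_sums b dN)
    then show ?thesis by (simp add: sums_iff A1_coeff_def d_def right_diff_distrib)
  qed
  have col: "(\<Sum>l. \<kappa> l j) = A2_coeff n b j - L j" for j
  proof -
    have "(\<lambda>l. (- b) ^ j / fact j * (c l / (ex l - z j))) sums ((- b) ^ j / fact j *
        ((Gamma (z j / a) * Gamma (\<nu> - z j / a) / (a * Gamma \<nu>) - N j) / Gamma (z j)))"
      unfolding N_def by (intro sums_mult low_mellin_sums z zne)
    moreover have "(- b) ^ j / fact j * (c l / (ex l - z j)) = \<kappa> l j" for l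
      by (simp add: \<kappa>_def d_def z_def algebra_simps)
    moreover have "(- b) ^ j / fact j * ((Gamma (z j / a) * Gamma (\<nu> - z j / a) / (a * Gamma \<nu>) - N j) / Gamma (z j)) = A2_coeff n b j - L j"
    proof -
      have "B / F * ((X - Y) / G) = B / (F * G) * X - B / (F * G) * Y" for B F X Y G :: real
        by (simp add: diff_divide_distrib right_diff_distrib)
      then show ?thesis unfolding A2_coeff_def L_def z_def .
    qed
    ultimately show ?thesis by (simp only: sums_iff)
  qed
  obtain M where M: "\<And>w. 0 < w \<Longrightarrow> w \<le> 2 \<Longrightarrow> w powr (- (n / 2)) * exp (- b / w) \<le> M"
    using powr_exp_inverse_bounded[OF b, of "n / 2"] n by (metis half_gt_zero less_imp_le)
  have wM: "\<bar>u powr (- (n / 2)) * exp (- b / u)\<bar> \<le> M" if "u \<in> {0<..1}" for u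
    using M[of u] that by simp
  have Ieq: "(LINT u:{0<..1}|lborel. u powr (ex l - 1) * (u powr (- (n / 2)) * exp (- b / u))) = I l" for l
    unfolding I_def
  proof (rule set_lebesgue_integral_cong)
    have "u powr (ex l - 1) * u powr (- (n / 2)) = u powr (d l - 1)" for u
      by (simp add: d_def flip: powr_add) (simp add: algebra_simps)
    then show "\<forall>u. u \<in> {0<..1} \<longrightarrow> u powr (ex l - 1) * (u powr (- (n / 2)) * exp (- b / u)) = u powr (d l - 1) * exp (- b / u)"
      by (simp only: mult.assoc[symmetric]) simp
  qed simp
  have wmeas: "(\<lambda>u. u powr (- (n / 2)) * exp (- b / u)) \<in> borel_measurable borel" by measurable
  note SI = S_weight(2,3)[OF wmeas wM, unfolded Ieq]
  \<comment> \<open>By \<open>row\<close> the A1 term is a difference of two absolutely summable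
    sequences. This is how its convergence is obtained, with no direct estimate of Gamma at the
    negative arguments; A2 is treated likewise through \<open>col\<close>.\<close>
  have "summable (\<lambda>l. \<bar>c l * I l\<bar> + \<bar>\<Sum>j. \<kappa> l j\<bar>)" by (intro summable_add SI(2) sw1(2))
  then show s1: "summable (\<lambda>l. \<bar>A1_coeff n b l\<bar>)"
    by (rule summable_comparison_test'[of _ 0]) (simp add: row)
  obtain D where D: "\<And>y. 0 \<le> y \<Longrightarrow> \<bar>low y\<bar> \<le> D * exp (- y)" using low_bound by blast
  have sL: "summable (\<lambda>j. \<bar>L j\<bar>)"
  proof (rule summable_comparison_test'[of _ 0])
    show "summable (\<lambda>j. D * (b ^ j / fact j))" by (intro summable_mult summable_power_div_fact)
    fix j
    have Gp: "0 < Gamma (z j)" using z by (rule Gamma_real_pos)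
    have "\<bar>N j\<bar> \<le> D * (Gamma (z j) * 1 powr (- z j))"
      unfolding N_def by (rule abs_mellin_le[OF low_mellin_integrable[OF z] z zero_less_one]) (use D in simp)
    then have "b ^ j / (fact j * Gamma (z j)) * \<bar>N j\<bar> \<le> b ^ j / (fact j * Gamma (z j)) * (D * Gamma (z j))"
      using b Gp by (intro mult_left_mono) auto
    also have "\<dots> = D * (b ^ j / fact j)" using Gp by simp
    finally show "norm \<bar>L j\<bar> \<le> D * (b ^ j / fact j)"
      using b Gp by (simp add: L_def abs_mult power_abs)
  qed
  have "summable (\<lambda>j. \<bar>\<Sum>l. \<kappa> l j\<bar> + \<bar>L j\<bar>)" by (intro summable_add sL sw1(3))
  then show s2: "summable (\<lambda>j. \<bar>A2_coeff n b j\<bar>)"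
    by (rule summable_comparison_test'[of _ 0]) (simp add: col)
  have "(\<lambda>l. A1_coeff n b l + (\<Sum>j. \<kappa> l j)) sums ((\<Sum>l. A1_coeff n b l) + (\<Sum>j. \<Sum>l. \<kappa> l j))"
    by (intro sums_add sw1(1) summable_sums summable_rabs_cancel[OF s1])
  then have "(\<lambda>l. c l * I l) sums ((\<Sum>l. A1_coeff n b l) + (\<Sum>j. \<Sum>l. \<kappa> l j))" by (simp add: row)
  from sums_unique2[OF SI(1) this]
  have A: "(LINT u:{0<..1}|lborel. S u * (u powr (- (n / 2)) * exp (- b / u))) = (\<Sum>l. A1_coeff n b l) + (\<Sum>j. A2_coeff n b j - L j)"
    by (simp add: col)
  have "(\<Sum>j. A2_coeff n b j - L j) = (\<Sum>j. A2_coeff n b j) - (\<Sum>j. L j)"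
    by (rule suminf_diff[OF summable_rabs_cancel[OF s2] summable_rabs_cancel[OF sL], symmetric])
  with A show "(LINT u:{0<..1}|lborel. S u * (u powr (- (n / 2)) * exp (- b / u))) +
      (\<Sum>j. (- b) ^ j / (fact j * Gamma (n / 2 + real j)) *
        (LINT y:{0<..}|lborel. y powr (n / 2 + real j - 1) * low y)) =
      (\<Sum>l. A1_coeff n b l) + (\<Sum>j. A2_coeff n b j)"
    by (simp add: L_def N_def z_def)
qed

text \<open>Both parts of \<open>density_decomposition\<close> carry pi^(n/2), one from the heat
  kernels and the other from \<open>radial_fourier_sums\<close>; together with the inversion
  constant (2 pi)^(-n) it becomes (4 pi)^(-n/2).\<close>

lemma density_eq_series:
  fixes p :: "'a::euclidean_space \<Rightarrow> real" and C :: real and k :: nat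
  defines "n \<equiv> real DIM('a)"
  assumes p: "integrable lborel p" and nonneg: "\<And>y. 0 \<le> p y" and cont: "isCont p x" and x: "x \<noteq> 0"
    and cf: "\<And>t. (\<integral>y. iexp (y \<bullet> t) * complex_of_real (p y) \<partial>lborel) =
      complex_of_real ((1 + ((norm t)\<^sup>2) powr a) powr (- \<nu>))"
    and C: "0 < C" and gap: "\<And>l j. C / (1 + real l) ^ k \<le> \<bar>ex l - (n / 2 + real j)\<bar>"
  shows "p x = (4 * pi) powr (- (n / 2)) *
    ((\<Sum>l. A1_coeff n ((norm x)\<^sup>2 / 4) l) + (\<Sum>j. A2_coeff n ((norm x)\<^sup>2 / 4) j))"
proof -
  define b where "b = (norm x)\<^sup>2 / 4"
  have b: "0 < b" using x by (simp add: b_def)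
  have n: "0 < n" by (simp add: n_def)
  let ?L = "\<lambda>j. (- b) ^ j / (fact j * Gamma (n / 2 + real j)) *
        (LINT y:{0<..}|lborel. y powr (n / 2 + real j - 1) * low y)"
  obtain D where D: "\<And>y. 0 \<le> y \<Longrightarrow> \<bar>low y\<bar> \<le> D * exp (- y)" using low_bound by blast
  note R = radial_fourier_sums[OF continuous_on_low D low_measurable low_mellin_integrable, of "- x"]
  have "P * B / F * X = P * (B / F * X)" for P B F X :: real by simp
  then have "(\<lambda>j. pi powr (n / 2) * ?L j) sums Re (\<integral>t. iexp (- x \<bullet> t) * complex_of_real (low ((norm t)\<^sup>2)) \<partial>lborel)"
    using R(2) unfolding norm_minus_cancel n_def[symmetric] b_def[symmetric] by (simp only:)
  from sums_mult_D[OF this]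
  have Re_eq: "Re (\<integral>t. iexp (- x \<bullet> t) * complex_of_real (low ((norm t)\<^sup>2)) \<partial>lborel) = pi powr (n / 2) * (\<Sum>j. ?L j)"
    by (auto simp: sums_iff)
  have "(LINT u:{0<..1}|lborel. S u * ((pi / u) powr (n / 2) * exp (- (norm x)\<^sup>2 / (4 * u)))) =
      (LINT u:{0<..1}|lborel. pi powr (n / 2) * (S u * (u powr (- (n / 2)) * exp (- b / u))))"
    by (rule set_lebesgue_integral_cong) (auto simp: b_def powr_divide powr_minus_divide)
  then have A_eq: "(LINT u:{0<..1}|lborel. S u * ((pi / u) powr (n / 2) * exp (- (norm x)\<^sup>2 / (4 * u)))) =
      pi powr (n / 2) * (LINT u:{0<..1}|lborel. S u * (u powr (- (n / 2)) * exp (- b / u)))"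
    unfolding set_integral_mult_right .
  have "p x = (2 * pi) powr (- n) * (pi powr (n / 2) *
      ((LINT u:{0<..1}|lborel. S u * (u powr (- (n / 2)) * exp (- b / u))) + (\<Sum>j. ?L j)))"
    using density_decomposition[OF p nonneg cont x cf] unfolding n_def[symmetric] Re_eq A_eq
    by (simp only: distrib_left)
  also have "\<dots> = ((2 * pi) powr (- n) * pi powr (n / 2)) * ((\<Sum>l. A1_coeff n b l) + (\<Sum>j. A2_coeff n b j))"
    unfolding regrouped_series(3)[OF n b C gap] by (simp only: mult.assoc)
  also have "(2 * pi) powr (- n) * pi powr (n / 2) = (4 * pi) powr (- (n / 2))"
  proof -
    have "(2 * pi) powr (- n) = (2 * pi) powr (2 * (- (n / 2)))" by simp
    also have "\<dots> = ((2 * pi) powr 2) powr (- (n / 2))" by (simp only: powr_powr)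
    also have "(2 * pi) powr 2 = (4 * pi) * pi" by (simp add: power2_eq_square)
    also have "\<dots> powr (- (n / 2)) = (4 * pi) powr (- (n / 2)) * pi powr (- (n / 2))"
      by (subst powr_mult) auto
    finally show ?thesis by (simp add: powr_minus)
  qed
  finally show ?thesis by (simp only: b_def)
qed

end

section \<open>From the coefficients to the stated series\<close>

lemma integrable_prob_density:
  fixes p :: "'a::euclidean_space \<Rightarrow> real"
  assumes [measurable]: "p \<in> borel_measurable borel" and nonneg: "\<And>x. 0 \<le> p x"
    and prob: "prob_space (density lborel (\<lambda>x. ennreal (p x)))"
  shows "integrable lborel p"
proof (rule integrableI_nonneg)
  have "(\<integral>\<^sup>+ x. ennreal (p x) \<partial>lborel) = emeasure (density lborel (\<lambda>x. ennreal (p x))) UNIV"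
    by (simp add: emeasure_density)
  also have "\<dots> = 1" using prob_space.emeasure_space_1[OF prob] by simp
  finally show "(\<integral>\<^sup>+ x. ennreal (p x) \<partial>lborel) < \<infinity>" by simp
qed (use nonneg in auto)

lemma power_series_entire:
  fixes w :: "nat \<Rightarrow> complex"
  assumes "\<And>z. summable (\<lambda>l. norm (w l * z ^ l))"
  shows "(\<lambda>z. \<Sum>l. w l * z ^ l) holomorphic_on UNIV"
proof -
  have "summable (\<lambda>l. w l * z ^ l)" for z by (rule summable_norm_cancel[OF assms])
  then have "DERIV (\<lambda>z. \<Sum>l. w l * z ^ l) z :> (\<Sum>l. diffs w l * z ^ l)" for z
    by (rule termdiffs_strong_converges_everywhere)
  then show ?thesis by (auto simp: holomorphic_on_def field_differentiable_def intro: DERIV_subset)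
qed

lemma gbinomial_minus_Gamma:
  fixes \<nu> :: real
  assumes "0 < \<nu>"
  shows "Gamma \<nu> * (- \<nu> gchoose l) = (- 1) ^ l / fact l * Gamma (\<nu> + real l)"
proof -
  have "pochhammer \<nu> l = Gamma (\<nu> + real l) / Gamma \<nu>"
    using assms by (intro pochhammer_Gamma) (force elim: nonpos_Ints_cases')
  moreover have "0 < Gamma \<nu>" using assms by (rule Gamma_real_pos)
  ultimately show ?thesis by (simp add: gbinomial_pochhammer)
qed

context ml_param
begin

text \<open>\<open>A1_coeff\<close> contains (r^2/4)^(a(\<nu>+l) - n/2) = (r/2)^(2a(\<nu>+l) - n).
  The factor (r/2)^(n - 2a\<nu>) removes the part independent of l, which the final formula keeps
  outside the entire function.\<close>

lemma A1_term_eq: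
  assumes r: "0 < r"
  shows "A1_term (2 * a) \<nu> n (complex_of_real (r powr (2 * a))) l =
    complex_of_real (Gamma \<nu> * (r / 2) powr (real n - 2 * a * \<nu>) * A1_coeff (real n) (r\<^sup>2 / 4) l)"
proof -
  have "A1_coeff (real n) (r\<^sup>2 / 4) l = (- \<nu> gchoose l) / Gamma (ex l) * ((r / 2) powr (2 * ex l - real n) * Gamma (real n / 2 - ex l))"
  proof -
    have "(r\<^sup>2 / 4) powr (ex l - real n / 2) = ((r / 2) powr 2) powr (ex l - real n / 2)"
      using r by (simp add: power_divide)
    also have "\<dots> = (r / 2) powr (2 * (ex l - real n / 2))" by (simp only: powr_powr)
    also have "2 * (ex l - real n / 2) = 2 * ex l - real n" by simp
    finally show ?thesis by (simp add: A1_coeff_def ml_coeff_def)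
  qed
  moreover have "(r / 2) powr (real n - 2 * a * \<nu>) * (r / 2) powr (2 * ex l - real n) = (r powr (2 * a)) ^ l / 2 powr (2 * a * real l)"
  proof -
    have "(r / 2) powr (real n - 2 * a * \<nu>) * (r / 2) powr (2 * ex l - real n) = (r / 2) powr (2 * a * real l)"
      by (simp flip: powr_add) (simp add: algebra_simps)
    also have "\<dots> = r powr (2 * a * real l) / 2 powr (2 * a * real l)" using r by (simp add: powr_divide)
    also have "r powr (2 * a * real l) = (r powr (2 * a)) ^ l" using r by (simp add: powr_powr flip: powr_realpow)
    finally show ?thesis .
  qed
  ultimately have "Gamma \<nu> * (r / 2) powr (real n - 2 * a * \<nu>) * A1_coeff (real n) (r\<^sup>2 / 4) l =
      (Gamma \<nu> * (- \<nu> gchoose l)) * (Gamma (real n / 2 - ex l) / Gamma (ex l)) * ((r powr (2 * a)) ^ l / 2 powr (2 * a * real l))"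
    by (simp add: mult_ac)
  moreover have "(real n - 2 * a * (\<nu> + real l)) / 2 = real n / 2 - ex l" "2 * a * (\<nu> + real l) / 2 = ex l"
    by (simp_all add: algebra_simps diff_divide_distrib)
  ultimately show ?thesis
    unfolding A1_term_def gbinomial_minus_Gamma[OF nu] by (simp only: of_real_mult of_real_divide of_real_power)
qed

lemma A2_term_eq:
  "A2_term (2 * a) \<nu> n (complex_of_real (r\<^sup>2)) j =
    complex_of_real (a * Gamma \<nu> * A2_coeff (real n) (r\<^sup>2 / 4) j)"
proof -
  have e: "(real n + 2 * real j) / (2 * a) = (real n / 2 + real j) / a" "(real n + 2 * real j) / 2 = real n / 2 + real j"
    "(2 * a * \<nu> - real n - 2 * real j) / (2 * a) = \<nu> - (real n / 2 + real j) / a"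
    using a by (simp_all add: field_simps)
  have b: "(r\<^sup>2) ^ j / 2 ^ (2 * j) = (r\<^sup>2 / 4) ^ j"
    by (simp add: power_mult power_divide)
  have "a * Gamma \<nu> * A2_coeff (real n) (r\<^sup>2 / 4) j =
      (- 1) ^ j / fact j * (Gamma ((real n / 2 + real j) / a) / Gamma (real n / 2 + real j)) *
        Gamma (\<nu> - (real n / 2 + real j) / a) * ((r\<^sup>2) ^ j / 2 ^ (2 * j))"
    using a Gamma_real_pos[OF nu] unfolding b power_minus[of "r\<^sup>2 / 4"] A2_coeff_def by simp
  then show ?thesis
    unfolding A2_term_def e by (simp add: mult_ac)
qed

end


theorem proposition4p5:
  fixes \<alpha> \<nu> :: real and e f :: nat
  assumes "1 \<le> e" and "1 \<le> f" and "coprime e f" and "\<nu> = real e / real f"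
    and "0 < \<alpha>" and "\<alpha> < 2" and "\<alpha> \<notin> \<rat>" and "\<not> liouville_number \<alpha>"
  shows "(\<forall>z. summable (\<lambda>l. norm (A1_term \<alpha> \<nu> CARD('n) z l))) \<and>
    (\<forall>z. summable (\<lambda>j. norm (A2_term \<alpha> \<nu> CARD('n) z j))) \<and>
    A1 \<alpha> \<nu> CARD('n) holomorphic_on UNIV \<and>
    A2 \<alpha> \<nu> CARD('n) holomorphic_on UNIV \<and>
    (\<forall>p :: real ^ 'n \<Rightarrow> real. linnik_density \<alpha> \<nu> p \<longrightarrow> (\<forall>r>0. complex_of_real (radial_part p r) =
      complex_of_real (1 / (2 ^ CARD('n) * pi powr (real CARD('n) / 2) * Gamma \<nu>)) *
      (complex_of_real (r powr (\<alpha> * \<nu> - real CARD('n)) / 2 powr (\<alpha> * \<nu> - real CARD('n))) *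
         A1 \<alpha> \<nu> CARD('n) (complex_of_real (r powr \<alpha>)) +
       A2 \<alpha> \<nu> CARD('n) (complex_of_real (r\<^sup>2)))))"
proof -
  define a where "a = \<alpha> / 2"
  define n where "n = CARD('n)"
  have n: "0 < real n" by (simp add: n_def)
  have \<alpha>: "\<alpha> = 2 * a" by (simp add: a_def)
  have nu: "0 < \<nu>" using assms by simp
  interpret ml_param a \<nu> by standard (use assms nu in \<open>simp_all add: a_def\<close>)
  obtain C k where C: "0 < C" and gap: "\<And>l j. C / (1 + real l) ^ k \<le> \<bar>ex l - (real n / 2 + real j)\<bar>"
    using not_liouville_gap[OF assms(1,2,4,7,8), of n] unfolding a_def by blast
  have Gnu: "0 < Gamma \<nu>" using nu by (rule Gamma_real_pos)
  have b: "0 < r\<^sup>2 / 4" if "0 < r" for r :: real using that by simp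
  note two = regrouped_series[OF n b C gap]
  have sA1: "summable (\<lambda>l. norm (A1_term \<alpha> \<nu> n z l))" for z
  proof -
    \<comment> \<open>Absolute convergence is known at the positive points r^\<alpha>, so a complex
      \<open>z\<close> is compared with r^\<alpha> = |z| + 1; the summand 1 keeps \<open>r\<close>
      positive at z = 0. For A2 the point is r^2 = |z| + 1.\<close>
    define r where "r = (norm z + 1) powr (1 / \<alpha>)"
    have z1: "0 < norm z + 1" by (simp add: add_nonneg_pos)
    then have r: "0 < r" by (simp add: r_def)
    have r\<alpha>: "r powr (2 * a) = norm z + 1"
      using assms(5) z1 by (simp add: r_def powr_powr flip: \<alpha>)
    show ?thesis
    proof (rule summable_comparison_test'[of _ 0])
      show "summable (\<lambda>l. norm (Gamma \<nu> * (r / 2) powr (real n - 2 * a * \<nu>)) * \<bar>A1_coeff (real n) (r\<^sup>2 / 4) l\<bar>)"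
        by (intro summable_mult two(1) r)
      fix l
      have "norm (A1_term \<alpha> \<nu> n z l) \<le> norm (A1_term (2 * a) \<nu> n (complex_of_real (r powr (2 * a))) l)"
        unfolding A1_term_def \<alpha> norm_mult norm_divide norm_power r\<alpha>
        by (intro mult_left_mono divide_right_mono power_mono) auto
      also have "\<dots> = norm (Gamma \<nu> * (r / 2) powr (real n - 2 * a * \<nu>)) * \<bar>A1_coeff (real n) (r\<^sup>2 / 4) l\<bar>"
        unfolding A1_term_eq[OF r] by (simp only: norm_of_real abs_mult real_norm_def)
      finally show "norm (norm (A1_term \<alpha> \<nu> n z l)) \<le> norm (Gamma \<nu> * (r / 2) powr (real n - 2 * a * \<nu>)) * \<bar>A1_coeff (real n) (r\<^sup>2 / 4) l\<bar>"
        by simp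
    qed
  qed
  have sA2: "summable (\<lambda>j. norm (A2_term \<alpha> \<nu> n z j))" for z
  proof -
    define r where "r = sqrt (norm z + 1)"
    have z1: "0 < norm z + 1" by (simp add: add_nonneg_pos)
    then have r: "0 < r" and r2: "r\<^sup>2 = norm z + 1" by (simp_all add: r_def)
    show ?thesis
    proof (rule summable_comparison_test'[of _ 0])
      show "summable (\<lambda>j. norm (a * Gamma \<nu>) * \<bar>A2_coeff (real n) (r\<^sup>2 / 4) j\<bar>)"
        by (intro summable_mult two(2) r)
      fix j
      have "norm (A2_term \<alpha> \<nu> n z j) \<le> norm (A2_term (2 * a) \<nu> n (complex_of_real (r\<^sup>2)) j)"
        unfolding A2_term_def \<alpha> norm_mult norm_divide norm_power r2
        by (intro mult_left_mono divide_right_mono power_mono) auto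
      also have "\<dots> = norm (a * Gamma \<nu>) * \<bar>A2_coeff (real n) (r\<^sup>2 / 4) j\<bar>"
        unfolding A2_term_eq by (simp only: norm_of_real abs_mult real_norm_def)
      finally show "norm (norm (A2_term \<alpha> \<nu> n z j)) \<le> norm (a * Gamma \<nu>) * \<bar>A2_coeff (real n) (r\<^sup>2 / 4) j\<bar>"
        by simp
    qed
  qed
  have h1: "A1 \<alpha> \<nu> n holomorphic_on UNIV"
  proof -
    \<comment> \<open>The value of a term at z = 1 is its coefficient.\<close>
    define w where "w l = A1_term \<alpha> \<nu> n 1 l" for l
    have w: "A1_term \<alpha> \<nu> n z = (\<lambda>l. w l * z ^ l)" for z
      by (simp add: fun_eq_iff w_def A1_term_def)
    have "(\<lambda>z. \<Sum>l. w l * z ^ l) holomorphic_on UNIV"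
      by (rule power_series_entire) (use sA1 in \<open>simp add: w\<close>)
    then show ?thesis by (simp only: A1_def[abs_def] w)
  qed
  have h2: "A2 \<alpha> \<nu> n holomorphic_on UNIV"
  proof -
    define w where "w j = A2_term \<alpha> \<nu> n 1 j" for j
    have w: "A2_term \<alpha> \<nu> n z = (\<lambda>j. w j * z ^ j)" for z
      by (simp add: fun_eq_iff w_def A2_term_def)
    have "(\<lambda>z. \<Sum>j. w j * z ^ j) holomorphic_on UNIV"
      by (rule power_series_entire) (use sA2 in \<open>simp add: w\<close>)
    then have "(\<lambda>z. complex_of_real (2 / \<alpha>) * (\<Sum>j. w j * z ^ j)) holomorphic_on UNIV"
      by (intro holomorphic_intros)
    then show ?thesis by (simp only: A2_def[abs_def] w)
  qed
  have "complex_of_real (radial_part p r) =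
      complex_of_real (1 / (2 ^ n * pi powr (real n / 2) * Gamma \<nu>)) *
      (complex_of_real (r powr (\<alpha> * \<nu> - real n) / 2 powr (\<alpha> * \<nu> - real n)) *
         A1 \<alpha> \<nu> n (complex_of_real (r powr \<alpha>)) + A2 \<alpha> \<nu> n (complex_of_real (r\<^sup>2)))"
    if lin: "linnik_density \<alpha> \<nu> p" and r: "0 < r" for p :: "real ^ 'n \<Rightarrow> real" and r
  proof -
    define X Y where "X = (\<Sum>l. A1_coeff (real n) (r\<^sup>2 / 4) l)" and "Y = (\<Sum>j. A2_coeff (real n) (r\<^sup>2 / 4) j)"
    define v where "v = (4 * pi) powr (- (real n / 2)) * (X + Y)"
    have p0: "0 \<le> p x" for x
      using lin by (auto simp: linnik_density_def)
    have pint: "integrable lborel p"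
      using lin p0 by (intro integrable_prob_density) (auto simp: linnik_density_def)
    have cf: "(\<integral>y. iexp (y \<bullet> t) * complex_of_real (p y) \<partial>lborel) =
        complex_of_real ((1 + ((norm t)\<^sup>2) powr a) powr (- \<nu>))" for t
    proof -
      have "((norm t)\<^sup>2) powr a = norm t powr \<alpha>"
      proof (cases "t = 0")
        case False
        then have "((norm t)\<^sup>2) powr a = (norm t powr 2) powr a" by simp
        then show ?thesis by (simp only: powr_powr \<alpha>)
      qed simp
      moreover have "(\<integral>y. iexp (y \<bullet> t) * complex_of_real (p y) \<partial>lborel) = complex_of_real ((1 + norm t powr \<alpha>) powr (- \<nu>))"
        using lin unfolding linnik_density_def by blast
      ultimately show ?thesis by (simp only:)
    qed
    \<comment> \<open>\<open>v\<close> depends on \<open>x\<close> through its norm only, so this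
      also shows that \<open>p\<close> is constant on the sphere.\<close>
    have val: "p x = v" if "norm x = r" for x
    proof -
      have x: "x \<noteq> 0" using that r by auto
      then have "isCont p x"
        using lin by (auto simp: linnik_density_def continuous_on_eq_continuous_at open_Compl)
      moreover have "C / (1 + real l) ^ k \<le> \<bar>ex l - (real DIM(real ^ 'n) / 2 + real j)\<bar>" for l j
        using gap[of l j] by (simp add: n_def)
      ultimately have "p x = (4 * pi) powr (- (real DIM(real ^ 'n) / 2)) *
          ((\<Sum>l. A1_coeff (real DIM(real ^ 'n)) ((norm x)\<^sup>2 / 4) l) + (\<Sum>j. A2_coeff (real DIM(real ^ 'n)) ((norm x)\<^sup>2 / 4) j))"
        by (rule density_eq_series[OF pint p0 _ x cf C])
      then show ?thesis
        by (simp add: v_def X_def Y_def that n_def)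
    qed
    \<comment> \<open>A point on the sphere makes the common value unique; without one the
      description in \<open>radial_part\<close> would be vacuous.\<close>
    obtain x0 :: "real ^ 'n" where "norm x0 = r" using vector_choose_size[of r] r by auto
    then have "radial_part p r = v"
      unfolding radial_part_def by (intro the_equality) (use val in auto)
    moreover have A1v: "A1 \<alpha> \<nu> n (complex_of_real (r powr \<alpha>)) = complex_of_real (Gamma \<nu> * (r / 2) powr (real n - 2 * a * \<nu>) * X)"
      unfolding A1_def \<alpha> A1_term_eq[OF r] X_def
      using two(1)[OF r] by (simp add: suminf_mult summable_rabs_cancel flip: suminf_of_real)
    moreover have A2v: "A2 \<alpha> \<nu> n (complex_of_real (r\<^sup>2)) = complex_of_real (Gamma \<nu> * Y)"
    proof -
      have "(\<Sum>j. complex_of_real (a * Gamma \<nu> * A2_coeff (real n) (r\<^sup>2 / 4) j)) = complex_of_real (a * Gamma \<nu> * Y)"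
        unfolding Y_def using two(2)[OF r] by (simp add: suminf_mult summable_rabs_cancel flip: suminf_of_real)
      then show ?thesis
        unfolding A2_def \<alpha> A2_term_eq using a by simp
    qed
    moreover have "v = 1 / (2 ^ n * pi powr (real n / 2) * Gamma \<nu>) *
        (r powr (\<alpha> * \<nu> - real n) / 2 powr (\<alpha> * \<nu> - real n) * (Gamma \<nu> * (r / 2) powr (real n - 2 * a * \<nu>) * X) + Gamma \<nu> * Y)"
    proof -
      have "r powr (\<alpha> * \<nu> - real n) / 2 powr (\<alpha> * \<nu> - real n) * (r / 2) powr (real n - 2 * a * \<nu>) = 1"
      proof -
        have "r powr (\<alpha> * \<nu> - real n) / 2 powr (\<alpha> * \<nu> - real n) = (r / 2) powr (\<alpha> * \<nu> - real n)"
          using r by (simp add: powr_divide)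
        then show ?thesis using r by (simp add: \<alpha> flip: powr_add)
      qed
      then have "r powr (\<alpha> * \<nu> - real n) / 2 powr (\<alpha> * \<nu> - real n) * (Gamma \<nu> * (r / 2) powr (real n - 2 * a * \<nu>) * X) = Gamma \<nu> * X"
        by (metis mult.assoc mult.left_commute mult_1_right)
      moreover have "(4 * pi) powr (- (real n / 2)) = 1 / (2 ^ n * pi powr (real n / 2))"
      proof -
        have "(4 * pi) powr (- (real n / 2)) = 4 powr (- (real n / 2)) * pi powr (- (real n / 2))"
          by (subst powr_mult) auto
        moreover have "4 powr (- (real n / 2)) = (2 powr 2) powr (- (real n / 2))" by simp
        moreover have "\<dots> = 2 powr (2 * - (real n / 2))" by (simp only: powr_powr)
        ultimately show ?thesis by (simp add: powr_minus_divide powr_realpow)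
      qed
      ultimately show ?thesis
        using Gnu by (simp add: v_def flip: distrib_left)
    qed
    ultimately show ?thesis by (simp only: of_real_mult of_real_add)
  qed
  then show ?thesis
    using sA1 sA2 h1 h2 unfolding n_def by blast
qed

end
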